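(* Let $N\ge 3$ be an integer. The vectors of asymptotic series $\Psi_N(\tau)=(\psi_k(\tau)-\psi_{N-k}(\tau))_{k\in G_N^+}$ and $\Phi_N(\tau)=(\varphi_k(\tau)-\varphi_{N-k}(\tau))_{k\in G_N^+}$ are both vector-valued modular resurgent series.
   Context: Notation. $\zeta_N=e^{2\pi i/N}$, $G_N=(\mathbb Z/N)^\times$, represented by integers in $\{1,\dots,N-1\}$ coprime to $N$; $G_N^+=\{a\in G_N:1\le a\le\lfloor N/2\rfloor\}$, of cardinality $r=\phi(N)/2$ ($\phi$ is Euler's totient). For $k\in G_N$, $$\psi_k(\tau)=\sum_{\ell\ge1}(2\pi i\tau)^{2\ell-1}\frac{B_{2\ell}}{(2\ell)!}\,\mathrm{Li}_{2-2\ell}(\zeta_N^k),\qquad \varphi_k(\tau)=\sum_{\ell\ge1}(2\pi i\tau)^{2\ell}\frac{B_{2\ell}\,B_{2\ell+1}(k/N)}{2\ell\,(2\ell+1)!},$$ where $B_\ell(x)$ are the Bernoulli polynomials, $B_\ell=B_\ell(0)$, and $\mathrm{Li}_\ell$ is the polylogarithm of order $\ell$. Borel transform and Stokes constants. A series $\phi(\tau)=\sum_{n\ge0}a_n\tau^{n+1}$ is Gevrey-1 if $|a_n|\le A^{-n}n!$ for some $A>0$; its Borel transform is $\mathcal B[\phi](\zeta)=\sum_{n\ge0}\frac{a_n}{n!}\zeta^n$, analytically continued in the $\zeta$-plane. If near $\zeta=\rho$ one has $\mathcal B[\phi](\zeta)=-\frac{S}{2\pi i(\zeta-\rho)}+(\text{regular})$,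 the resurgent series at $\rho$ is said to be the constant $S$, called the Stokes constant at $\rho$; the value $S=0$ (no actual pole) is allowed. $L$-functions. A Dirichlet series $\sum_{m\ge1}A_m m^{-s}$ is an $L$-function if it converges absolutely in some right half-plane, has an Euler product expansion there, and has a meromorphic continuation to a larger domain containing $\{\mathrm{Re}(s)<0\}$. Vector-valued modular resurgent series. A vector $(\phi_1,\dots,\phi_r)$ of Gevrey-1 series is a vector-valued modular resurgent series if: (1) there is $\mathcal A\in\mathbb C$ such that for every $k$ the Borel transform $\mathcal B[\phi_k]$ has a tower of singularities at $\rho_m=\mathcal A m$, $m\in\mathbb Z_{\ne0}$; (2) for every $k$ and $m\in\mathbb Z_{\neq0}$ the resurgent series of $\phi_k$ at $\rho_m$ is a constant $S_{k,m}\in\mathbb C$; put $\boldsymbol S_m=(S_{1,m},\dots,S_{r,m})$; (3) there exist vectors of $L$-functions $\boldsymbol L_\pm=(L_{1,\pm},\dots,L_{v,\pm})$, vectors $(c_{1,\pm},\dots,c_{v,\pm})\in\mathbb C^v$ and matrices $\mathbf M_\pm\in\mathrm{Mat}_{r\times v}(\mathbb C)$ such that the Dirichlet vectors $\boldsymbol{\mathcal L}_+(s)=\sum_{m\ge1}\boldsymbol S_m m^{-s}$ and $\boldsymbol{\mathcal L}_-(s)=-\sum_{m\ge1}\boldsymbol S_{-m}m^{-s}$ satisfy $\boldsymbol{\mathcal L}_\pm(s)=\mathbf M_\pm\,\mathrm{diag}(c_{1,\pm}^s,\dots,c_{v,\pm}^s)\,\boldsymbol L_\pm(s)$.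
   Formalization: Gevrey-1 is taken as |a_n| ≤ C A^{-n} n! with a constant C; without C it forces |a_0| ≤ 1, which fails for Ψ_N, where a_0 = -(π/6)cot(πk/N) (e.g. N=7, k=1). For n ≥ 1 the constant can be absorbed into A. *)

theory Defs
  imports "HOL-Complex_Analysis.Complex_Analysis"
begin

section \<open>Bernoulli polynomials and polylogarithms of integer order\<close>

text \<open>
  Generating function \<open>t e\<^bsup>xt\<^esup> / (e\<^bsup>t\<^esup> - 1) = (\<Sum>n. B\<^sub>n(x) t\<^bsup>n\<^esup> / n!)\<close>; in particular
  \<open>B\<^sub>1 = B\<^sub>1(0) = -1/2\<close>.
\<close>
definition bernoulli_poly :: "nat \<Rightarrow> complex \<Rightarrow> complex" where
  "bernoulli_poly n x = fact n * fps_nth (fps_X * fps_exp x / (fps_exp 1 - 1)) n"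

abbreviation bernoulli_number :: "nat \<Rightarrow> complex" where
  "bernoulli_number n \<equiv> bernoulli_poly n 0"

definition slit_plane :: "complex set" where
  "slit_plane = - {z. Im z = 0 \<and> Re z \<ge> 1}"

text \<open>
  The power series \<open>\<Sum>m\<ge>1. z\<^bsup>m\<^esup> / m\<^bsup>s\<^esup>\<close> on the unit disc, continued analytically to the plane
  slit along \<open>[1, \<infinity>)\<close>. The slit plane is connected, so the value is unique; it is only
  meaningful for \<open>z\<close> in the slit plane.
\<close>
definition polylog :: "int \<Rightarrow> complex \<Rightarrow> complex" where
  "polylog s z = (THE w. \<exists>f. f holomorphic_on slit_plane \<and>
     (\<forall>u\<in>ball 0 1. (\<lambda>m. u ^ Suc m / of_nat (Suc m) powi s) sums f u) \<and> w = f z)"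

section \<open>The asymptotic series\<close>

definition zeta_root :: "nat \<Rightarrow> complex" where
  "zeta_root N = exp (2 * of_real pi * \<i> / of_nat N)"

definition G_plus :: "nat \<Rightarrow> nat set" where
  "G_plus N = {a. 1 \<le> a \<and> a \<le> N div 2 \<and> coprime a N}"

text \<open>
  Series in \<open>\<tau>\<close> are formal power series. The coefficient of \<open>\<tau>\<^bsup>n\<^esup>\<close> is the summand with
  \<open>n = 2\<ell> - 1\<close> in \<open>psi_series\<close> and with \<open>n = 2\<ell>\<close> in \<open>phi_series\<close>, where \<open>\<ell> \<ge> 1\<close>.
\<close>
definition psi_series :: "nat \<Rightarrow> nat \<Rightarrow> complex fps" where
  "psi_series N k = Abs_fps (\<lambda>n. if odd n
     then (2 * of_real pi * \<i>) ^ n * (bernoulli_number (n + 1) / fact (n + 1))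
            * polylog (1 - int n) (zeta_root N ^ k)
     else 0)"

definition phi_series :: "nat \<Rightarrow> nat \<Rightarrow> complex fps" where
  "phi_series N k = Abs_fps (\<lambda>n. if even n \<and> n > 0
     then (2 * of_real pi * \<i>) ^ n
            * (bernoulli_number n * bernoulli_poly (n + 1) (of_nat k / of_nat N)
                 / (of_nat n * fact (n + 1)))
     else 0)"

section \<open>Borel transform and Stokes constants\<close>

text \<open>
  A series \<open>\<Sum>n. a\<^sub>n \<tau>\<^bsup>n+1\<^esup>\<close> has no constant term, and \<open>a\<^sub>n\<close> is its coefficient at \<open>Suc n\<close>.
  The multiplicative constant \<open>C\<close> is the usual convention for the Gevrey-1 bound
  \<open>|a\<^sub>n| \<le> A\<^bsup>-n\<^esup> n!\<close>: for \<open>n \<ge> 1\<close> it can be absorbed into \<open>A\<close>, so it only avoids the spurious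
  constraint \<open>|a\<^sub>0| \<le> 1\<close>.
\<close>
definition gevrey1 :: "complex fps \<Rightarrow> bool" where
  "gevrey1 \<phi> \<longleftrightarrow> fps_nth \<phi> 0 = 0 \<and>
     (\<exists>A>0. \<exists>C::real. \<forall>n. norm (fps_nth \<phi> (Suc n)) \<le> C * (fact n / A ^ n))"

definition borel :: "complex fps \<Rightarrow> complex fps" where
  "borel \<phi> = Abs_fps (\<lambda>n. fps_nth \<phi> (Suc n) / fact n)"

text \<open>
  All singularities of interest are at worst simple poles, so the continuation is a single-valued
  function \<open>f\<close> on the complement of the tower \<open>\<A> m\<close>, \<open>m \<noteq> 0\<close>.
\<close>
definition borel_continuation :: "complex fps \<Rightarrow> complex \<Rightarrow> (complex \<Rightarrow> complex) \<Rightarrow> bool" where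
  "borel_continuation \<phi> \<A> f \<longleftrightarrow>
     f holomorphic_on - {\<A> * of_int m |m. m \<noteq> 0} \<and> f has_fps_expansion borel \<phi>"

definition has_stokes_constant :: "(complex \<Rightarrow> complex) \<Rightarrow> complex \<Rightarrow> complex \<Rightarrow> bool" where
  "has_stokes_constant f \<rho> S \<longleftrightarrow>
     (\<exists>g. g analytic_on {\<rho>} \<and>
        (\<forall>\<^sub>F \<zeta> in at \<rho>. f \<zeta> = - (S / (2 * of_real pi * \<i> * (\<zeta> - \<rho>))) + g \<zeta>))"

section \<open>Dirichlet series and L-functions\<close>

text \<open>Coefficients are indexed by \<open>m \<ge> 1\<close>; the value at \<open>0\<close> is ignored.\<close>
definition dirichlet_series :: "(nat \<Rightarrow> complex) \<Rightarrow> complex \<Rightarrow> complex" where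
  "dirichlet_series A s = (\<Sum>m. A (Suc m) / of_nat (Suc m) powr s)"

definition dirichlet_abs_conv :: "(nat \<Rightarrow> complex) \<Rightarrow> complex \<Rightarrow> bool" where
  "dirichlet_abs_conv A s \<longleftrightarrow> summable (\<lambda>m. norm (A (Suc m) / of_nat (Suc m) powr s))"

text \<open>
  The Euler product is over primes \<open>p\<close> with local factors \<open>\<Sum>j\<ge>0. A(p\<^bsup>j\<^esup>) p\<^bsup>-js\<^esup>\<close>; since its factors
  tend to \<open>A 1\<close> along the primes, its convergence includes the normalization \<open>A 1 = 1\<close>. The
  domain \<open>D\<close> is connected, so that \<open>F\<close> really is a continuation of the Dirichlet series.
\<close>
definition L_function :: "(nat \<Rightarrow> complex) \<Rightarrow> bool" where
  "L_function A \<longleftrightarrow> (\<exists>\<sigma>::real.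
     (\<forall>s. Re s > \<sigma> \<longrightarrow> dirichlet_abs_conv A s) \<and>
     (\<forall>s. Re s > \<sigma> \<longrightarrow>
        (\<lambda>p. if prime p then (\<Sum>j. A (p ^ j) / of_nat (p ^ j) powr s) else 1)
          has_prod dirichlet_series A s) \<and>
     (\<exists>D F. open D \<and> connected D \<and> {s. Re s > \<sigma>} \<subseteq> D \<and> {s. Re s < 0} \<subseteq> D \<and>
        F meromorphic_on D \<and> (\<forall>s. Re s > \<sigma> \<longrightarrow> F s = dirichlet_series A s)))"

section \<open>Vector-valued modular resurgent series\<close>

text \<open>
  The identity \<open>\<L>(s) = M diag(c\<^sub>1\<^bsup>s\<^esup>, \<dots>, c\<^sub>v\<^bsup>s\<^esup>) L(s)\<close>, written out componentwise, for a vector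
  \<open>T\<close> of coefficient sequences indexed by \<open>I\<close>. It is an identity of absolutely convergent
  Dirichlet series on some right half-plane; powers \<open>c\<^bsup>s\<^esup>\<close> use the principal branch.
\<close>
definition L_decomposition :: "'i set \<Rightarrow> nat \<Rightarrow> ('i \<Rightarrow> nat \<Rightarrow> complex) \<Rightarrow> bool" where
  "L_decomposition I v T \<longleftrightarrow>
     (\<exists>(L :: nat \<Rightarrow> nat \<Rightarrow> complex) (c :: nat \<Rightarrow> complex) (M :: 'i \<Rightarrow> nat \<Rightarrow> complex).
        (\<forall>j<v. L_function (L j)) \<and>
        (\<exists>\<sigma>::real. \<forall>s. Re s > \<sigma> \<longrightarrow>
           (\<forall>j<v. dirichlet_abs_conv (L j) s) \<and>
           (\<forall>k\<in>I. dirichlet_abs_conv (T k) s \<and>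
              dirichlet_series (T k) s
                = (\<Sum>j<v. M k j * (c j powr s * dirichlet_series (L j) s)))))"

text \<open>
  The components of the vector are indexed by a finite set \<open>I\<close> of cardinality \<open>r\<close>. The condition
  \<open>\<A> \<noteq> 0\<close> makes the points \<open>\<A> m\<close> pairwise distinct and different from the base point \<open>0\<close>.
\<close>
definition vector_modular_resurgent :: "'i set \<Rightarrow> ('i \<Rightarrow> complex fps) \<Rightarrow> bool" where
  "vector_modular_resurgent I \<phi> \<longleftrightarrow>
     finite I \<and> (\<forall>k\<in>I. gevrey1 (\<phi> k)) \<and>
     (\<exists>(\<A> :: complex) (S :: 'i \<Rightarrow> int \<Rightarrow> complex). \<A> \<noteq> 0 \<and>
        (\<forall>k\<in>I. \<exists>f. borel_continuation (\<phi> k) \<A> f \<and>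
           (\<forall>m. m \<noteq> 0 \<longrightarrow> has_stokes_constant f (\<A> * of_int m) (S k m))) \<and>
        (\<exists>v. L_decomposition I v (\<lambda>k m. S k (int m)) \<and>
             L_decomposition I v (\<lambda>k m. - S k (- int m))))"

end

theory Submission
  imports Defs "HOL-Number_Theory.Number_Theory"
begin

text \<open>
  Let \<open>f(d) = [d \<equiv> k] - [d \<equiv> -k]\<close> modulo \<open>N\<close> and \<open>g(d) = -4 \<i> sin(2\<pi>dk/N)\<close>. The two Borel transforms
  have only simple poles, and their Stokes constants are explicit divisor sums: at \<open>2\<pi>\<i>m/N\<close> and \<open>m \<ge> 1\<close> the
  constant of the component \<open>k\<close> of \<open>\<Psi>\<^sub>N\<close> is \<open>S\<^sub>m = 2 \<Sum>\<^sub>d\<^sub>|\<^sub>m f(d) d/m\<close>, with \<open>S\<^sub>-\<^sub>m = -S\<^sub>m\<close>; at \<open>2\<pi>\<i>m\<close>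
  the constant of the component \<open>k\<close> of \<open>\<Phi>\<^sub>N\<close> is \<open>S\<^sub>m = -\<Sum>\<^sub>d\<^sub>|\<^sub>m g(d)/d\<close>, with \<open>S\<^sub>-\<^sub>m = S\<^sub>m\<close>.

  These constants come from the coefficients. A sum of simple poles
  \<open>a - (2\<pi>\<i>)\<^sup>-\<^sup>1 \<Sum>\<^sub>m S\<^sub>m (1/(\<zeta> - Am) + 1/(Am))\<close> over \<open>m \<noteq> 0\<close> has the moments
  \<open>(2\<pi>\<i>)\<^sup>-\<^sup>1 \<Sum>\<^sub>m S\<^sub>m (Am)\<^sup>-\<^sup>n\<^sup>-\<^sup>1\<close> as its Taylor coefficients of order
  \<open>n \<ge> 1\<close>, so it suffices to write the coefficients of the
  Borel transform as such moments (\<open>resurgent_if_moments\<close>); the Gevrey bound is then the convergence of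
  the Taylor series. Bernoulli numbers, polylogarithms of negative order at roots of unity and Bernoulli
  polynomials at \<open>k/N\<close> are all linear combinations of Taylor coefficients of \<open>1/(e\<^sup>u - 1)\<close> at the points
  \<open>2\<pi>\<i>j/N\<close>, with the pole at \<open>0\<close> removed. The
  reflection formula of the digamma function expands this function in partial fractions, which turns its
  derivatives into sums over residue classes (\<open>higher_deriv_bose_even\<close>, \<open>bernoulli_number_zeta\<close>,
  \<open>bernoulli_poly_rational\<close>, \<open>polylog_zeta_root\<close>). Taking the difference of the entries for \<open>k\<close> and
  \<open>N - k\<close> pairs these classes into odd \<open>N\<close>-periodic functions. Up to an elementary factor each
  coefficient becomes a zeta value times a value of the Dirichlet series of \<open>f\<close> or \<open>g\<close>, and a product of two Dirichlet series is the Dirichlet series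
  of the convolution of their coefficients: this convolution is the sequence of Stokes constants.

  It remains to see that the Dirichlet series \<open>\<Sum>\<^sub>m S\<^sub>m m\<^sup>-\<^sup>s\<close> are combinations of L-functions
  (\<open>L_combination_periodic\<close>). A periodic function is sorted by \<open>g = gcd(n, N)\<close>, which gives the factors
  \<open>c\<^sup>s\<close> with \<open>c = 1/g\<close>, and its restriction to each class is a combination of Dirichlet characters modulo
  \<open>N/g\<close>, because it splits into simultaneous eigenfunctions of the multiplications by units
  (\<open>dirichlet_character_induct\<close>). What is left is the product of a shifted Dirichlet L-series and a shifted
  zeta function. Its Euler product is a product of two geometric local factors. It continues
  meromorphically: repeated summation by parts continues the Dirichlet series of a periodic function with mean zero to
  the whole plane, and multiplication by \<open>1 - 2\<^sup>1\<^sup>-\<^sup>s\<close> reduces an arbitrary periodic function to that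
  case (\<open>dirichlet_series_periodic_meromorphic\<close>).
\<close>

section \<open>Dirichlet convolution and Euler products\<close>

definition dirichlet_conv :: "(nat \<Rightarrow> complex) \<Rightarrow> (nat \<Rightarrow> complex) \<Rightarrow> nat \<Rightarrow> complex" where
  "dirichlet_conv u v n = (\<Sum>d | d dvd n. u d * v (n div d))"

text \<open>
  Absolute convergence allows the double series over pairs to be rearranged along the products of the
  two indices.
\<close>
lemma has_sum_dirichlet_conv:
  assumes u: "(u has_sum a) {0<..}" and v: "(v has_sum b) {0<..}"
  shows "(dirichlet_conv u v has_sum a * b) {0<..}"
proof -
  have abs: "(\<lambda>n. norm (u n)) summable_on {0<..}" "(\<lambda>n. norm (v n)) summable_on {0<..}"
    using u v by (auto simp: has_sum_imp_summable simp flip: summable_on_iff_abs_summable_on_complex)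
  have "(\<lambda>x. norm (case x of (m, d) \<Rightarrow> u m * v d)) summable_on {0<..} \<times> {0<..}"
  proof (rule summable_on_SigmaI)
    show "((\<lambda>y. norm (case (m, y) of (m, d) \<Rightarrow> u m * v d)) has_sum norm (u m) * (\<Sum>\<^sub>\<infinity>d\<in>{0<..}. norm (v d))) {0<..}" for m
      unfolding prod.case norm_mult by (intro has_sum_cmult_right has_sum_infsum abs)
    show "(\<lambda>m. norm (u m) * (\<Sum>\<^sub>\<infinity>d\<in>{0<..}. norm (v d))) summable_on {0<..}"
      by (intro summable_on_cmult_left abs)
  qed auto
  hence "(\<lambda>(m, d). u m * v d) summable_on {0<..} \<times> {0<..}"
    using abs_summable_summable by blast
  hence "((\<lambda>(m, d). u m * v d) has_sum a * b) ({0<..} \<times> {0<..})"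
    by (intro has_sum_SigmaI[where g = "\<lambda>m. u m * b"])
       (auto intro!: has_sum_cmult_right has_sum_cmult_left u v)
  also have "?this \<longleftrightarrow> ((\<lambda>(n, d). u d * v (n div d)) has_sum a * b) (SIGMA n:{0<..}. {d. d dvd n})"
    by (rule has_sum_reindex_bij_witness[of _ "\<lambda>(n, d). (d, n div d)" "\<lambda>(m, d). (m * d, m)"])
       (auto simp: Suc_le_eq dvd_div_eq_0_iff elim!: dvdE intro!: Nat.gr0I)
  finally show ?thesis
    by (rule has_sum_SigmaD) (auto simp: dirichlet_conv_def intro!: has_sum_finiteI)
qed

text \<open>
  Unordered sums over the positive integers can be reindexed, rearranged and restricted to subsets, which
  the shifted sequences \<open>m \<mapsto> Suc m\<close> make cumbersome.
\<close>
lemma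
  shows dirichlet_abs_conv_iff: "dirichlet_abs_conv A s \<longleftrightarrow> (\<lambda>n. A n / of_nat n powr s) summable_on {0<..}"
    and has_sum_dirichlet_series: "dirichlet_abs_conv A s \<Longrightarrow> ((\<lambda>n. A n / of_nat n powr s) has_sum dirichlet_series A s) {0<..}"
proof -
  let ?a = "\<lambda>n. A n / of_nat n powr s"
  have reindex: "((\<lambda>m. ?a (Suc m)) has_sum x) UNIV \<longleftrightarrow> (?a has_sum x) {0<..}" for x
    by (rule has_sum_reindex_bij_witness[of _ "\<lambda>n. n - 1" Suc]) auto
  have 1: "((\<lambda>m. ?a (Suc m)) has_sum dirichlet_series A s) UNIV" if "dirichlet_abs_conv A s"
    using that unfolding dirichlet_abs_conv_def dirichlet_series_def
    by (intro norm_summable_imp_has_sum summable_sums) (auto dest: summable_norm_cancel)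
  thus 2: "dirichlet_abs_conv A s \<Longrightarrow> (?a has_sum dirichlet_series A s) {0<..}"
    using reindex by blast
  show "dirichlet_abs_conv A s \<longleftrightarrow> ?a summable_on {0<..}"
  proof
    assume "?a summable_on {0<..}"
    hence "(\<lambda>m. ?a (Suc m)) summable_on UNIV"
      using reindex by (auto simp: summable_on_def)
    hence "(\<lambda>m. norm (?a (Suc m))) summable_on UNIV"
      by (simp flip: summable_on_iff_abs_summable_on_complex)
    thus "dirichlet_abs_conv A s"
      unfolding dirichlet_abs_conv_def by (rule summable_on_imp_summable)
  qed (use 2 in \<open>auto simp: summable_on_def\<close>)
qed

lemma dirichlet_seriesI:
  assumes "((\<lambda>n. A n / of_nat n powr s) has_sum x) {0<..}"
  shows "dirichlet_abs_conv A s" "dirichlet_series A s = x"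
  using assms has_sum_dirichlet_series[of A s]
  by (auto simp: dirichlet_abs_conv_iff summable_on_def dest: has_sum_unique)

lemma powr_mult_of_nat:
  "of_nat (m * n) powr (s :: complex) = of_nat m powr s * of_nat n powr s"
proof -
  have "of_real (real m * real n) powr s = of_real (real m) powr s * of_real (real n) powr s"
    by (subst of_real_mult, rule powr_times_real) auto
  thus ?thesis by simp
qed

lemma dirichlet_series_conv:
  assumes "dirichlet_abs_conv u s" "dirichlet_abs_conv v s"
  shows "dirichlet_abs_conv (dirichlet_conv u v) s"
    and "dirichlet_series (dirichlet_conv u v) s = dirichlet_series u s * dirichlet_series v s"
proof -
  have "dirichlet_conv (\<lambda>n. u n / of_nat n powr s) (\<lambda>n. v n / of_nat n powr s) n =
          dirichlet_conv u v n / of_nat n powr s" for n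
  proof -
    have "u d / of_nat d powr s * (v (n div d) / of_nat (n div d) powr s) =
            u d * v (n div d) / of_nat n powr s" if "d dvd n" for d
      using that powr_mult_of_nat[of d "n div d" s] by (simp add: field_simps)
    thus ?thesis
      unfolding dirichlet_conv_def sum_divide_distrib by (intro sum.cong) auto
  qed
  hence "dirichlet_conv (\<lambda>n. u n / of_nat n powr s) (\<lambda>n. v n / of_nat n powr s) =
           (\<lambda>n. dirichlet_conv u v n / of_nat n powr s)" by blast
  hence "((\<lambda>n. dirichlet_conv u v n / of_nat n powr s) has_sum
           dirichlet_series u s * dirichlet_series v s) {0<..}"
    using has_sum_dirichlet_conv[OF assms[THEN has_sum_dirichlet_series]] by metis
  thus "dirichlet_abs_conv (dirichlet_conv u v) s"
    and "dirichlet_series (dirichlet_conv u v) s = dirichlet_series u s * dirichlet_series v s"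
    by (auto dest: dirichlet_seriesI)
qed

lemma dirichlet_abs_conv_bounded:
  assumes "\<And>n. n > 0 \<Longrightarrow> norm (A n) \<le> C" "Re s > 1"
  shows "dirichlet_abs_conv A s"
  unfolding dirichlet_abs_conv_def
proof (rule summable_comparison_test')
  have "summable (\<lambda>m. real m powr - Re s)"
    using assms by (subst summable_real_powr_iff) auto
  hence "summable (\<lambda>m. real (Suc m) powr - Re s)"
    by (subst summable_Suc_iff)
  thus "summable (\<lambda>m. C * real (Suc m) powr - Re s)"
    by (rule summable_mult)
  fix m
  have "norm (of_nat (Suc m) powr s) = real (Suc m) powr Re s"
    by (subst norm_powr_real_powr) auto
  thus "norm (norm (A (Suc m) / of_nat (Suc m) powr s)) \<le> C * real (Suc m) powr - Re s"
    using assms(1)[of "Suc m"] by (simp add: norm_divide powr_minus field_simps)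
qed

definition completely_multiplicative :: "(nat \<Rightarrow> complex) \<Rightarrow> bool" where
  "completely_multiplicative u \<longleftrightarrow> u 1 = 1 \<and> (\<forall>m n. m > 0 \<longrightarrow> n > 0 \<longrightarrow> u (m * n) = u m * u n)"

lemma completely_multiplicative_power:
  "completely_multiplicative u \<Longrightarrow> n > 0 \<Longrightarrow> u (n ^ k) = u n ^ k"
  by (induction k) (auto simp: completely_multiplicative_def)

text \<open>
  The powers of \<open>u p\<close> are values of the summable function \<open>u\<close>, so they form a convergent geometric series.
\<close>
lemma completely_multiplicative_prime_norm_less_1:
  assumes u: "completely_multiplicative u" "u summable_on {0<..}" and p: "p \<ge> 2"
  shows "norm (u p) < 1"
proof -
  have "u summable_on (\<lambda>k. p ^ k) ` UNIV"
    by (rule summable_on_subset[OF u(2)]) (use p in \<open>auto simp: Suc_le_eq\<close>)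
  hence "(\<lambda>k. u (p ^ k)) summable_on UNIV"
    by (subst (asm) summable_on_reindex) (use p in \<open>auto simp: o_def inj_on_def\<close>)
  hence "summable (\<lambda>k. u p ^ k)"
    using p by (subst (asm) completely_multiplicative_power[OF u(1)])
               (auto dest: summable_on_imp_summable)
  thus ?thesis by (simp add: summable_geometric_iff)
qed

text \<open>
  The sieve of Eratosthenes: multiplication by \<open>1 - u p\<close> removes the terms whose index is divisible by \<open>p\<close>, so
  \<open>L\<close> times the product of these factors over \<open>p \<le> x\<close> is the sum over the integers that have no prime factor
  up to \<open>x\<close>. Apart from \<open>1\<close> these integers exceed \<open>x\<close>, hence the product tends to \<open>1\<close>. This gives both
  the value of the infinite product and the non-vanishing of \<open>L\<close>, on which its convergence depends.
\<close>
lemma has_prod_completely_multiplicative: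
  assumes u: "completely_multiplicative u" "(u has_sum L) {0<..}"
  shows "(\<lambda>p. if prime p then 1 / (1 - u p) else 1) has_prod L"
proof -
  define R where "R x = {n. n > 0 \<and> (\<forall>p. prime p \<and> p \<le> x \<longrightarrow> \<not> p dvd n)}" for x :: nat
  define E where "E x = infsum u (R x)" for x
  define Q where "Q x = (\<Prod>p\<le>x. if prime p then 1 / (1 - u p) else 1)" for x
  have summ: "u summable_on {0<..}" using u(2) by (auto simp: summable_on_def)
  have summ': "u summable_on X" if "X \<subseteq> {0<..}" for X
    by (rule summable_on_subset[OF summ that])
  have less1: "norm (u p) < 1" if "prime p" for p
    using completely_multiplicative_prime_norm_less_1[OF u(1) summ] prime_ge_2_nat[OF that] .
  have ne1: "u p \<noteq> 1" if "prime p" for p using less1[OF that] by auto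
  have E_step: "E (Suc x) = E x * (1 - u (Suc x))" if p: "prime (Suc x)" for x
  proof -
    let ?p = "Suc x"
    have eq: "R (Suc x) = R x - (\<lambda>n. ?p * n) ` R x"
    proof (intro Set.set_eqI iffI)
      fix n assume n: "n \<in> R (Suc x)"
      hence "\<not> ?p dvd n" using p by (auto simp: R_def)
      thus "n \<in> R x - (\<lambda>n. ?p * n) ` R x" using n by (auto simp: R_def simp del: mult_Suc)
    next
      fix n assume n: "n \<in> R x - (\<lambda>n. ?p * n) ` R x"
      have "\<not> ?p dvd n"
      proof
        assume "?p dvd n"
        then obtain k where k: "n = ?p * k" by (elim dvdE)
        hence "k \<in> R x" using n by (auto simp: R_def intro!: Nat.gr0I)
        thus False using n k by auto
      qed
      thus "n \<in> R (Suc x)" using n by (auto simp: R_def le_Suc_eq)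
    qed
    have sub: "(\<lambda>n. ?p * n) ` R x \<subseteq> R x"
    proof safe
      fix n assume n: "n \<in> R x"
      have "\<not> q dvd ?p * n" if q: "prime q" "q \<le> x" for q
      proof
        assume "q dvd ?p * n"
        hence "q dvd ?p \<or> q dvd n" using q by (simp only: prime_dvd_mult_iff)
        moreover have "\<not> q dvd ?p" using q p primes_dvd_imp_eq[of q ?p] by auto
        ultimately show False using n q by (auto simp: R_def)
      qed
      moreover have "?p * n > 0" using n by (auto simp: R_def)
      ultimately show "?p * n \<in> R x" unfolding R_def by blast
    qed
    have "infsum u ((\<lambda>n. ?p * n) ` R x) = infsum (\<lambda>n. u (?p * n)) (R x)"
      by (subst infsum_reindex) (auto simp: inj_on_def o_def simp del: mult_Suc)
    also have "\<dots> = infsum (\<lambda>n. u ?p * u n) (R x)"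
      using u(1) by (intro infsum_cong) (auto simp: R_def completely_multiplicative_def simp del: mult_Suc)
    also have "\<dots> = u ?p * E x"
      unfolding E_def by (rule infsum_cmult_right) (auto simp: R_def intro: summ')
    finally have "infsum u ((\<lambda>n. ?p * n) ` R x) = u ?p * E x" .
    moreover have "E (Suc x) = infsum u (R x) - infsum u ((\<lambda>n. ?p * n) ` R x)"
      unfolding E_def eq
      by (rule infsum_Diff) (use sub in \<open>auto intro!: summ' simp: R_def\<close>)
    ultimately show ?thesis by (simp add: E_def algebra_simps)
  qed
  have Q_eq: "E x * Q x = L" for x
  proof (induction x)
    case 0
    have "R 0 = {0<..}" by (auto simp: R_def)
    thus ?case using u(2) by (auto simp: E_def Q_def infsumI)
  next
    case (Suc x)
    show ?case
    proof (cases "prime (Suc x)")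
      case True
      hence "Q (Suc x) = Q x / (1 - u (Suc x))" by (simp add: Q_def)
      thus ?thesis using Suc.IH E_step[OF True] ne1[OF True] by simp
    next
      case False
      have "R (Suc x) = R x" using False by (auto simp: R_def le_Suc_eq)
      thus ?thesis using Suc.IH False by (simp add: E_def Q_def)
    qed
  qed
  \<comment> \<open>what is left after sieving by all primes up to \<open>x\<close> is \<open>1\<close> and numbers exceeding \<open>x\<close>\<close>
  have E_lim: "E \<longlonglongrightarrow> 1"
  proof -
    have nsum: "(\<lambda>n. norm (u n)) summable_on X" if "X \<subseteq> {0<..}" for X
      using summ'[OF that] by (simp flip: summable_on_iff_abs_summable_on_complex)
    have "((\<lambda>m. norm (u (Suc m))) has_sum (\<Sum>\<^sub>\<infinity>n\<in>{0<..}. norm (u n))) UNIV \<longleftrightarrow>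
            ((\<lambda>n. norm (u n)) has_sum (\<Sum>\<^sub>\<infinity>n\<in>{0<..}. norm (u n))) {0<..}"
      by (rule has_sum_reindex_bij_witness[of _ "\<lambda>n. n - 1" Suc]) auto
    hence sums: "(\<lambda>m. norm (u (Suc m))) sums (\<Sum>\<^sub>\<infinity>n\<in>{0<..}. norm (u n))"
      using has_sum_infsum[OF nsum[of "{0<..}"]] has_sum_imp_sums by blast
    define t where "t x = (\<Sum>\<^sub>\<infinity>n\<in>{0<..}. norm (u n)) - (\<Sum>m<x. norm (u (Suc m)))" for x
    have t_lim: "t \<longlonglongrightarrow> 0"
      using tendsto_diff[OF tendsto_const[of "\<Sum>\<^sub>\<infinity>n\<in>{0<..}. norm (u n)"] sums[unfolded sums_def]]
      by (simp add: t_def[abs_def])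
    have "norm (E x - 1) \<le> t x" for x
    proof -
      have "R x = insert 1 (R x - {1})" by (auto simp: R_def dest: prime_gt_1_nat)
      hence "E x = infsum u (insert 1 (R x - {1}))" unfolding E_def by simp
      also have "\<dots> = u 1 + infsum u (R x - {1})"
        by (rule infsum_insert) (auto intro!: summ' simp: R_def)
      finally have "E x - 1 = infsum u (R x - {1})"
        using u(1) by (simp add: completely_multiplicative_def)
      also have "norm \<dots> \<le> (\<Sum>\<^sub>\<infinity>n\<in>R x - {1}. norm (u n))"
        by (rule norm_infsum_bound) (auto intro!: nsum simp: R_def)
      also have "\<dots> \<le> (\<Sum>\<^sub>\<infinity>n\<in>{0<..} - {0<..x}. norm (u n))"
      proof (rule infsum_mono2)
        show "R x - {1} \<subseteq> {0<..} - {0<..x}"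
        proof
          fix n assume n: "n \<in> R x - {1}"
          then obtain p where "prime p" "p dvd n" using prime_factor_nat[of n] by auto
          with n have "\<not> p \<le> x" "p \<le> n" by (auto simp: R_def intro!: dvd_imp_le)
          thus "n \<in> {0<..} - {0<..x}" using n by (auto simp: R_def)
        qed
      qed (auto intro!: nsum simp: R_def)
      also have "\<dots> = (\<Sum>\<^sub>\<infinity>n\<in>{0<..}. norm (u n)) - (\<Sum>\<^sub>\<infinity>n\<in>{0<..x}. norm (u n))"
        by (rule infsum_Diff) (auto intro!: nsum)
      also have "(\<Sum>\<^sub>\<infinity>n\<in>{0<..x}. norm (u n)) = (\<Sum>n\<in>{0<..x}. norm (u n))"
        by simp
      also have "\<dots> = (\<Sum>m<x. norm (u (Suc m)))"
        by (rule sum.reindex_bij_witness[of _ Suc "\<lambda>n. n - 1"]) auto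
      finally show ?thesis by (simp add: t_def)
    qed
    hence "(\<lambda>x. E x - 1) \<longlonglongrightarrow> 0"
      by (intro Lim_null_comparison[OF _ t_lim] always_eventually allI)
    thus ?thesis by (simp add: LIM_zero_iff)
  qed
  have Lnz: "L \<noteq> 0"
  proof
    assume "L = 0"
    have Qnz: "Q x \<noteq> 0" for x unfolding Q_def by (auto simp: ne1)
    have "E x = 0" for x using Q_eq[of x] Qnz[of x] \<open>L = 0\<close> by auto
    hence "E = (\<lambda>_. 0)" by blast
    thus False using E_lim by (simp add: LIMSEQ_const_iff)
  qed
  have "(\<lambda>x. L / E x) \<longlonglongrightarrow> L / 1" by (intro tendsto_divide tendsto_const E_lim) auto
  moreover have "L / E x = Q x" for x
  proof -
    have "E x \<noteq> 0" using Q_eq[of x] Lnz by auto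
    thus ?thesis using Q_eq[of x] by (simp add: field_simps)
  qed
  ultimately have "Q \<longlonglongrightarrow> L" by simp
  thus ?thesis using Lnz by (auto simp: has_prod_def raw_has_prod_def Q_def[abs_def] cong: if_cong)
qed

lemma dirichlet_conv_prime_power:
  assumes "prime p" "completely_multiplicative u" "completely_multiplicative v"
  shows "dirichlet_conv u v (p ^ j) = (\<Sum>i\<le>j. u p ^ i * v p ^ (j - i))"
proof -
  have p: "p > 1" using assms prime_gt_1_nat by blast
  have "{d. d dvd p ^ j} = (\<lambda>i. p ^ i) ` {..j}"
    using assms(1) by (auto simp: divides_primepow_nat)
  hence "dirichlet_conv u v (p ^ j) = (\<Sum>i\<le>j. u (p ^ i) * v (p ^ j div p ^ i))"
    unfolding dirichlet_conv_def using p by (simp add: sum.reindex inj_on_def)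
  also have "\<dots> = (\<Sum>i\<le>j. u p ^ i * v p ^ (j - i))"
    using p assms
    by (intro sum.cong refl) (simp add: completely_multiplicative_power flip: power_diff)
  finally show ?thesis .
qed

lemma completely_multiplicative_divide_powr:
  "completely_multiplicative u \<Longrightarrow> completely_multiplicative (\<lambda>n. u n / of_nat n powr s)"
  using powr_mult_of_nat[of _ _ s] by (auto simp: completely_multiplicative_def simp del: of_nat_mult)

text \<open>
  The convolution is multiplicative but in general not completely multiplicative. Its local factor at \<open>p\<close> is
  the Cauchy product of two geometric series, that is, the product of the local factors of \<open>u\<close> and \<open>v\<close>.
\<close>
lemma has_prod_dirichlet_conv:
  assumes u: "completely_multiplicative u" "dirichlet_abs_conv u s"
    and v: "completely_multiplicative v" "dirichlet_abs_conv v s"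
  shows "(\<lambda>p. if prime p then (\<Sum>j. dirichlet_conv u v (p ^ j) / of_nat (p ^ j) powr s) else 1)
           has_prod dirichlet_series (dirichlet_conv u v) s"
proof -
  define a where "a n = u n / of_nat n powr s" for n
  define b where "b n = v n / of_nat n powr s" for n
  have a: "completely_multiplicative a" "(a has_sum dirichlet_series u s) {0<..}"
    unfolding a_def using u by (auto intro: completely_multiplicative_divide_powr has_sum_dirichlet_series)
  have b: "completely_multiplicative b" "(b has_sum dirichlet_series v s) {0<..}"
    unfolding b_def using v by (auto intro: completely_multiplicative_divide_powr has_sum_dirichlet_series)
  have "(\<Sum>j. dirichlet_conv u v (p ^ j) / of_nat (p ^ j) powr s) = 1 / (1 - a p) * (1 / (1 - b p))"
    if p: "prime p" for p
  proof -
    have *: "norm (a p) < 1" "norm (b p) < 1"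
      using a b prime_ge_2_nat[OF p]
      by (auto intro!: completely_multiplicative_prime_norm_less_1 dest: has_sum_imp_summable)
    have "(\<lambda>j. \<Sum>i\<le>j. a p ^ i * b p ^ (j - i)) sums ((\<Sum>j. a p ^ j) * (\<Sum>j. b p ^ j))"
      using * by (intro Cauchy_product_sums) (auto simp: norm_power)
    also have "(\<Sum>j. a p ^ j) * (\<Sum>j. b p ^ j) = 1 / (1 - a p) * (1 / (1 - b p))"
      using * by (simp add: suminf_geometric)
    also have "(\<lambda>j. \<Sum>i\<le>j. a p ^ i * b p ^ (j - i)) =
                 (\<lambda>j. dirichlet_conv u v (p ^ j) / of_nat (p ^ j) powr s)"
    proof
      fix j
      have pw: "of_nat (p ^ i) powr s = (of_nat p powr s) ^ i" for i
        by (induction i) (use powr_mult_of_nat[of p "p ^ _" s] in \<open>simp_all\<close>)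
      have "a p ^ i * b p ^ (j - i) = u p ^ i * v p ^ (j - i) / of_nat (p ^ j) powr s" if "i \<le> j" for i
        unfolding a_def b_def pw power_divide using that by (simp flip: power_add)
      thus "(\<Sum>i\<le>j. a p ^ i * b p ^ (j - i)) = dirichlet_conv u v (p ^ j) / of_nat (p ^ j) powr s"
        unfolding dirichlet_conv_prime_power[OF p u(1) v(1)] by (simp add: sum_divide_distrib)
    qed
    finally show ?thesis by (simp add: sums_iff)
  qed
  hence "(\<lambda>p. if prime p then (\<Sum>j. dirichlet_conv u v (p ^ j) / of_nat (p ^ j) powr s) else 1) =
         (\<lambda>p. (if prime p then 1 / (1 - a p) else 1) * (if prime p then 1 / (1 - b p) else 1))"
    by auto
  thus ?thesis
    using has_prod_mult[OF has_prod_completely_multiplicative[OF a] has_prod_completely_multiplicative[OF b]]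
    by (simp add: dirichlet_series_conv(2)[OF u(2) v(2)])
qed

lemma L_function_dirichlet_conv:
  assumes u: "completely_multiplicative u" "\<And>s. Re s > 1 \<Longrightarrow> dirichlet_abs_conv u s"
    and v: "completely_multiplicative v" "\<And>s. Re s > 1 \<Longrightarrow> dirichlet_abs_conv v s"
    and Fu: "Fu meromorphic_on UNIV" "\<And>s. Re s > 1 \<Longrightarrow> Fu s = dirichlet_series u s"
    and Fv: "Fv meromorphic_on UNIV" "\<And>s. Re s > 1 \<Longrightarrow> Fv s = dirichlet_series v s"
  shows "L_function (dirichlet_conv u v)"
  unfolding L_function_def
proof (intro exI[of _ "1 :: real"] conjI allI impI)
  show "\<exists>D F. open D \<and> connected D \<and> {s. 1 < Re s} \<subseteq> D \<and> {s. Re s < 0} \<subseteq> D \<and> F meromorphic_on D \<and>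
          (\<forall>s. 1 < Re s \<longrightarrow> F s = dirichlet_series (dirichlet_conv u v) s)"
    by (intro exI[of _ UNIV] exI[of _ "\<lambda>s. Fu s * Fv s"])
       (auto intro!: meromorphic_intros Fu(1) Fv(1) simp: Fu(2) Fv(2) dirichlet_series_conv u v)
qed (auto intro!: dirichlet_series_conv u v has_prod_dirichlet_conv)

section \<open>Combinations of L-functions\<close>

text \<open>
  The half-plane \<open>Re s > 1\<close> is fixed once and for all, so that combinations of several L-functions
  can be compared on it without tracking abscissas of convergence.
\<close>
definition L_pairs :: "(complex \<times> (nat \<Rightarrow> complex)) set" where
  "L_pairs = {(c, A). L_function A \<and> (\<forall>s. Re s > 1 \<longrightarrow> dirichlet_abs_conv A s)}"

text \<open>
  The pairs \<open>(c, A)\<close> form a finite set and not an enumerated family: then a union of such sets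
  serves several sequences at once, which is how the components of a vector come to share their L-functions.
\<close>
definition L_combination_on ::
    "(complex \<times> (nat \<Rightarrow> complex)) set \<Rightarrow> (complex \<times> (nat \<Rightarrow> complex) \<Rightarrow> complex) \<Rightarrow> (nat \<Rightarrow> complex) \<Rightarrow> bool" where
  "L_combination_on X \<mu> T \<longleftrightarrow> finite X \<and> X \<subseteq> L_pairs \<and>
     (\<forall>s. Re s > 1 \<longrightarrow> dirichlet_abs_conv T s \<and>
        dirichlet_series T s = (\<Sum>x\<in>X. \<mu> x * (fst x powr s * dirichlet_series (snd x) s)))"

definition L_combination :: "(nat \<Rightarrow> complex) \<Rightarrow> bool" where
  "L_combination T \<longleftrightarrow> (\<exists>X \<mu>. L_combination_on X \<mu> T)"

lemma L_combination_on_mono: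
  assumes "L_combination_on X \<mu> T" "X \<subseteq> Y" "finite Y" "Y \<subseteq> L_pairs"
  shows "L_combination_on Y (\<lambda>x. if x \<in> X then \<mu> x else 0) T"
proof -
  have "(\<Sum>x\<in>X. \<mu> x * (fst x powr s * dirichlet_series (snd x) s)) =
        (\<Sum>x\<in>Y. (if x \<in> X then \<mu> x else 0) * (fst x powr s * dirichlet_series (snd x) s))" for s
    using assms by (intro sum.mono_neutral_cong_left) auto
  thus ?thesis using assms unfolding L_combination_on_def by simp
qed

lemma dirichlet_series_add:
  assumes "dirichlet_abs_conv A s" "dirichlet_abs_conv B s"
  shows "dirichlet_abs_conv (\<lambda>n. A n + B n) s"
    and "dirichlet_series (\<lambda>n. A n + B n) s = dirichlet_series A s + dirichlet_series B s"
  using has_sum_add[OF assms[THEN has_sum_dirichlet_series]]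
  by (auto intro!: dirichlet_seriesI simp: add_divide_distrib)

lemma dirichlet_series_cmult:
  assumes "dirichlet_abs_conv A s"
  shows "dirichlet_abs_conv (\<lambda>n. c * A n) s"
    and "dirichlet_series (\<lambda>n. c * A n) s = c * dirichlet_series A s"
  using has_sum_cmult_right[OF has_sum_dirichlet_series[OF assms], of c]
  by (auto intro!: dirichlet_seriesI)

lemma L_combination_add:
  assumes "L_combination T" "L_combination U"
  shows "L_combination (\<lambda>n. T n + U n)"
proof -
  obtain X \<mu> Y \<nu> where XY: "L_combination_on X \<mu> T" "L_combination_on Y \<nu> U"
    using assms by (auto simp: L_combination_def)
  have fin: "finite (X \<union> Y)" "X \<union> Y \<subseteq> L_pairs" using XY by (auto simp: L_combination_on_def)
  obtain \<mu>' \<nu>' where "L_combination_on (X \<union> Y) \<mu>' T" "L_combination_on (X \<union> Y) \<nu>' U"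
    using L_combination_on_mono[OF XY(1) _ fin] L_combination_on_mono[OF XY(2) _ fin] by blast
  hence "L_combination_on (X \<union> Y) (\<lambda>x. \<mu>' x + \<nu>' x) (\<lambda>n. T n + U n)"
    by (auto simp: L_combination_on_def dirichlet_series_add sum.distrib distrib_right)
  thus ?thesis by (auto simp: L_combination_def)
qed

lemma L_combination_cmult:
  assumes "L_combination T"
  shows "L_combination (\<lambda>n. c * T n)"
proof -
  obtain X \<mu> where "L_combination_on X \<mu> T" using assms by (auto simp: L_combination_def)
  hence "L_combination_on X (\<lambda>x. c * \<mu> x) (\<lambda>n. c * T n)"
    by (auto simp: L_combination_on_def dirichlet_series_cmult sum_distrib_left mult.assoc)
  thus ?thesis by (auto simp: L_combination_def)
qed

lemma L_combination_0: "L_combination (\<lambda>_. 0)"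
  unfolding L_combination_def L_combination_on_def
  by (intro exI[of _ "{}"]) (auto simp: dirichlet_abs_conv_def dirichlet_series_def)

lemma L_combination_sum:
  assumes "\<And>x. x \<in> X \<Longrightarrow> L_combination (f x)"
  shows "L_combination (\<lambda>n. \<Sum>x\<in>X. f x n)"
  using assms by (induction X rule: infinite_finite_induct) (auto intro!: L_combination_0 L_combination_add)

text \<open>
  The coefficients of \<open>g\<^sup>-\<^sup>s\<close> times the Dirichlet series of \<open>A\<close>. These are the source of the factors \<open>c\<^sup>s\<close>.
\<close>
definition dilate :: "nat \<Rightarrow> (nat \<Rightarrow> complex) \<Rightarrow> nat \<Rightarrow> complex" where
  "dilate g A n = (if g dvd n then A (n div g) else 0)"

lemma dirichlet_series_dilate:
  assumes "dirichlet_abs_conv A s" "g > 0"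
  shows "dirichlet_abs_conv (dilate g A) s"
    and "dirichlet_series (dilate g A) s = (1 / of_nat g) powr s * dirichlet_series A s"
proof -
  let ?x = "(1 / of_nat g) powr s * dirichlet_series A s"
  have pw: "(1 / of_nat g) powr s * (a / of_nat n powr s) = a / of_nat (g * n) powr s" for n and a :: complex
  proof -
    have "(1 / of_nat g :: complex) powr s = 1 / of_nat g powr s"
      using powr_mult_of_nat[of 1 1 s] powr_times_real[of "1 / of_nat g" "of_nat g" s] assms(2)
      by (simp add: field_simps)
    thus ?thesis by (simp only: powr_mult_of_nat) simp
  qed
  have "((\<lambda>n. A n / of_nat (g * n) powr s) has_sum ?x) {0<..}"
    using has_sum_cmult_right[OF has_sum_dirichlet_series[OF assms(1)], of "(1 / of_nat g) powr s"]
    by (simp only: pw)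
  also have "?this \<longleftrightarrow> ((\<lambda>n. dilate g A n / of_nat n powr s) has_sum ?x) ((\<lambda>n. g * n) ` {0<..})"
    using assms(2) by (subst has_sum_reindex) (auto simp: inj_on_def o_def dilate_def)
  also have "\<dots> \<longleftrightarrow> ((\<lambda>n. dilate g A n / of_nat n powr s) has_sum ?x) {0<..}"
    using assms(2) by (intro has_sum_cong_neutral) (auto simp: dilate_def elim!: dvdE)
  finally show "dirichlet_abs_conv (dilate g A) s"
    and "dirichlet_series (dilate g A) s = ?x" by (auto dest: dirichlet_seriesI)
qed

lemma L_combination_dilate:
  assumes "L_function A" "\<And>s. Re s > 1 \<Longrightarrow> dirichlet_abs_conv A s" "g > 0"
  shows "L_combination (dilate g A)"
  unfolding L_combination_def L_combination_on_def
  by (rule exI[of _ "{(1 / of_nat g, A)}"], rule exI[of _ "\<lambda>_. 1"])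
     (use assms in \<open>auto simp: L_pairs_def dirichlet_series_dilate\<close>)

text \<open>
  All sets of pairs are merged into one. Its enumeration is the common vector of L-functions, and the matrix
  entry is zero where a pair does not occur in the combination for \<open>k\<close>.
\<close>
lemma L_combination_imp_L_decomposition:
  assumes I: "finite I" and T: "\<And>k. k \<in> I \<Longrightarrow> L_combination (T k)"
    and U: "\<And>k. k \<in> I \<Longrightarrow> L_combination (U k)"
  shows "\<exists>v. L_decomposition I v T \<and> L_decomposition I v U"
proof -
  obtain X \<mu> where X: "\<And>k. k \<in> I \<Longrightarrow> L_combination_on (X k) (\<mu> k) (T k)"
    using T unfolding L_combination_def by metis
  obtain Y \<nu> where Y: "\<And>k. k \<in> I \<Longrightarrow> L_combination_on (Y k) (\<nu> k) (U k)"
    using U unfolding L_combination_def by metis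
  define Z where "Z = (\<Union>k\<in>I. X k \<union> Y k)"
  have Z: "finite Z" "Z \<subseteq> L_pairs"
    using X Y I by (auto simp: Z_def L_combination_on_def) blast+
  obtain h where h: "bij_betw h {..<card Z} Z"
    using ex_bij_betw_nat_finite[OF Z(1)] by (auto simp: lessThan_atLeast0)
  have hZ: "h j \<in> L_pairs" if "j < card Z" for j
    using h that Z(2) by (auto simp: bij_betw_def)
  have "L_decomposition I (card Z) V"
    if V: "\<And>k. k \<in> I \<Longrightarrow> L_combination_on (W k) (\<rho> k) (V k)" "\<And>k. k \<in> I \<Longrightarrow> W k \<subseteq> Z" for V W \<rho>
  proof -
    define M where "M k j = (if h j \<in> W k then \<rho> k (h j) else 0)" for k j
    have "dirichlet_series (V k) s =
           (\<Sum>j<card Z. M k j * (fst (h j) powr s * dirichlet_series (snd (h j)) s))"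
      and "dirichlet_abs_conv (V k) s"
      if "k \<in> I" "Re s > 1" for k s
      using L_combination_on_mono[OF V(1)[OF that(1)] V(2)[OF that(1)] Z] that(2)
        sum.reindex_bij_betw[OF h, of "\<lambda>x. (if x \<in> W k then \<rho> k x else 0) * (fst x powr s * dirichlet_series (snd x) s)"]
      by (auto simp: L_combination_on_def M_def)
    moreover have "L_function (snd (h j))" "Re s > 1 \<Longrightarrow> dirichlet_abs_conv (snd (h j)) s" if "j < card Z" for j s
      using hZ[OF that] by (auto simp: L_pairs_def split: prod.splits)
    ultimately show ?thesis
      unfolding L_decomposition_def
      by (intro exI[of _ "\<lambda>j. snd (h j)"] exI[of _ "\<lambda>j. fst (h j)"] exI[of _ M] conjI exI[of _ "1 :: real"]) auto
  qed
  from this[of X \<mu> T] this[of Y \<nu> U] X Y show ?thesis by (auto simp: Z_def)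
qed

section \<open>Meromorphic continuation of periodic Dirichlet series\<close>

lemma holomorphic_on_suminf:
  fixes f :: "nat \<Rightarrow> complex \<Rightarrow> complex"
  assumes S: "open S" and hol: "\<And>n. f n holomorphic_on S"
    and bound: "\<And>x. x \<in> S \<Longrightarrow> \<exists>d>0. \<exists>h. summable h \<and> (\<forall>n. \<forall>y\<in>ball x d \<inter> S. norm (f n y) \<le> h n)"
  shows "(\<lambda>x. \<Sum>n. f n x) holomorphic_on S"
proof -
  have "\<exists>g g'. \<forall>x\<in>S. ((\<lambda>n. f n x) sums g x) \<and> ((\<lambda>n. deriv (f n) x) sums g' x) \<and> (g has_field_derivative g' x) (at x)"
  proof (rule series_and_derivative_comparison_local[OF S])
    show "(f n has_field_derivative deriv (f n) x) (at x)" if "x \<in> S" for n x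
      using that hol S holomorphic_derivI by blast
  next
    fix x assume "x \<in> S"
    from bound[OF this] obtain d h where "d > 0" "summable h" "\<forall>n. \<forall>y\<in>ball x d \<inter> S. norm (f n y) \<le> h n"
      by blast
    thus "\<exists>d h. 0 < d \<and> summable h \<and> (\<forall>\<^sub>F n in sequentially. \<forall>y\<in>ball x d \<inter> S. norm (f n y) \<le> h n)"
      by (intro exI[of _ d] exI[of _ h]) auto
  qed
  then obtain g g' where g: "\<And>x. x \<in> S \<Longrightarrow> (\<lambda>n. f n x) sums g x"
      "\<And>x. x \<in> S \<Longrightarrow> (g has_field_derivative g' x) (at x)" by blast
  have "g holomorphic_on S"
    using g(2) S by (auto simp: holomorphic_on_open)
  thus ?thesis
    by (rule holomorphic_transform) (use g(1) in \<open>auto simp: sums_iff\<close>)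
qed

text \<open>
  Iterated differences of \<open>x \<mapsto> x\<^sup>-\<^sup>s\<close> with the sign \<open>g(x) - g(x + 1)\<close> that summation by parts produces.
\<close>
primrec powr_diff :: "nat \<Rightarrow> complex \<Rightarrow> complex \<Rightarrow> complex" where
  "powr_diff 0 x s = x powr (-s)"
| "powr_diff (Suc r) x s = powr_diff r x s - powr_diff r (x + 1) s"

lemma has_field_derivative_powr_diff:
  "Re x > 0 \<Longrightarrow> ((\<lambda>x. powr_diff r x s) has_field_derivative - s * powr_diff r x (s + 1)) (at x within A)"
proof (induction r arbitrary: x A)
  case 0
  have "x \<notin> \<real>\<^sub>\<le>\<^sub>0" using 0 by (auto simp: complex_nonpos_Reals_iff)
  hence "((\<lambda>x. x powr (-s)) has_field_derivative -s * x powr (-s - 1)) (at x within A)"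
    by (rule has_field_derivative_at_within[OF has_field_derivative_powr])
  moreover have "-s - 1 = -(s + 1)" by simp
  ultimately show ?case by (simp only: powr_diff.simps)
next
  case (Suc r)
  have "((\<lambda>x. powr_diff r (x + 1) s) has_field_derivative - s * powr_diff r (x + 1) (s + 1) * 1) (at x within A)"
  proof (rule DERIV_chain2[where f = "\<lambda>x. powr_diff r x s" and g = "\<lambda>x. x + 1"])
    show "((\<lambda>x. powr_diff r x s) has_field_derivative - s * powr_diff r (x + 1) (s + 1)) (at (x + 1))"
      using Suc.prems by (intro Suc.IH) simp
    show "((\<lambda>x. x + 1) has_field_derivative 1) (at x within A)"
      by (intro derivative_eq_intros) auto
  qed
  from DERIV_diff[OF Suc.IH[OF Suc.prems] this] show ?case by (simp add: algebra_simps)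
qed

text \<open>
  By the mean value inequality a difference is bounded by a derivative, and differentiating in \<open>x\<close> amounts to
  replacing \<open>s\<close> by \<open>s + 1\<close> up to the factor \<open>-s\<close>. Every difference therefore gains one power of \<open>x\<close>, and the
  factors accumulate to the Pochhammer symbol.
\<close>
lemma norm_powr_diff_le:
  assumes "x \<ge> 1" "Re s + r \<ge> 0"
  shows "norm (powr_diff r (of_real x) s) \<le> norm (pochhammer s r) * x powr - (Re s + r)"
  using assms
proof (induction r arbitrary: x s)
  case 0
  thus ?case by (simp add: norm_powr_real_powr)
next
  case (Suc r)
  let ?S = "closed_segment (of_real x) (of_real (x + 1)) :: complex set"
  define B where "B = norm s * (norm (pochhammer (s + 1) r) * x powr - (Re s + 1 + r))"
  have "norm (powr_diff r (of_real x) s - powr_diff r (of_real (x + 1)) s) \<le>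
          B * norm (of_real x - of_real (x + 1) :: complex)"
  proof (rule field_differentiable_bound[of ?S])
    fix z assume "z \<in> ?S"
    then obtain y where y: "z = of_real y" "x \<le> y" "y \<le> x + 1"
      by (subst (asm) closed_segment_of_real) (auto simp: closed_segment_eq_real_ivl)
    show "((\<lambda>x. powr_diff r x s) has_field_derivative - s * powr_diff r z (s + 1)) (at z within ?S)"
      using y Suc.prems by (intro has_field_derivative_powr_diff) auto
    have "norm (powr_diff r (of_real y) (s + 1)) \<le> norm (pochhammer (s + 1) r) * y powr - (Re (s + 1) + r)"
      using Suc.prems y by (intro Suc.IH) auto
    also have "\<dots> \<le> norm (pochhammer (s + 1) r) * x powr - (Re (s + 1) + r)"
      using Suc.prems y by (intro mult_left_mono powr_mono2') auto
    finally show "norm (- s * powr_diff r z (s + 1)) \<le> B"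
      by (simp add: norm_mult B_def y mult_left_mono)
  qed auto
  also have "norm (of_real x - of_real (x + 1) :: complex) = 1"
    by (simp flip: of_real_diff)
  finally have "norm (powr_diff (Suc r) (of_real x) s) \<le> B" by simp
  moreover have "B = norm (pochhammer s (Suc r)) * x powr - (Re s + Suc r)"
    unfolding B_def pochhammer_rec norm_mult of_nat_Suc by (simp only: mult.assoc add.assoc)
  ultimately show ?case by (simp only:)
qed

lemma powr_diff_0_fun: "powr_diff 0 x = (\<lambda>s. x powr (-s))"
  by (rule ext) simp

lemma powr_diff_Suc_fun: "powr_diff (Suc r) x = (\<lambda>s. powr_diff r x s - powr_diff r (x + 1) s)"
  by (rule ext) simp

lemma holomorphic_powr_diff: "powr_diff r x holomorphic_on A"
proof (induction r arbitrary: x)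
  case 0
  show ?case unfolding powr_diff_0_fun
    by (rule holomorphic_on_powr_right[OF holomorphic_on_minus[OF holomorphic_on_ident]])
next
  case (Suc r)
  show ?case unfolding powr_diff_Suc_fun
    by (rule holomorphic_on_diff[OF Suc.IH Suc.IH])
qed

lemma periodic_bounded:
  fixes f :: "nat \<Rightarrow> complex"
  assumes "q > 0" "\<And>n. f (n + q) = f n"
  obtains C where "\<And>n. norm (f n) \<le> C"
proof -
  have per: "f (n + k * q) = f n" for n k
  proof (induction k)
    case (Suc k)
    thus ?case using assms(2)[of "n + k * q"] by (simp add: algebra_simps)
  qed auto
  have "norm (f n) \<le> Max ((\<lambda>n. norm (f n)) ` {..<q})" for n
  proof (rule Max_ge)
    have "n mod q + n div q * q = n" by simp
    hence "norm (f n) = norm (f (n mod q))" using per[of "n mod q" "n div q"] by simp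
    thus "norm (f n) \<in> (\<lambda>n. norm (f n)) ` {..<q}" using assms(1) by auto
  qed auto
  thus ?thesis by (rule that)
qed

text \<open>
  Every difference moves the half-plane of absolute convergence one unit to the left; the bound is locally
  uniform in \<open>s\<close>, so that the series is holomorphic there.
\<close>
lemma powr_diff_series_bound:
  assumes f: "\<And>n. norm (f n) \<le> C" and s: "Re s0 > 1 - real r"
  shows "\<exists>d h. d > 0 \<and> summable h \<and>
    (\<forall>n. \<forall>s\<in>ball s0 d. norm (f (Suc n) * powr_diff r (of_nat (Suc n)) s) \<le> h n)"
proof -
  \<comment> \<open>half the distance of \<open>s0\<close> from the boundary of the half-plane, so that \<open>Re s + r \<ge> 1 + d\<close> on the disc\<close>
  define d where "d = (Re s0 + r - 1) / 2"
  have d: "d > 0" using s by (simp add: d_def)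
  have "bounded ((\<lambda>s. pochhammer s r) ` cball s0 d)"
    by (intro compact_imp_bounded compact_continuous_image)
       (auto simp: pochhammer_prod intro!: continuous_intros)
  then obtain K where "\<forall>z\<in>(\<lambda>s. pochhammer s r) ` cball s0 d. norm z \<le> K"
    unfolding bounded_iff by blast
  hence K: "norm (pochhammer s r) \<le> K" if "s \<in> cball s0 d" for s
    using that by blast
  have C: "C \<ge> 0" using order_trans[OF norm_ge_zero f[of 0]] .
  have K0: "K \<ge> 0" using order_trans[OF norm_ge_zero K[of s0]] d by simp
  have "summable (\<lambda>m. real m powr - (1 + d))"
    using d by (subst summable_real_powr_iff) auto
  hence "summable (\<lambda>m. real (Suc m) powr - (1 + d))"
    by (subst summable_Suc_iff)
  hence summ: "summable (\<lambda>m. C * (K * real (Suc m) powr - (1 + d)))"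
    by (intro summable_mult)
  have le: "norm (f (Suc n) * powr_diff r (of_nat (Suc n)) s) \<le> C * (K * real (Suc n) powr - (1 + d))"
    if "s \<in> ball s0 d" for n s
  proof -
    have "\<bar>Re (s0 - s)\<bar> < d"
      using that abs_Re_le_cmod[of "s0 - s"] by (auto simp: dist_norm)
    moreover have "2 * d = Re s0 + r - 1" by (simp add: d_def)
    ultimately have Re: "Re s + r \<ge> 1 + d" by (simp add: abs_if split: if_splits)
    have "norm (powr_diff r (of_real (real (Suc n))) s) \<le> norm (pochhammer s r) * real (Suc n) powr - (Re s + r)"
      using Re d by (intro norm_powr_diff_le) auto
    also have "\<dots> \<le> K * real (Suc n) powr - (1 + d)"
      using Re that K[of s] K0 by (intro mult_mono powr_mono) auto
    finally show ?thesis
      unfolding norm_mult using C f by (intro mult_mono) auto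
  qed
  show ?thesis
    by (rule exI[of _ d], rule exI[of _ "\<lambda>m. C * (K * real (Suc m) powr - (1 + d))"], intro conjI d summ allI ballI le)
qed

text \<open>
  Summation by parts. If \<open>f\<close> is periodic with mean zero, then its partial sums are periodic, and so are
  the partial sums minus their mean, which again have mean zero. Hence the series with \<open>f\<close> and \<open>r\<close> differences
  equals one of the same kind with \<open>r + 1\<close> differences plus an entire boundary term. Performing this \<open>i\<close> times
  continues the series \<open>i\<close> units beyond its half-plane of convergence.
\<close>
lemma powr_diff_series_continuation:
  fixes f :: "nat \<Rightarrow> complex"
  assumes "q > 0" "\<And>n. f (n + q) = f n" "(\<Sum>n<q. f n) = 0"
  shows "\<exists>G. G holomorphic_on {s. Re s > 1 - real r - real i} \<and>
           (\<forall>s. Re s > 1 \<longrightarrow> G s = (\<Sum>n. f (Suc n) * powr_diff r (of_nat (Suc n)) s))"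
  using assms
proof (induction i arbitrary: f r)
  case 0
  obtain C where C: "\<And>n. norm (f n) \<le> C" using periodic_bounded[of q f, OF 0(1,2)] by blast
  have "(\<lambda>s. \<Sum>n. f (Suc n) * powr_diff r (of_nat (Suc n)) s) holomorphic_on {s. Re s > 1 - real r}"
  proof (rule holomorphic_on_suminf)
    fix s assume "s \<in> {s. Re s > 1 - real r}"
    hence "Re s > 1 - real r" by simp
    from powr_diff_series_bound[of f C r s, OF C this] obtain d h where *: "d > 0 \<and> summable h \<and>
        (\<forall>n. \<forall>s'\<in>ball s d. norm (f (Suc n) * powr_diff r (of_nat (Suc n)) s') \<le> h n)"
      by (elim exE) (rule that)
    thus "\<exists>d>0. \<exists>h. summable h \<and> (\<forall>n. \<forall>y\<in>ball s d \<inter> {s. Re s > 1 - real r}.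
            norm (f (Suc n) * powr_diff r (of_nat (Suc n)) y) \<le> h n)"
      by (intro exI[of _ d] exI[of _ h] conjI allI ballI) (use * in auto)
  qed (intro holomorphic_on_mult holomorphic_on_const holomorphic_powr_diff open_halfspace_Re_gt)+
  thus ?case by (intro exI[of _ "\<lambda>s. \<Sum>n. f (Suc n) * powr_diff r (of_nat (Suc n)) s"]) simp
next
  case (Suc i)
  define S where "S n = (\<Sum>k\<le>n. f k)" for n
  define c where "c = (\<Sum>n<q. S n) / of_nat q"
  define F where "F n = S n - c" for n
  have S_per: "S (n + q) = S n" for n
  proof (induction n)
    case 0
    have "S q = (\<Sum>k<q. f k) + f q" unfolding S_def by (simp add: lessThan_Suc_atMost[symmetric])
    thus ?case using Suc.prems(2)[of 0] Suc.prems(3) by (simp add: S_def)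
  next
    case (Suc n)
    thus ?case using \<open>\<And>n. f (n + q) = f n\<close>[of "Suc n"] by (simp add: S_def)
  qed
  have F: "F (n + q) = F n" "(\<Sum>n<q. F n) = 0" for n
    using \<open>q > 0\<close> by (auto simp: F_def S_per sum_subtractf c_def)
  have diff: "f (Suc n) = F (Suc n) - F n" for n by (simp add: F_def S_def)
  obtain C where C: "\<And>n. norm (F n) \<le> C" using periodic_bounded[of q F, OF \<open>q > 0\<close> F(1)] by blast
  obtain G where G: "G holomorphic_on {s. Re s > 1 - real (Suc r) - real i}"
     "\<And>s. Re s > 1 \<Longrightarrow> G s = (\<Sum>n. F (Suc n) * powr_diff (Suc r) (of_nat (Suc n)) s)"
    using Suc.IH[of F "Suc r", OF \<open>q > 0\<close> F] by blast
  have "(\<Sum>n. f (Suc n) * powr_diff r (of_nat (Suc n)) s) = G s - F 0 * powr_diff r 1 s"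
    if s: "Re s > 1" for s
  proof -
    define h where "h n = powr_diff r (of_nat n) s" for n :: nat
    have h_Suc: "powr_diff (Suc r) (of_nat (Suc n)) s = h (Suc n) - h (Suc (Suc n))" for n
      by (simp add: h_def add_ac)
    \<comment> \<open>Abel summation; the boundary term at \<open>N\<close> vanishes in the limit\<close>
    have part: "(\<Sum>n<N. f (Suc n) * h (Suc n)) =
            (\<Sum>n<N. F (Suc n) * (h (Suc n) - h (Suc (Suc n)))) - F 0 * h 1 + F N * h (Suc N)" for N
      by (induction N) (auto simp: diff algebra_simps)
    have summ: "summable (\<lambda>n. F (Suc n) * powr_diff k (of_nat (Suc n)) s)" for k
    proof -
      have "Re s > 1 - real k" using s by simp
      from powr_diff_series_bound[of F C k s, OF C this] obtain d g where *: "d > 0 \<and> summable g \<and>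
          (\<forall>n. \<forall>s'\<in>ball s d. norm (F (Suc n) * powr_diff k (of_nat (Suc n)) s') \<le> g n)"
        by (elim exE) (rule that)
      show ?thesis
      proof (rule summable_comparison_test')
        show "summable g" using * by simp
        show "norm (F (Suc n) * powr_diff k (of_nat (Suc n)) s) \<le> g n" for n
          using * by (simp del: of_nat_Suc)
      qed
    qed
    have "(\<lambda>N. F N * h (Suc N)) \<longlonglongrightarrow> 0"
    proof -
      have "norm (1 :: complex) \<le> 1" "Re s > 1 - real r" using s by simp_all
      from powr_diff_series_bound[of "\<lambda>_. 1" 1 r s, OF this] obtain d g where g: "d > 0 \<and> summable g \<and>
          (\<forall>n. \<forall>s'\<in>ball s d. norm (1 * powr_diff r (of_nat (Suc n)) s') \<le> g n)"
        by (elim exE) (rule that)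
      have le: "norm (powr_diff r (of_nat (Suc n)) s) \<le> g n" for n
        using g by (simp del: of_nat_Suc)
      have "g \<longlonglongrightarrow> 0" using g by (intro summable_LIMSEQ_zero) simp
      hence Cg: "(\<lambda>n. C * g n) \<longlonglongrightarrow> 0" by (rule tendsto_mult_right_zero)
      have "norm (F n * h (Suc n)) \<le> C * g n" for n
        unfolding norm_mult h_def
        by (intro mult_mono C le norm_ge_zero order_trans[OF norm_ge_zero C[of n]])
      thus ?thesis
        by (intro Lim_null_comparison[OF always_eventually Cg] allI)
    qed
    moreover have "(\<lambda>N. \<Sum>n<N. F (Suc n) * (h (Suc n) - h (Suc (Suc n)))) \<longlonglongrightarrow> G s"
      using summable_sums[OF summ[of "Suc r"]] unfolding h_Suc G(2)[OF s] sums_def .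
    ultimately have "(\<lambda>N. \<Sum>n<N. f (Suc n) * h (Suc n)) \<longlonglongrightarrow> G s - F 0 * h 1 + 0"
      unfolding part by (intro tendsto_add tendsto_diff tendsto_const)
    hence "(\<lambda>n. f (Suc n) * h (Suc n)) sums (G s - F 0 * h 1)" by (simp add: sums_def)
    hence "(\<Sum>n. f (Suc n) * h (Suc n)) = G s - F 0 * h 1" by (rule sums_unique[symmetric])
    thus ?thesis by (simp only: h_def of_nat_1)
  qed
  moreover have "(\<lambda>s. G s - F 0 * powr_diff r 1 s) holomorphic_on {s. Re s > 1 - real r - real (Suc i)}"
  proof -
    have "1 - real (Suc r) - real i = 1 - real r - real (Suc i)" by simp
    with G(1) have "G holomorphic_on {s. Re s > 1 - real r - real (Suc i)}" by (simp only:)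
    thus ?thesis
      by (intro holomorphic_on_diff holomorphic_on_mult holomorphic_on_const holomorphic_powr_diff)
  qed
  ultimately show ?case by (intro exI[of _ "\<lambda>s. G s - F 0 * powr_diff r 1 s"]) auto
qed

text \<open>
  The continuations to different half-planes agree by the identity theorem and can be glued.
\<close>
lemma entire_if_half_planes:
  assumes "\<And>i::nat. \<exists>G. G holomorphic_on {s. Re s > 1 - real i} \<and> (\<forall>s. Re s > 1 \<longrightarrow> G s = D s)"
  shows "\<exists>G. G holomorphic_on UNIV \<and> (\<forall>s. Re s > 1 \<longrightarrow> G s = D s)"
proof -
  obtain G where G: "\<And>i::nat. G i holomorphic_on {s. Re s > 1 - real i}" "\<And>i s. Re s > 1 \<Longrightarrow> G i s = D s"
    using assms by metis
  have eq: "G i s = G j s" if "i \<le> j" "Re s > 1 - real i" for i j s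
  proof (rule analytic_continuation_open[of "{s. Re s > 1}" "{s. Re s > 1 - real i}" "G i" "G j" s])
    show "open {s. Re s > 1}" "open {s. Re s > 1 - real i}" by (simp_all add: open_halfspace_Re_gt)
    show "connected {s. Re s > 1 - real i}" by (rule convex_connected[OF convex_halfspace_Re_gt])
    have "(2 :: complex) \<in> {s. Re s > 1}" by simp
    thus "{s. Re s > 1} \<noteq> {}" by (metis empty_iff)
    show "G i holomorphic_on {s. Re s > 1 - real i}" by (rule G(1))
    show "G j holomorphic_on {s. Re s > 1 - real i}"
      by (rule holomorphic_on_subset[OF G(1)]) (use that in auto)
    show "G i z = G j z" if "z \<in> {s. Re s > 1}" for z using that G(2) by simp
  qed (use that in auto)
  \<comment> \<open>an index of a half-plane that contains \<open>s\<close>\<close>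
  define idx where "idx s = nat \<lceil>1 - Re s\<rceil> + 1" for s
  have idx: "Re s > 1 - real (idx s)" for s unfolding idx_def by linarith
  have eq': "G (idx s) s = G i s" if "Re s > 1 - real i" for i s
  proof (cases "idx s \<le> i")
    case True
    show ?thesis by (rule eq[OF True idx])
  next
    case False
    hence "i \<le> idx s" by simp
    from eq[OF this that] show ?thesis by (rule sym)
  qed
  have "(\<lambda>s. G (idx s) s) field_differentiable at s0" for s0
  proof -
    let ?H = "{s. Re s > 1 - real (idx s0)}"
    have "(\<lambda>s. G (idx s) s) holomorphic_on ?H"
      by (rule holomorphic_transform[OF G(1)[of "idx s0"]]) (use eq' in auto)
    moreover have "open ?H" "s0 \<in> ?H" using idx[of s0] open_halfspace_Re_gt by auto
    ultimately show ?thesis by (rule holomorphic_on_imp_differentiable_at)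
  qed
  hence "(\<lambda>s. G (idx s) s) holomorphic_on UNIV" by (simp add: holomorphic_on_def)
  moreover have "G (idx s) s = D s" if "Re s > 1" for s using G(2)[OF that] .
  ultimately show ?thesis by blast
qed

lemma dirichlet_series_mean_zero_entire:
  fixes f :: "nat \<Rightarrow> complex"
  assumes "q > 0" "\<And>n. f (n + q) = f n" "(\<Sum>n<q. f n) = 0"
  shows "\<exists>G. G holomorphic_on UNIV \<and> (\<forall>s. Re s > 1 \<longrightarrow> G s = dirichlet_series f s)"
proof (rule entire_if_half_planes)
  fix i
  have eq: "(\<Sum>n. f (Suc n) * powr_diff 0 (of_nat (Suc n)) s) = dirichlet_series f s" for s
    unfolding dirichlet_series_def powr_diff.simps powr_minus divide_inverse ..
  obtain G where G: "G holomorphic_on {s. Re s > 1 - real 0 - real i}"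
      "\<forall>s. Re s > 1 \<longrightarrow> G s = (\<Sum>n. f (Suc n) * powr_diff 0 (of_nat (Suc n)) s)"
    using powr_diff_series_continuation[of q f 0 i, OF assms] by (elim exE conjE)
  show "\<exists>G. G holomorphic_on {s. Re s > 1 - real i} \<and> (\<forall>s. Re s > 1 \<longrightarrow> G s = dirichlet_series f s)"
  proof (intro exI conjI)
    show "G holomorphic_on {s. Re s > 1 - real i}" using G(1) by simp
    show "\<forall>s. Re s > 1 \<longrightarrow> G s = dirichlet_series f s" using G(2) unfolding eq .
  qed
qed

lemma periodic_dirichlet_abs_conv:
  fixes f :: "nat \<Rightarrow> complex"
  assumes "q > 0" "\<And>n. f (n + q) = f n" "Re s > 1"
  shows "dirichlet_abs_conv f s"
proof -
  obtain C where "\<And>n. norm (f n) \<le> C" using periodic_bounded[of q f, OF assms(1,2)] by blast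
  thus ?thesis by (intro dirichlet_abs_conv_bounded[OF _ assms(3)])
qed

text \<open>
  Multiplying the Dirichlet series of \<open>f\<close> by \<open>1 - 2\<^sup>1\<^sup>-\<^sup>s\<close> subtracts \<open>2 f(n/2)\<close> from the coefficient at every even
  \<open>n\<close>. The new coefficients have period \<open>2 q\<close> and mean zero, so the product is entire. For \<open>f = 1\<close> this is
  the classical continuation of the zeta function by the alternating series.
\<close>
lemma dirichlet_series_periodic_meromorphic:
  fixes f :: "nat \<Rightarrow> complex"
  assumes q: "q > 0" and per: "\<And>n. f (n + q) = f n"
  shows "\<exists>F. F meromorphic_on UNIV \<and> (\<forall>s. Re s > 1 \<longrightarrow> F s = dirichlet_series f s)"
proof -
  \<comment> \<open>the coefficients of \<open>1 - 2\<^sup>1\<^sup>-\<^sup>s\<close> times the series of \<open>f\<close>\<close>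
  define g where "g n = f n + (-2) * dilate 2 f n" for n
  have "(\<Sum>n<2*q. dilate 2 f n) = (\<Sum>n\<in>(\<lambda>n. 2 * n) ` {..<q}. dilate 2 f n)"
    by (rule sum.mono_neutral_right) (auto simp: dilate_def elim!: dvdE)
  also have "\<dots> = (\<Sum>n<q. f n)"
    by (subst sum.reindex) (auto simp: inj_on_def dilate_def)
  finally have 1: "(\<Sum>n<2*q. dilate 2 f n) = (\<Sum>n<q. f n)" .
  have "(\<Sum>n<2*q. f n) = (\<Sum>n<q. f n) + (\<Sum>n\<in>{q..<2*q}. f n)"
    by (subst sum.union_disjoint[symmetric]) (auto intro!: sum.cong)
  also have "(\<Sum>n\<in>{q..<2*q}. f n) = (\<Sum>n<q. f n)"
    by (rule sum.reindex_bij_witness[of _ "\<lambda>n. n + q" "\<lambda>n. n - q"]) (auto simp: per, metis le_add_diff_inverse2 per)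
  finally have "(\<Sum>n<2*q. g n) = 0"
    unfolding g_def sum.distrib sum_distrib_left[symmetric] 1 by simp
  moreover have "g (n + 2 * q) = g n" for n
  proof -
    have "f (n + 2 * q) = f n" using per[of "n + q"] per[of n] by (simp only: mult_2 add.assoc)
    thus ?thesis by (auto simp: g_def dilate_def per)
  qed
  ultimately obtain G where G: "G holomorphic_on UNIV" "\<And>s. Re s > 1 \<Longrightarrow> G s = dirichlet_series g s"
    using dirichlet_series_mean_zero_entire[of "2 * q" g] q by auto
  define F where "F s = G s / (1 - 2 * (1 / 2) powr s)" for s
  have "F s = dirichlet_series f s" if s: "Re s > 1" for s
  proof -
    have conv: "dirichlet_abs_conv f s" by (rule periodic_dirichlet_abs_conv[of q f, OF q per s])
    have "G s = dirichlet_series f s + (-2) * ((1 / 2) powr s * dirichlet_series f s)"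
      unfolding G(2)[OF s] g_def[abs_def]
      using dirichlet_series_dilate[OF conv, of 2] dirichlet_series_cmult[of "dilate 2 f" s "-2"]
        dirichlet_series_add(2)[OF conv, of "\<lambda>n. (-2) * dilate 2 f n"]
      by simp
    also have "\<dots> = (1 - 2 * (1 / 2) powr s) * dirichlet_series f s" by (simp add: algebra_simps)
    finally have eq: "G s = (1 - 2 * (1 / 2) powr s) * dirichlet_series f s" .
    have "norm (2 * (1 / 2) powr s :: complex) = 2 * (1 / 2) powr Re s"
      using norm_powr_real_powr[of "1 / 2" s] by (simp add: norm_mult)
    also have "\<dots> < 2 * (1 / 2) powr 1" using s by (intro mult_strict_left_mono powr_less_mono') auto
    finally have "norm (2 * (1 / 2) powr s :: complex) < 1" by simp
    hence "2 * (1 / 2) powr s \<noteq> (1 :: complex)" by (intro notI) simp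
    hence "1 - 2 * (1 / 2) powr s \<noteq> 0" by simp
    thus ?thesis by (simp add: F_def eq)
  qed
  moreover have "F meromorphic_on UNIV"
    unfolding F_def using G(1)
    by (intro meromorphic_on_divide analytic_on_imp_meromorphic_on)
       (auto simp: analytic_on_open intro!: holomorphic_on_diff holomorphic_on_mult holomorphic_on_powr_right)
  ultimately show ?thesis by blast
qed

section \<open>Dirichlet characters and periodic coefficients\<close>

lemma zeta_root_power: "zeta_root e ^ i = exp (2 * of_real pi * \<i> * of_nat i / of_nat e)"
  unfolding zeta_root_def exp_of_nat_mult[symmetric] by (simp add: field_simps)

lemma zeta_root_power_eq_1_iff: "e > 0 \<Longrightarrow> zeta_root e ^ i = 1 \<longleftrightarrow> e dvd i"
  unfolding zeta_root_power by (rule complex_root_unity_eq_1) simp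

lemma zeta_root_nonzero [simp]: "zeta_root e \<noteq> 0"
  by (simp add: zeta_root_def)

lemma sum_zeta_root_power:
  assumes "e > 0"
  shows "(\<Sum>j<e. zeta_root e ^ (i * j)) = (if e dvd i then of_nat e else 0)"
proof (cases "e dvd i")
  case True
  thus ?thesis using zeta_root_power_eq_1_iff[OF assms, of i] by (simp add: power_mult)
next
  case False
  have "(zeta_root e ^ i) ^ e = (zeta_root e ^ e) ^ i" by (simp add: mult.commute flip: power_mult)
  also have "\<dots> = 1" using zeta_root_power_eq_1_iff[OF assms, of e] by simp
  finally have "(zeta_root e ^ i) ^ e = 1" .
  thus ?thesis using False zeta_root_power_eq_1_iff[OF assms, of i]
    by (simp add: power_mult sum_gp_strict)
qed

text \<open>
  Functions on the group of units modulo \<open>q\<close>, extended by zero.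
\<close>
definition unit_periodic :: "nat \<Rightarrow> (nat \<Rightarrow> complex) \<Rightarrow> bool" where
  "unit_periodic q f \<longleftrightarrow> (\<forall>n. f (n + q) = f n) \<and> (\<forall>n. \<not> coprime n q \<longrightarrow> f n = 0)"

definition dirichlet_character :: "nat \<Rightarrow> (nat \<Rightarrow> complex) \<Rightarrow> bool" where
  "dirichlet_character q \<psi> \<longleftrightarrow> unit_periodic q \<psi> \<and> \<psi> 1 = 1 \<and> (\<forall>m n. \<psi> (m * n) = \<psi> m * \<psi> n)"

lemma periodic_cong:
  fixes f :: "nat \<Rightarrow> 'a"
  assumes "\<And>n. f (n + q) = f n" "[m = n] (mod q)"
  shows "f m = f n"
proof -
  have per: "f (n + k * q) = f n" for n k
  proof (induction k)
    case (Suc k)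
    have "n + Suc k * q = (n + k * q) + q" by simp
    thus ?case using assms(1)[of "n + k * q"] Suc by (simp only:)
  qed auto
  have mod: "f n = f (n mod q)" for n
  proof -
    have "n mod q + n div q * q = n" by simp
    thus ?thesis using per[of "n mod q" "n div q"] by (simp only:)
  qed
  have "f (m mod q) = f (n mod q)" using assms(2) by (simp add: cong_def)
  thus ?thesis using mod[of m] mod[of n] by (simp only:)
qed

lemma unit_periodic_cong: "unit_periodic q f \<Longrightarrow> [m = n] (mod q) \<Longrightarrow> f m = f n"
  by (rule periodic_cong[of f q]) (auto simp: unit_periodic_def)

text \<open>
  By Euler's theorem, multiplication of the argument by a unit is an operator of finite order on these
  functions, hence diagonalizable.
\<close>
lemma unit_periodic_power_totient:
  assumes "unit_periodic q f" "coprime a q"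
  shows "f (a ^ totient q * n) = f n"
proof -
  have "[a ^ totient q * n = 1 * n] (mod q)"
    by (intro cong_mult euler_theorem assms(2)) simp
  thus ?thesis using unit_periodic_cong[OF assms(1)] by simp
qed

text \<open>
  The projection of \<open>f\<close> onto an eigenspace of the operator \<open>f(n) \<mapsto> f(a n)\<close>, whose \<open>e\<close>-th power is the
  identity; the eigenvalue is the inverse of the \<open>j\<close>-th power of \<open>zeta_root e\<close>.
\<close>
definition eigen_part :: "nat \<Rightarrow> nat \<Rightarrow> nat \<Rightarrow> (nat \<Rightarrow> complex) \<Rightarrow> nat \<Rightarrow> complex" where
  "eigen_part e a j f n = (\<Sum>i<e. zeta_root e ^ (i * j) * f (a ^ i * n)) / of_nat e"

lemma sum_eigen_part:
  assumes "e > 0"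
  shows "(\<Sum>j<e. eigen_part e a j f n) = f n"
proof -
  have "(\<Sum>j<e. eigen_part e a j f n) =
          (\<Sum>i<e. (\<Sum>j<e. zeta_root e ^ (i * j)) * f (a ^ i * n)) / of_nat e"
    unfolding eigen_part_def sum_divide_distrib[symmetric] sum_distrib_right
    by (subst sum.swap) simp
  also have "(\<Sum>i<e. (\<Sum>j<e. zeta_root e ^ (i * j)) * f (a ^ i * n)) =
               (\<Sum>i\<in>{0}. (\<Sum>j<e. zeta_root e ^ (i * j)) * f (a ^ i * n))"
    using assms by (intro sum.mono_neutral_right) (auto simp: sum_zeta_root_power dest: nat_dvd_not_less)
  finally show ?thesis using assms by simp
qed

lemma eigen_part_eigen:
  assumes f: "unit_periodic q f" and a: "coprime a q" and e: "e = totient q" "q > 0"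
  shows "eigen_part e a j f (a * n) = inverse (zeta_root e ^ j) * eigen_part e a j f n"
proof -
  let ?c = "\<lambda>i. zeta_root e ^ (i * j) * f (a ^ i * n)"
  have e0: "e > 0" using e by simp
  have "zeta_root e ^ e = 1" using zeta_root_power_eq_1_iff[OF e0, of e] by simp
  hence "zeta_root e ^ (e * j) = 1" by (simp add: power_mult)
  hence "?c e = ?c 0"
    using unit_periodic_power_totient[OF f a, of n] e(1) by simp
  hence "(\<Sum>i<e. ?c (Suc i)) = (\<Sum>i<e. ?c i)"
    using sum.lessThan_Suc_shift[of ?c e] sum.lessThan_Suc[of ?c e] by simp
  hence "zeta_root e ^ j * eigen_part e a j f (a * n) = eigen_part e a j f n"
    unfolding eigen_part_def times_divide_eq_right sum_distrib_left
    by (simp add: power_add mult_ac)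
  thus ?thesis by (simp add: field_simps)
qed

lemma unit_periodic_eigen_part:
  assumes f: "unit_periodic q f" 
  shows "unit_periodic q (eigen_part e a j f)"
  unfolding unit_periodic_def
proof (intro conjI allI impI)
  fix n
  have "f (a ^ i * (n + q)) = f (a ^ i * n)" for i
    by (rule unit_periodic_cong[OF f]) (simp add: cong_def distrib_left)
  thus "eigen_part e a j f (n + q) = eigen_part e a j f n" by (simp add: eigen_part_def)
next
  fix n assume "\<not> coprime n q"
  hence "f (a ^ i * n) = 0" for i
    using f by (auto simp: unit_periodic_def)
  thus "eigen_part e a j f n = 0" by (simp add: eigen_part_def)
qed

lemma eigen_part_preserves_eigen:
  assumes "\<And>n. f (b * n) = c * f n"
  shows "eigen_part e a j f (b * n) = c * eigen_part e a j f n"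
proof -
  have "f (a ^ i * (b * n)) = c * f (a ^ i * n)" for i
    using assms[of "a ^ i * n"] by (simp add: mult.left_commute)
  thus ?thesis by (simp add: eigen_part_def sum_distrib_left mult.left_commute)
qed

lemma closed_under_sum:
  assumes "Q (\<lambda>_. 0 :: complex)" "\<And>g h. Q g \<Longrightarrow> Q h \<Longrightarrow> Q (\<lambda>n :: nat. g n + h n)"
    and "\<And>j. j < (m :: nat) \<Longrightarrow> Q (F j)"
  shows "Q (\<lambda>n. \<Sum>j<m. F j n)"
  using assms(3)
proof (induction m)
  case (Suc m)
  hence "Q (\<lambda>n. \<Sum>j<m. F j n)" "Q (F m)" by auto
  from assms(2)[OF this] show ?case by simp
qed (use assms(1) in simp)

text \<open>
  Splitting \<open>f\<close> successively along the eigenspaces of the multiplications by the elements of \<open>A\<close> works because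
  the projections for one unit preserve the eigenfunctions for another one (\<open>eigen_part_preserves_eigen\<close>). Phrased as an induction
  principle for additive properties, this avoids carrying the resulting finite sums along.
\<close>
lemma unit_periodic_eigen_induct:
  assumes q: "q > 0" and zero: "Q (\<lambda>_. 0)"
    and add: "\<And>g h. Q g \<Longrightarrow> Q h \<Longrightarrow> Q (\<lambda>n. g n + h n)"
    and A: "finite A" "\<And>a. a \<in> A \<Longrightarrow> coprime a q"
    and eigen: "\<And>g. unit_periodic q g \<Longrightarrow> (\<And>a. a \<in> A \<Longrightarrow> \<exists>c. \<forall>n. g (a * n) = c * g n) \<Longrightarrow> Q g"
    and f: "unit_periodic q f"
  shows "Q f"
  using A eigen f
proof (induction A arbitrary: f rule: finite_induct)
  case empty
  thus ?case by blast
next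
  case (insert a A)
  define e where "e = totient q"
  have e: "e > 0" using q by (simp add: e_def)
  have "Q g" if g: "unit_periodic q g" "\<And>b. b \<in> A \<Longrightarrow> \<exists>c. \<forall>n. g (b * n) = c * g n" for g
  proof -
    have "Q (eigen_part e a j g)" for j
    proof (rule insert.prems(2))
      show "unit_periodic q (eigen_part e a j g)" by (rule unit_periodic_eigen_part[OF g(1)])
      fix b assume b: "b \<in> insert a A"
      show "\<exists>c. \<forall>n. eigen_part e a j g (b * n) = c * eigen_part e a j g n"
      proof (cases "b = a")
        case True
        thus ?thesis using eigen_part_eigen[OF g(1) insert.prems(1)[of a] e_def q] by blast
      next
        case False
        then obtain c where "\<forall>n. g (b * n) = c * g n" using g(2) b by blast
        hence "\<forall>n. eigen_part e a j g (b * n) = c * eigen_part e a j g n"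
          using eigen_part_preserves_eigen[of g b c] by blast
        thus ?thesis ..
      qed
    qed
    hence "Q (\<lambda>n. \<Sum>j<e. eigen_part e a j g n)"
      by (intro closed_under_sum[of Q] zero add)
    thus ?thesis by (simp only: sum_eigen_part[OF e])
  qed
  with insert.IH[of f] insert.prems(1,3) show ?case by blast
qed

text \<open>
  A simultaneous eigenfunction \<open>g\<close> satisfies \<open>g(a n) g(1) = g(a) g(n)\<close>, so it vanishes or is \<open>g(1)\<close> times a
  character. Thus the characters span all functions on the group of units.
\<close>
lemma dirichlet_character_induct:
  assumes q: "q > 0" and zero: "Q (\<lambda>_. 0)"
    and add: "\<And>g h. Q g \<Longrightarrow> Q h \<Longrightarrow> Q (\<lambda>n. g n + h n)"
    and character: "\<And>\<psi> c. dirichlet_character q \<psi> \<Longrightarrow> Q (\<lambda>n. c * \<psi> n)"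
    and f: "unit_periodic q f"
  shows "Q f"
proof (rule unit_periodic_eigen_induct[of q Q "{a. a < q \<and> coprime a q}", OF q zero add _ _ _ f])
  fix g assume g: "unit_periodic q g" "\<And>a. a \<in> {a. a < q \<and> coprime a q} \<Longrightarrow> \<exists>c. \<forall>n. g (a * n) = c * g n"
  have eig: "\<exists>c. \<forall>n. g (a * n) = c * g n" if "coprime a q" for a
  proof -
    have "a mod q < q" "coprime (a mod q) q" using that q by (auto simp: coprime_mod_left_iff)
    then obtain c where c: "\<And>n. g (a mod q * n) = c * g n" using g(2)[of "a mod q"] by blast
    have "g (a * n) = g (a mod q * n)" for n
      by (rule unit_periodic_cong[OF g(1)]) (simp add: cong_def mod_simps)
    thus ?thesis using c by metis
  qed
  have mult: "g (a * n) * g 1 = g a * g n" for a n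
  proof (cases "coprime a q")
    case True
    then obtain c where c: "\<And>n. g (a * n) = c * g n" using eig by blast
    from c[of 1] c[of n] show ?thesis by simp
  next
    case False
    hence "\<not> coprime (a * n) q" by simp
    with False show ?thesis using g(1) by (simp add: unit_periodic_def)
  qed
  show "Q g"
  proof (cases "g 1 = 0")
    case True
    hence "g a = 0" for a using mult[of a a] by simp
    hence "g = (\<lambda>_. 0)" by blast
    thus ?thesis using zero by simp
  next
    case False
    have "dirichlet_character q (\<lambda>n. g n / g 1)"
      using g(1) mult False by (auto simp: dirichlet_character_def unit_periodic_def field_simps)
    from character[OF this, of "g 1"] show ?thesis using False by simp
  qed
qed auto

lemma dirichlet_series_divide_power:
  assumes "dirichlet_abs_conv f (s + of_nat a)"
  shows "dirichlet_abs_conv (\<lambda>n. f n / of_nat n ^ a) s"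
    and "dirichlet_series (\<lambda>n. f n / of_nat n ^ a) s = dirichlet_series f (s + of_nat a)"
proof -
  have "((\<lambda>n. f n / of_nat n ^ a / of_nat n powr s) has_sum dirichlet_series f (s + of_nat a)) {0<..}
        \<longleftrightarrow> ((\<lambda>n. f n / of_nat n powr (s + of_nat a)) has_sum dirichlet_series f (s + of_nat a)) {0<..}"
    by (intro has_sum_cong) (auto simp: powr_add powr_nat' field_simps)
  with has_sum_dirichlet_series[OF assms]
  have sum: "((\<lambda>n. f n / of_nat n ^ a / of_nat n powr s) has_sum dirichlet_series f (s + of_nat a)) {0<..}"
    by blast
  show "dirichlet_abs_conv (\<lambda>n. f n / of_nat n ^ a) s"
    and "dirichlet_series (\<lambda>n. f n / of_nat n ^ a) s = dirichlet_series f (s + of_nat a)"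
    by (rule dirichlet_seriesI[OF sum])+
qed

lemma dirichlet_character_shift:
  fixes a :: nat
  assumes \<psi>: "dirichlet_character q \<psi>" "q > 0"
  defines "u \<equiv> (\<lambda>n. \<psi> n / of_nat n ^ a)"
  shows "completely_multiplicative u" "Re s > 1 \<Longrightarrow> dirichlet_abs_conv u s"
    and "\<exists>F. F meromorphic_on UNIV \<and> (\<forall>s. Re s > 1 \<longrightarrow> F s = dirichlet_series u s)"
proof -
  have per: "\<psi> (n + q) = \<psi> n" for n
    using \<psi> by (simp add: dirichlet_character_def unit_periodic_def)
  have conv: "dirichlet_abs_conv \<psi> s" if "Re s > 1" for s
    by (rule periodic_dirichlet_abs_conv[of q \<psi>, OF \<psi>(2) per that])
  show "completely_multiplicative u"
    using \<psi>(1) by (auto simp: completely_multiplicative_def u_def dirichlet_character_def power_mult_distrib)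
  show "Re s > 1 \<Longrightarrow> dirichlet_abs_conv u s"
    unfolding u_def by (intro dirichlet_series_divide_power conv) auto
  obtain F where F: "F meromorphic_on UNIV" "\<And>s. Re s > 1 \<Longrightarrow> F s = dirichlet_series \<psi> s"
    using dirichlet_series_periodic_meromorphic[of q \<psi>, OF \<psi>(2) per] by blast
  have "(\<lambda>s. F (s + of_nat a)) meromorphic_on UNIV"
    by (rule meromorphic_on_compose[OF F(1)]) (auto intro!: analytic_intros)
  moreover have "F (s + of_nat a) = dirichlet_series u s" if "Re s > 1" for s
    using that unfolding u_def by (simp add: F(2) dirichlet_series_divide_power conv)
  ultimately show "\<exists>F. F meromorphic_on UNIV \<and> (\<forall>s. Re s > 1 \<longrightarrow> F s = dirichlet_series u s)"
    by blast
qed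

lemma dirichlet_character_trivial: "dirichlet_character 1 (\<lambda>_. 1)"
  by (simp add: dirichlet_character_def unit_periodic_def)

text \<open>
  The Dirichlet series of \<open>A\<close> is \<open>L(\<psi>, s + a) \<zeta>(s + b)\<close>.
\<close>
lemma L_function_character:
  fixes a b :: nat
  assumes \<psi>: "dirichlet_character q \<psi>" "q > 0"
  defines "A \<equiv> dirichlet_conv (\<lambda>n. \<psi> n / of_nat n ^ a) (\<lambda>n. 1 / of_nat n ^ b)"
  shows "L_function A" "Re s > 1 \<Longrightarrow> dirichlet_abs_conv A s"
proof -
  note u = dirichlet_character_shift[where a = a, OF \<psi>]
  have "(1::nat) > 0" by simp
  note v = dirichlet_character_shift[where a = b, OF dirichlet_character_trivial this]
  show "Re s > 1 \<Longrightarrow> dirichlet_abs_conv A s"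
    unfolding A_def by (intro dirichlet_series_conv u(2) v(2))
  obtain Fu Fv where "Fu meromorphic_on UNIV" "\<And>s. Re s > 1 \<Longrightarrow> Fu s = dirichlet_series (\<lambda>n. \<psi> n / of_nat n ^ a) s"
    "Fv meromorphic_on UNIV" "\<And>s. Re s > 1 \<Longrightarrow> Fv s = dirichlet_series (\<lambda>n. 1 / of_nat n ^ b) s"
    using u(3) v(3) by blast
  thus "L_function A"
    unfolding A_def by (intro L_function_dirichlet_conv[of _ _ Fu Fv] u(1,2) v(1,2))
qed

lemma dirichlet_conv_dilate:
  assumes "g > 0"
  shows "dirichlet_conv (dilate g v) w = dilate g (dirichlet_conv v w)"
proof
  fix n
  have eq: "(\<Sum>d\<in>{d. d dvd n} \<inter> {d. g dvd d}. v (d div g) * w (n div d)) = dilate g (dirichlet_conv v w) n" if "n > 0"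
  proof (cases "g dvd n")
    case True
    then obtain m where m: "n = g * m" by (elim dvdE)
    have "(\<Sum>d\<in>{d. d dvd n} \<inter> {d. g dvd d}. v (d div g) * w (n div d)) =
            (\<Sum>i | i dvd m. v i * w (m div i))"
    proof -
      have "{d. d dvd n} \<inter> {d. g dvd d} = (\<lambda>i. g * i) ` {i. i dvd m}"
        using assms m by (auto elim: dvdE)
      thus ?thesis using assms m by (simp add: sum.reindex inj_on_def)
    qed
    thus ?thesis using m assms by (simp add: dilate_def dirichlet_conv_def)
  next
    case False
    hence "{d. d dvd n} \<inter> {d. g dvd d} = {}" by (auto dest: dvd_trans)
    thus ?thesis using False by (simp add: dilate_def)
  qed
  show "dirichlet_conv (dilate g v) w n = dilate g (dirichlet_conv v w) n"
  proof (cases "n = 0")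
    case False
    have "dirichlet_conv (dilate g v) w n = (\<Sum>d | d dvd n. if g dvd d then v (d div g) * w (n div d) else 0)"
      unfolding dirichlet_conv_def dilate_def by (intro sum.cong) auto
    also have "\<dots> = (\<Sum>d\<in>{d. d dvd n} \<inter> {d. g dvd d}. v (d div g) * w (n div d))"
      using False by (subst sum.inter_restrict) auto
    finally show ?thesis using eq False by simp
  qed (use assms in \<open>simp add: dilate_def dirichlet_conv_def\<close>)
qed

lemma dirichlet_conv_add: "dirichlet_conv (\<lambda>n. u n + v n) w n = dirichlet_conv u w n + dirichlet_conv v w n"
  by (simp add: dirichlet_conv_def distrib_right sum.distrib)

lemma dirichlet_conv_cmult: "dirichlet_conv (\<lambda>n. c * u n) w n = c * dirichlet_conv u w n"
  by (simp add: dirichlet_conv_def sum_distrib_left mult.assoc)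

lemma dirichlet_conv_sum:
  "dirichlet_conv (\<lambda>n. \<Sum>x\<in>X. u x n) w n = (\<Sum>x\<in>X. dirichlet_conv (u x) w n)"
  unfolding dirichlet_conv_def sum_distrib_right by (rule sum.swap)

text \<open>
  The integers \<open>n\<close> are sorted by \<open>g = gcd n N\<close>; then \<open>n div g\<close> is a unit modulo \<open>N div g\<close>.
\<close>
lemma sum_dilate_unit_periodic:
  fixes h :: "nat \<Rightarrow> complex"
  assumes N: "N > 0"
  defines "hg \<equiv> (\<lambda>g i. if coprime i (N div g) then h (g * i) else 0)"
  shows "(\<Sum>g | g dvd N. dilate g (hg g) n) = h n"
proof -
  have "dilate g (hg g) n = (if g = gcd n N then h n else 0)" if g: "g dvd N" for g
  proof (cases "g dvd n")
    case True
    obtain m k where mk: "n = g * m" "N = g * k" using True g by (elim dvdE)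
    have "g > 0" using N mk by auto
    have "gcd n N = g * gcd m k" unfolding mk by (simp add: gcd_mult_left)
    hence iff: "g = gcd n N \<longleftrightarrow> coprime m k"
      using \<open>g > 0\<close> by (metis coprime_iff_gcd_eq_1 mult.right_neutral mult_cancel1 less_irrefl)
    have "dilate g (hg g) n = (if coprime m k then h n else 0)"
      using mk \<open>g > 0\<close> by (simp add: dilate_def hg_def)
    thus ?thesis by (simp only: iff)
  next
    case False
    hence "g \<noteq> gcd n N" by auto
    thus ?thesis using False by (simp add: dilate_def)
  qed
  hence "(\<Sum>g | g dvd N. dilate g (hg g) n) = (\<Sum>g | g dvd N. if g = gcd n N then h n else 0)"
    by (intro sum.cong) auto
  also have "\<dots> = h n" using N by (simp add: finite_divisors_nat)
  finally show ?thesis .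
qed

lemma dirichlet_conv_zero: "dirichlet_conv (\<lambda>_. 0) w = (\<lambda>_. 0)"
  by (simp add: dirichlet_conv_def fun_eq_iff)

lemma L_combination_unit_periodic:
  assumes q: "q > 0" and f: "unit_periodic q f" and g: "g > 0"
  shows "L_combination (dilate g (dirichlet_conv (\<lambda>n. f n / of_nat n ^ a) (\<lambda>n. 1 / of_nat n ^ b)))"
proof (rule dirichlet_character_induct[of q, OF q _ _ _ f])
  let ?T = "\<lambda>f. dilate g (dirichlet_conv (\<lambda>n. f n / of_nat n ^ a) (\<lambda>n. 1 / of_nat n ^ b))"
  have "?T (\<lambda>_. 0) = (\<lambda>_. 0)" by (auto simp: dirichlet_conv_zero dilate_def fun_eq_iff)
  thus "L_combination (?T (\<lambda>_. 0))" by (simp add: L_combination_0)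
  show "L_combination (?T (\<lambda>n. u n + v n))" if "L_combination (?T u)" "L_combination (?T v)" for u v
  proof -
    have "?T (\<lambda>n. u n + v n) = (\<lambda>n. ?T u n + ?T v n)"
      by (auto simp: fun_eq_iff dilate_def add_divide_distrib dirichlet_conv_add)
    thus ?thesis using L_combination_add[OF that] by simp
  qed
  show "L_combination (?T (\<lambda>n. c * \<psi> n))" if \<psi>: "dirichlet_character q \<psi>" for \<psi> c
  proof -
    have "?T (\<lambda>n. c * \<psi> n) = (\<lambda>n. c * ?T \<psi> n)"
    proof -
      have *: "(\<lambda>n. c * \<psi> n / of_nat n ^ a) = (\<lambda>n. c * (\<psi> n / of_nat n ^ a))" by simp
      show ?thesis
        by (rule ext) (simp only: * dilate_def dirichlet_conv_cmult, simp)
    qed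
    moreover have "L_combination (?T \<psi>)"
      by (intro L_combination_dilate L_function_character[OF \<psi> q] g)
    ultimately show ?thesis using L_combination_cmult by simp
  qed
qed

text \<open>
  After sorting by \<open>gcd n N\<close>, the function \<open>h\<close> is a sum of dilated functions on groups of units, whose
  expansions into characters give the L-functions \<open>L(\<psi>, s + a) \<zeta>(s + b)\<close>. Dilation of
  the first factor of a convolution dilates the convolution.
\<close>
theorem L_combination_periodic:
  assumes N: "N > 0" and h: "\<And>n. h (n + N) = h n"
  shows "L_combination (dirichlet_conv (\<lambda>n. h n / of_nat n ^ a) (\<lambda>n. 1 / of_nat n ^ b))"
proof -
  define hg where "hg g i = (if coprime i (N div g) then h (g * i) else 0)" for g i
  let ?w = "\<lambda>n. 1 / of_nat n ^ b"
  have "h n / of_nat n ^ a = (\<Sum>g | g dvd N. (1 / of_nat g ^ a) * dilate g (\<lambda>i. hg g i / of_nat i ^ a) n)" for n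
  proof -
    have "h n / of_nat n ^ a = (\<Sum>g | g dvd N. dilate g (hg g) n / of_nat n ^ a)"
    proof -
      have "(\<Sum>g | g dvd N. dilate g (hg g) n) = h n"
        using sum_dilate_unit_periodic[OF N, of h n] unfolding hg_def .
      thus ?thesis by (simp flip: sum_divide_distrib)
    qed
    also have "\<dots> = (\<Sum>g | g dvd N. (1 / of_nat g ^ a) * dilate g (\<lambda>i. hg g i / of_nat i ^ a) n)"
      using N by (intro sum.cong) (auto simp: dilate_def power_mult_distrib elim!: dvdE)
    finally show ?thesis .
  qed
  hence eq: "(\<lambda>n. h n / of_nat n ^ a) =
      (\<lambda>n. \<Sum>g | g dvd N. (1 / of_nat g ^ a) * dilate g (\<lambda>i. hg g i / of_nat i ^ a) n)"
    by (rule ext)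
  have eq: "dirichlet_conv (\<lambda>n. h n / of_nat n ^ a) ?w =
      (\<lambda>n. \<Sum>g | g dvd N. (1 / of_nat g ^ a) * dilate g (dirichlet_conv (\<lambda>i. hg g i / of_nat i ^ a) ?w) n)"
  proof (rule ext)
    fix n
    show "dirichlet_conv (\<lambda>n. h n / of_nat n ^ a) ?w n =
        (\<Sum>g | g dvd N. (1 / of_nat g ^ a) * dilate g (dirichlet_conv (\<lambda>i. hg g i / of_nat i ^ a) ?w) n)"
      unfolding eq dirichlet_conv_sum dirichlet_conv_cmult
      using N by (intro sum.cong refl) (auto simp: dirichlet_conv_dilate dvd_pos_nat)
  qed
  have hg: "unit_periodic (N div g) (hg g)" if g: "g dvd N" for g
  proof -
    have "hg g (i + N div g) = hg g i" for i
    proof -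
      have "coprime (i + N div g) (N div g) \<longleftrightarrow> coprime i (N div g)"
        by (simp only: coprime_iff_gcd_eq_1 gcd_add1)
      thus ?thesis using g h[of "g * i"] by (simp add: hg_def distrib_left)
    qed
    thus ?thesis by (simp add: unit_periodic_def hg_def)
  qed
  have pos: "N div g > 0" "g > 0" if "g dvd N" for g
    using that N by (auto elim!: dvdE)
  show ?thesis
    unfolding eq
  proof (rule L_combination_sum, rule L_combination_cmult)
    fix g assume "g \<in> {g. g dvd N}"
    hence g: "g dvd N" by simp
    show "L_combination (dilate g (dirichlet_conv (\<lambda>i. hg g i / of_nat i ^ a) ?w))"
      by (rule L_combination_unit_periodic[OF pos(1)[OF g] hg[OF g] pos(2)[OF g]])
  qed
qed

section \<open>Series of simple poles and their Stokes constants\<close>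

text \<open>
  A Mittag-Leffler series: the summand \<open>1/\<rho>\<close> improves the general term from \<open>c m / m\<close> to \<open>c m / m\<^sup>2\<close> on compact
  sets.
\<close>
definition pole_series :: "complex \<Rightarrow> (nat \<Rightarrow> complex) \<Rightarrow> complex \<Rightarrow> complex" where
  "pole_series A c \<zeta> = (\<Sum>m. c m * (1 / (\<zeta> - A * of_nat (Suc m)) + 1 / (A * of_nat (Suc m))))"

lemma norm_pole_le:
  assumes "norm \<zeta> \<le> R" "norm \<rho> \<ge> 2 * R" "R > 0"
  shows "norm (1 / (\<zeta> - \<rho>) + 1 / \<rho> :: complex) \<le> 2 * R / norm \<rho> ^ 2"
proof -
  have \<rho>: "norm \<rho> > 0" using assms by linarith
  have "norm (\<zeta> - \<rho>) \<ge> norm \<rho> - norm \<zeta>" by (metis norm_minus_commute norm_triangle_ineq2)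
  hence *: "norm (\<zeta> - \<rho>) \<ge> norm \<rho> / 2" using assms by linarith
  hence "norm (\<zeta> - \<rho>) > 0" using \<rho> by linarith
  hence "1 / (\<zeta> - \<rho>) + 1 / \<rho> = \<zeta> / (\<rho> * (\<zeta> - \<rho>))" using \<rho> by (auto simp: field_simps)
  hence "norm (1 / (\<zeta> - \<rho>) + 1 / \<rho>) = norm \<zeta> / (norm \<rho> * norm (\<zeta> - \<rho>))"
    by (simp add: norm_divide norm_mult)
  also have "\<dots> \<le> R / (norm \<rho> * (norm \<rho> / 2))"
    using assms \<rho> * by (intro frac_le mult_left_mono mult_pos_pos) auto
  also have "R / (norm \<rho> * (norm \<rho> / 2)) = 2 * R / norm \<rho> ^ 2"
    by (simp add: power2_eq_square)
  finally show ?thesis .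
qed

lemma pole_series_term_bound:
  fixes A \<zeta> :: complex and c :: "nat \<Rightarrow> complex"
  assumes R: "2 * R \<le> norm A * real (Suc m)" "R > 0" and \<zeta>: "norm \<zeta> \<le> R"
  shows "norm (c m * (1 / (\<zeta> - A * of_nat (Suc m)) + 1 / (A * of_nat (Suc m)))) \<le>
           2 * R / norm A ^ 2 * (norm (c m) / real (Suc m) ^ 2)"
proof -
  have "norm (1 / (\<zeta> - A * of_nat (Suc m)) + 1 / (A * of_nat (Suc m))) \<le> 2 * R / norm (A * of_nat (Suc m)) ^ 2"
    by (rule norm_pole_le) (use assms in \<open>auto simp: norm_mult simp del: of_nat_Suc\<close>)
  also have "norm (A * of_nat (Suc m)) = norm A * real (Suc m)"
    by (simp add: norm_mult del: of_nat_Suc)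
  finally have "norm (1 / (\<zeta> - A * of_nat (Suc m)) + 1 / (A * of_nat (Suc m))) \<le> 2 * R / (norm A * real (Suc m)) ^ 2" .
  hence "norm (c m) * norm (1 / (\<zeta> - A * of_nat (Suc m)) + 1 / (A * of_nat (Suc m)))
           \<le> norm (c m) * (2 * R / (norm A * real (Suc m)) ^ 2)"
    by (rule mult_left_mono) simp
  also have "\<dots> = 2 * R / norm A ^ 2 * (norm (c m) / real (Suc m) ^ 2)"
    by (simp add: power_mult_distrib del: of_nat_Suc)
  finally show ?thesis by (simp only: norm_mult)
qed

text \<open>
  On a given disc all but finitely many terms add up to a holomorphic function, so that every local question about the
  series concerns a finite sum of poles.
\<close>
lemma pole_series_tail:
  assumes A: "A \<noteq> 0" and c: "summable (\<lambda>m. norm (c m) / real (Suc m) ^ 2)"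
  shows "\<exists>K T. K > n \<and> T holomorphic_on ball 0 R \<and>
     (\<forall>\<zeta>\<in>ball 0 R. pole_series A c \<zeta> =
        (\<Sum>m<K. c m * (1 / (\<zeta> - A * of_nat (Suc m)) + 1 / (A * of_nat (Suc m)))) + T \<zeta>)"
proof -
  define R' where "R' = max R 1"
  obtain k :: nat where k: "2 * R' / norm A \<le> real k" using real_arch_simple by blast
  define K where "K = max (Suc n) k"
  let ?f = "\<lambda>\<zeta> m. c m * (1 / (\<zeta> - A * of_nat (Suc m)) + 1 / (A * of_nat (Suc m)))"
  let ?T = "\<lambda>\<zeta>. \<Sum>m. ?f \<zeta> (m + K)"
  let ?h = "\<lambda>m. 2 * R' / norm A ^ 2 * (norm (c (m + K)) / real (Suc (m + K)) ^ 2)"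
  have h: "summable ?h" using c by (intro summable_mult) (subst summable_iff_shift)
  have R': "R' > 0" "R \<le> R'" by (auto simp: R'_def)
  have K: "2 * R' \<le> norm A * real (Suc (m + K))" for m
  proof -
    have "2 * R' \<le> norm A * real k" using k A by (simp add: field_simps)
    also have "\<dots> \<le> norm A * real (Suc (m + K))" by (intro mult_left_mono) (auto simp: K_def)
    finally show ?thesis .
  qed
  have bound: "norm (?f \<zeta> (m + K)) \<le> ?h m" if "\<zeta> \<in> ball 0 R" for \<zeta> m
    using that R' by (intro pole_series_term_bound K) auto
  have "?T holomorphic_on ball 0 R"
  proof (rule holomorphic_on_suminf)
    fix m
    have ne: "\<zeta> - A * of_nat (Suc (m + K)) \<noteq> 0" if "\<zeta> \<in> ball 0 R" for \<zeta>
    proof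
      assume "\<zeta> - A * of_nat (Suc (m + K)) = 0"
      hence "norm \<zeta> = norm A * real (Suc (m + K))" by (simp add: norm_mult del: of_nat_Suc)
      moreover have "norm \<zeta> < R'" using that R' by simp
      ultimately show False using K[of m] R' by linarith
    qed
    show "(\<lambda>\<zeta>. ?f \<zeta> (m + K)) holomorphic_on ball 0 R"
      by (intro holomorphic_on_mult holomorphic_on_add holomorphic_on_divide holomorphic_on_diff
                holomorphic_on_const holomorphic_on_ident ne)
  next
    fix x :: complex
    show "\<exists>d>0. \<exists>h. summable h \<and> (\<forall>m. \<forall>\<zeta>\<in>ball x d \<inter> ball 0 R. norm (?f \<zeta> (m + K)) \<le> h m)"
      by (rule exI[of _ 1], rule conjI, simp, rule exI[of _ ?h], intro conjI h allI ballI bound) simp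
  qed simp
  moreover have "pole_series A c \<zeta> = (\<Sum>m<K. ?f \<zeta> m) + ?T \<zeta>" if "\<zeta> \<in> ball 0 R" for \<zeta>
  proof -
    have "summable (\<lambda>m. ?f \<zeta> (m + K))"
      by (rule summable_comparison_test'[OF h]) (rule bound[OF that])
    hence "summable (?f \<zeta>)" by (subst (asm) summable_iff_shift)
    thus ?thesis unfolding pole_series_def
      by (subst suminf_split_initial_segment[of _ K]) (simp_all only: add.commute)
  qed
  moreover have "K > n" by (simp add: K_def)
  ultimately show ?thesis by blast
qed

lemma analytic_at_if_eq_on_ball:
  fixes f g :: "complex \<Rightarrow> complex"
  assumes "g analytic_on {z}" "norm z < R" "\<And>w. w \<in> ball 0 R \<Longrightarrow> f w = g w"
  shows "f analytic_on {z}"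
proof -
  have "eventually (\<lambda>w. w \<in> ball 0 R) (nhds z)"
    using assms(2) by (intro eventually_nhds_in_open) auto
  hence "eventually (\<lambda>w. f w = g w) (nhds z)"
    by eventually_elim (rule assms(3))
  thus ?thesis using assms(1) by (simp cong: analytic_at_cong)
qed

lemma analytic_pole_series:
  assumes A: "A \<noteq> 0" and c: "summable (\<lambda>m. norm (c m) / real (Suc m) ^ 2)"
    and z: "\<And>m. z \<noteq> A * of_nat (Suc m)"
  shows "pole_series A c analytic_on {z}"
proof -
  define R where "R = norm z + 1"
  obtain K T where KT: "T holomorphic_on ball 0 R"
    "\<And>\<zeta>. \<zeta> \<in> ball 0 R \<Longrightarrow> pole_series A c \<zeta> =
        (\<Sum>m<K. c m * (1 / (\<zeta> - A * of_nat (Suc m)) + 1 / (A * of_nat (Suc m)))) + T \<zeta>"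
    using pole_series_tail[OF A c, of 0 R] by blast
  have "T analytic_on {z}"
    using KT(1) by (rule holomorphic_on_imp_analytic_at) (auto simp: R_def)
  hence "(\<lambda>\<zeta>. (\<Sum>m<K. c m * (1 / (\<zeta> - A * of_nat (Suc m)) + 1 / (A * of_nat (Suc m)))) + T \<zeta>) analytic_on {z}"
    using z A by (intro analytic_intros) (auto simp del: of_nat_Suc)
  thus ?thesis by (rule analytic_at_if_eq_on_ball[OF _ _ KT(2)]) (simp_all add: R_def)
qed

lemma pole_series_at_pole:
  fixes n :: nat
  assumes A: "A \<noteq> 0" and c: "summable (\<lambda>m. norm (c m) / real (Suc m) ^ 2)"
  defines "\<rho> \<equiv> A * of_nat (Suc n)"
  shows "\<exists>g. g analytic_on {\<rho>} \<and> (\<forall>\<^sub>F \<zeta> in at \<rho>. pole_series A c \<zeta> = c n / (\<zeta> - \<rho>) + g \<zeta>)"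
proof -
  define R where "R = norm \<rho> + 1"
  let ?f = "\<lambda>\<zeta> m. c m * (1 / (\<zeta> - A * of_nat (Suc m)) + 1 / (A * of_nat (Suc m)))"
  obtain K T where KT: "K > n" "T holomorphic_on ball 0 R"
    "\<And>\<zeta>. \<zeta> \<in> ball 0 R \<Longrightarrow> pole_series A c \<zeta> = (\<Sum>m<K. ?f \<zeta> m) + T \<zeta>"
    using pole_series_tail[OF A c, of n R] by blast
  define g where "g \<zeta> = c n / \<rho> + (\<Sum>m\<in>{..<K} - {n}. ?f \<zeta> m) + T \<zeta>" for \<zeta>
  have T: "T analytic_on {\<rho>}"
    using KT(2) by (rule holomorphic_on_imp_analytic_at) (auto simp: R_def)
  have ne: "\<rho> - A * of_nat (Suc m) \<noteq> 0" "A * of_nat (Suc m) \<noteq> 0" if "m \<in> {..<K} - {n}" for m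
    using that A by (auto simp: \<rho>_def simp del: of_nat_Suc)
  have "g analytic_on {\<rho>}"
    unfolding g_def using T A by (intro analytic_intros) (use ne in \<open>auto simp del: of_nat_Suc\<close>)
  moreover have "\<forall>\<^sub>F \<zeta> in at \<rho>. \<zeta> \<in> ball 0 R - {\<rho>}"
    by (rule eventually_at_in_open) (auto simp: R_def)
  hence "\<forall>\<^sub>F \<zeta> in at \<rho>. pole_series A c \<zeta> = c n / (\<zeta> - \<rho>) + g \<zeta>"
  proof eventually_elim
    case (elim \<zeta>)
    have "(\<Sum>m<K. ?f \<zeta> m) = ?f \<zeta> n + (\<Sum>m\<in>{..<K} - {n}. ?f \<zeta> m)"
      using KT(1) by (intro sum.remove) auto
    thus ?case using elim KT(3)[of \<zeta>] by (simp add: g_def \<rho>_def ring_distribs del: of_nat_Suc)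
  qed
  ultimately show ?thesis by blast
qed

lemma has_fps_expansion_simple_pole:
  assumes "\<rho> \<noteq> 0"
  shows "(\<lambda>\<zeta>. 1 / (\<zeta> - \<rho>) + 1 / \<rho> :: complex) has_fps_expansion
           Abs_fps (\<lambda>n. if n = 0 then 0 else - 1 / \<rho> ^ Suc n)"
proof (rule has_fps_expansionI)
  have "\<forall>\<^sub>F \<zeta> in nhds 0. \<zeta> \<in> ball 0 (norm \<rho>)"
    using assms by (intro eventually_nhds_in_open) auto
  thus "\<forall>\<^sub>F \<zeta> in nhds 0. (\<lambda>n. fps_nth (Abs_fps (\<lambda>n. if n = 0 then 0 else - 1 / \<rho> ^ Suc n)) n * \<zeta> ^ n)
          sums (1 / (\<zeta> - \<rho>) + 1 / \<rho>)"
  proof eventually_elim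
    case (elim \<zeta>)
    hence "norm (\<zeta> / \<rho>) < 1" using assms by (simp add: norm_divide divide_simps)
    hence "(\<lambda>n. (\<zeta> / \<rho>) ^ n) sums (1 / (1 - \<zeta> / \<rho>))" by (rule geometric_sums)
    hence "(\<lambda>n. (- 1 / \<rho>) * (\<zeta> / \<rho>) ^ n) sums ((- 1 / \<rho>) * (1 / (1 - \<zeta> / \<rho>)))" by (rule sums_mult)
    also have "(- 1 / \<rho>) * (1 / (1 - \<zeta> / \<rho>)) = 1 / (\<zeta> - \<rho>)"
      using assms elim by (auto simp: divide_simps)
    finally have "(\<lambda>n. (if n = 0 then 1 / \<rho> else 0) + (- 1 / \<rho>) * (\<zeta> / \<rho>) ^ n) sums (1 / \<rho> + 1 / (\<zeta> - \<rho>))"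
      using sums_single[of 0 "\<lambda>_. 1 / \<rho>"] by (intro sums_add) auto
    moreover have "(\<lambda>n. (if n = 0 then 1 / \<rho> else 0) + (- 1 / \<rho>) * (\<zeta> / \<rho>) ^ n) =
            (\<lambda>n. fps_nth (Abs_fps (\<lambda>n. if n = 0 then 0 else - 1 / \<rho> ^ Suc n)) n * \<zeta> ^ n)"
      by (auto simp: fun_eq_iff power_divide)
    ultimately show ?case by (simp add: add.commute)
  qed
qed

text \<open>
  Near \<open>0\<close> the series converges uniformly, so its Taylor coefficients are the sums of the Taylor
  coefficients of the terms, which are geometric series.
\<close>
lemma has_fps_expansion_pole_series:
  assumes A: "A \<noteq> 0" and c: "summable (\<lambda>m. norm (c m) / real (Suc m) ^ 2)"
  shows "pole_series A c has_fps_expansion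
           Abs_fps (\<lambda>n. if n = 0 then 0 else - (\<Sum>m. c m / (A * of_nat (Suc m)) ^ Suc n))"
proof -
  let ?f = "\<lambda>m \<zeta>. c m * (1 / (\<zeta> - A * of_nat (Suc m)) + 1 / (A * of_nat (Suc m)))"
  define r where "r = norm A / 2"
  have r: "r > 0" using A by (simp add: r_def)
  have Am: "A * of_nat (Suc m) \<noteq> 0" for m using A by (simp del: of_nat_Suc)
  have Am': "norm (A * of_nat (Suc m)) \<ge> norm A" for m
  proof -
    have "norm A * 1 \<le> norm A * real (Suc m)" by (intro mult_left_mono) auto
    thus ?thesis unfolding norm_mult norm_of_nat by (simp del: of_nat_Suc)
  qed
  have rm: "2 * r \<le> norm A * real (Suc m)" for m
    using Am'[of m] unfolding norm_mult norm_of_nat by (simp add: r_def)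
  have ulim: "uniform_limit (ball 0 r) (\<lambda>n \<zeta>. \<Sum>m<n. ?f m \<zeta>) (\<lambda>\<zeta>. \<Sum>m. ?f m \<zeta>) sequentially"
  proof (rule Weierstrass_m_test)
    show "norm (?f m \<zeta>) \<le> 2 * r / norm A ^ 2 * (norm (c m) / real (Suc m) ^ 2)" if "\<zeta> \<in> ball 0 r" for m and \<zeta> :: complex
      using that by (intro pole_series_term_bound[OF rm r]) auto
    show "summable (\<lambda>m. 2 * r / norm A ^ 2 * (norm (c m) / real (Suc m) ^ 2))"
      by (intro summable_mult c)
  qed
  have hol: "(\<lambda>\<zeta>. \<Sum>m<n. ?f m \<zeta>) holomorphic_on ball 0 r" for n
  proof (intro holomorphic_on_sum holomorphic_on_mult holomorphic_on_add holomorphic_on_divide holomorphic_on_diff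
                holomorphic_on_const holomorphic_on_ident Am)
    fix m and \<zeta> :: complex assume "\<zeta> \<in> ball 0 r"
    hence "2 * norm \<zeta> < norm A" by (simp add: r_def)
    hence "norm \<zeta> < norm (A * of_nat (Suc m))"
      using Am'[of m] norm_ge_zero[of \<zeta>] by linarith
    thus "\<zeta> - A * of_nat (Suc m) \<noteq> 0" by auto
  qed
  have coeff: "(deriv ^^ n) (pole_series A c) 0 / fact n = - (\<Sum>m. c m / (A * of_nat (Suc m)) ^ Suc n)"
    if n: "n > 0" for n
  proof -
    have lim: "(\<lambda>N. (deriv ^^ n) (\<lambda>\<zeta>. \<Sum>m<N. ?f m \<zeta>) 0) \<longlonglongrightarrow> (deriv ^^ n) (\<lambda>\<zeta>. \<Sum>m. ?f m \<zeta>) 0"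
      by (rule higher_deriv_complex_uniform_limit[OF ulim]) (use r in \<open>simp_all add: hol del: of_nat_Suc\<close>)
    have "(deriv ^^ n) (\<lambda>\<zeta>. \<Sum>m<N. ?f m \<zeta>) 0 = fact n * (\<Sum>m<N. - (c m / (A * of_nat (Suc m)) ^ Suc n))" for N
    proof -
      have "(\<lambda>\<zeta>. \<Sum>m<N. ?f m \<zeta>) has_fps_expansion
              (\<Sum>m<N. fps_const (c m) * Abs_fps (\<lambda>n. if n = 0 then 0 else - 1 / (A * of_nat (Suc m)) ^ Suc n))"
        by (intro has_fps_expansion_sum has_fps_expansion_mult has_fps_expansion_const has_fps_expansion_simple_pole Am)
      from fps_nth_fps_expansion[OF this, of n] show ?thesis
        using n by (simp add: fps_sum_nth field_simps del: of_nat_Suc power_Suc)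
    qed
    with lim have "(\<lambda>N. fact n * (\<Sum>m<N. - (c m / (A * of_nat (Suc m)) ^ Suc n)))
        \<longlonglongrightarrow> (deriv ^^ n) (pole_series A c) 0"
      by (simp only: pole_series_def[abs_def])
    hence "(\<lambda>N. (fact n * (\<Sum>m<N. - (c m / (A * of_nat (Suc m)) ^ Suc n))) / fact n)
        \<longlonglongrightarrow> (deriv ^^ n) (pole_series A c) 0 / fact n"
      by (intro tendsto_divide tendsto_const) auto
    hence "(\<lambda>m. - (c m / (A * of_nat (Suc m)) ^ Suc n)) sums ((deriv ^^ n) (pole_series A c) 0 / fact n)"
      by (simp add: sums_def)
    from sums_minus[OF this] show ?thesis by (simp add: sums_iff)
  qed
  have "pole_series A c analytic_on {0}"
    by (rule analytic_pole_series[OF A c]) (metis Am)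
  hence "pole_series A c has_fps_expansion fps_expansion (pole_series A c) 0"
    by (rule analytic_at_imp_has_fps_expansion_0)
  also have "fps_expansion (pole_series A c) 0 =
     Abs_fps (\<lambda>n. if n = 0 then 0 else - (\<Sum>m. c m / (A * of_nat (Suc m)) ^ Suc n))"
    by (rule fps_ext) (simp add: fps_expansion_def coeff pole_series_def[of A c 0] del: power_Suc of_nat_Suc)
  finally show ?thesis .
qed

lemma gevrey1_if_borel_converges:
  assumes "fps_nth \<phi> 0 = 0" "f has_fps_expansion borel \<phi>"
  shows "gevrey1 \<phi>"
proof -
  have "fps_conv_radius (borel \<phi>) > 0" using assms(2) by (simp add: has_fps_expansion_def)
  then obtain r where r: "0 < ereal r" "ereal r < fps_conv_radius (borel \<phi>)"
    using ereal_dense2 by blast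
  have "summable (\<lambda>n. fps_nth (borel \<phi>) n * of_real r ^ n)"
    by (rule summable_fps) (use r in simp)
  hence "Bseq (\<lambda>n. fps_nth (borel \<phi>) n * of_real r ^ n)"
    by (intro convergent_imp_Bseq convergentI[OF summable_LIMSEQ_zero])
  then obtain C where C: "\<And>n. norm (fps_nth (borel \<phi>) n * of_real r ^ n) \<le> C"
    by (auto simp: Bseq_def)
  have "norm (fps_nth \<phi> (Suc n)) \<le> C * (fact n / r ^ n)" for n
    using C[of n] r(1) by (simp add: borel_def norm_mult norm_divide norm_power field_simps)
  thus ?thesis unfolding gevrey1_def using assms(1) r(1) by (intro conjI exI[of _ r] exI[of _ C]) auto
qed

text \<open>
  The continuation of the Borel transform is the sum of simple poles with the prescribed residues at
  \<open>\<plusminus>A m\<close>, where \<open>\<epsilon>\<close> relates the Stokes constants at opposite points; for \<open>\<epsilon> = \<plusminus>1\<close> the factor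
  \<open>1 + \<epsilon> (-1)\<^sup>p\<close> makes every second moment vanish. The coefficient of \<open>\<tau>\<close> is free, since it is
  the constant term of the Borel transform.
\<close>
theorem resurgent_if_moments:
  fixes \<epsilon> :: complex and T :: "nat \<Rightarrow> complex"
  assumes A: "A \<noteq> 0" and T: "summable (\<lambda>m. norm (T (Suc m)) / real (Suc m) ^ 2)"
    and \<phi>0: "fps_nth \<phi> 0 = 0"
    and \<phi>: "\<And>p. p \<ge> 2 \<Longrightarrow> fps_nth \<phi> p / fact (p - 1) =
       (1 + \<epsilon> * (- 1) ^ p) / (2 * of_real pi * \<i> * A ^ p) * (\<Sum>m. T (Suc m) / of_nat (Suc m) ^ p)"
  defines "S \<equiv> (\<lambda>m. if m > 0 then T (nat m) else \<epsilon> * T (nat (- m)))"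
  shows "gevrey1 \<phi>"
    and "\<exists>f. borel_continuation \<phi> A f \<and> (\<forall>m. m \<noteq> 0 \<longrightarrow> has_stokes_constant f (A * of_int m) (S m))"
proof -
  define c where "c m = T (Suc m)" for m
  define pi2 where "pi2 = 2 * complex_of_real pi * \<i>"
  have pi2: "pi2 \<noteq> 0" by (simp add: pi2_def)
  have c: "summable (\<lambda>m. norm (c m) / real (Suc m) ^ 2)" using T by (simp only: c_def)
  have A': "- A \<noteq> 0" using A by simp
  define P where "P = pole_series A c"
  define Q where "Q = pole_series (- A) c"
  \<comment> \<open>\<open>P\<close> has its poles at \<open>A m\<close> and \<open>Q\<close> at \<open>-A m\<close>, where \<open>m \<ge> 1\<close>\<close>
  define f where "f \<zeta> = fps_nth \<phi> 1 + (- 1 / pi2) * (P \<zeta> + \<epsilon> * Q \<zeta>)" for \<zeta>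
  have moments: "(\<Sum>m. c m / (B * of_nat (Suc m)) ^ p) = (1 / B ^ p) * (\<Sum>m. T (Suc m) / of_nat (Suc m) ^ p)"
    if p: "p \<ge> 2" and B: "B \<noteq> 0" for B p
  proof -
    have "summable (\<lambda>m. T (Suc m) / of_nat (Suc m) ^ p)"
    proof (rule summable_comparison_test'[OF T])
      fix m
      have "real (Suc m) ^ 2 \<le> real (Suc m) ^ p" using p by (intro power_increasing) auto
      thus "norm (T (Suc m) / of_nat (Suc m) ^ p) \<le> norm (T (Suc m)) / real (Suc m) ^ 2"
        by (auto simp: norm_divide norm_power simp del: of_nat_Suc intro!: divide_left_mono)
    qed
    from suminf_mult[OF this, of "1 / B ^ p"] show ?thesis
      by (simp add: c_def power_mult_distrib del: of_nat_Suc)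
  qed
  have "f has_fps_expansion fps_const (fps_nth \<phi> 1) + fps_const (- 1 / pi2) *
      (Abs_fps (\<lambda>n. if n = 0 then 0 else - (\<Sum>m. c m / (A * of_nat (Suc m)) ^ Suc n)) +
       fps_const \<epsilon> * Abs_fps (\<lambda>n. if n = 0 then 0 else - (\<Sum>m. c m / (- A * of_nat (Suc m)) ^ Suc n)))"
    unfolding f_def P_def Q_def
    by (intro has_fps_expansion_add has_fps_expansion_mult has_fps_expansion_const
              has_fps_expansion_pole_series A A' c)
  also have "\<dots> = borel \<phi>"
  proof (rule fps_ext)
    fix n
    show "fps_nth (fps_const (fps_nth \<phi> 1) + fps_const (- 1 / pi2) *
        (Abs_fps (\<lambda>n. if n = 0 then 0 else - (\<Sum>m. c m / (A * of_nat (Suc m)) ^ Suc n)) +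
         fps_const \<epsilon> * Abs_fps (\<lambda>n. if n = 0 then 0 else - (\<Sum>m. c m / (- A * of_nat (Suc m)) ^ Suc n)))) n
         = fps_nth (borel \<phi>) n"
    proof (cases "n = 0")
      case False
      define s where "s = (\<Sum>m. T (Suc m) / of_nat (Suc m) ^ Suc n)"
      have "fps_nth (borel \<phi>) n = (1 + \<epsilon> * (- 1) ^ Suc n) / (pi2 * A ^ Suc n) * s"
        using \<phi>[of "Suc n"] False by (simp add: borel_def pi2_def s_def)
      also have "\<dots> = (- 1 / pi2) * (- ((1 / A ^ Suc n) * s) + \<epsilon> * (- ((1 / (- A) ^ Suc n) * s)))"
        using pi2 A unfolding power_minus[of A "Suc n"]
        by (cases "even n") (simp_all add: field_simps)
      finally show ?thesis
        using False moments[of "Suc n" A] moments[of "Suc n" "- A"] A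
        by (simp only: s_def) simp
    qed (simp add: borel_def)
  qed
  finally have exp: "f has_fps_expansion borel \<phi>" .
  show "gevrey1 \<phi>" by (rule gevrey1_if_borel_converges[OF \<phi>0 exp])
  have P: "P analytic_on {z}" if "\<And>m. z \<noteq> A * of_nat (Suc m)" for z
    unfolding P_def by (rule analytic_pole_series[OF A c that])
  have Q: "Q analytic_on {z}" if "\<And>m. z \<noteq> - A * of_nat (Suc m)" for z
    unfolding Q_def by (rule analytic_pole_series[OF A' c that])
  have "f holomorphic_on - {A * of_int m |m. m \<noteq> 0}"
  proof -
    have "f analytic_on {z}" if z: "z \<notin> {A * of_int m |m. m \<noteq> 0}" for z
    proof -
      have "z \<noteq> A * of_nat (Suc m)" "z \<noteq> - A * of_nat (Suc m)" for m
      proof -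
        have ne: "z \<noteq> A * of_int k" if "k \<noteq> 0" for k using z that by blast
        from ne[of "int (Suc m)"] ne[of "- int (Suc m)"]
        show "z \<noteq> A * of_nat (Suc m)" "z \<noteq> - A * of_nat (Suc m)"
          by (simp_all del: of_nat_Suc)
      qed
      hence "P analytic_on {z}" "Q analytic_on {z}" using P Q by blast+
      thus ?thesis unfolding f_def by (intro analytic_on_add analytic_on_mult analytic_on_const)
    qed
    hence "f analytic_on - {A * of_int m |m. m \<noteq> 0}"
      by (subst analytic_on_analytic_at) blast
    thus ?thesis by (rule analytic_imp_holomorphic)
  qed
  with exp have "borel_continuation \<phi> A f" by (simp add: borel_continuation_def)
  moreover have "has_stokes_constant f (A * of_int m) (S m)" if m: "m \<noteq> 0" for m
  proof (cases "m > 0")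
    case True
    define n where "n = nat m - 1"
    have n: "m = int (Suc n)" using True by (simp add: n_def)
    define \<rho> where "\<rho> = A * of_nat (Suc n)"
    have \<rho>: "A * of_int m = \<rho>" by (simp add: n \<rho>_def del: of_nat_Suc)
    obtain g where g: "g analytic_on {\<rho>}" "\<forall>\<^sub>F \<zeta> in at \<rho>. P \<zeta> = c n / (\<zeta> - \<rho>) + g \<zeta>"
      using pole_series_at_pole[OF A c, of n] unfolding P_def \<rho>_def by blast
    have "Q analytic_on {\<rho>}"
    proof (rule Q)
      fix k
      have "of_nat (Suc n) + of_nat (Suc k) \<noteq> (0 :: complex)" by (simp flip: of_nat_add del: of_nat_Suc)
      hence "A * (of_nat (Suc n) + of_nat (Suc k)) \<noteq> 0" using A by (simp only: mult_eq_0_iff) simp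
      thus "\<rho> \<noteq> - A * of_nat (Suc k)"
        unfolding \<rho>_def distrib_left by (metis add.left_inverse add.right_inverse mult_minus_left)
    qed
    hence "(\<lambda>\<zeta>. fps_nth \<phi> 1 + (- 1 / pi2) * (g \<zeta> + \<epsilon> * Q \<zeta>)) analytic_on {\<rho>}"
      using g(1) by (intro analytic_on_add analytic_on_mult analytic_on_const)
    moreover have "\<forall>\<^sub>F \<zeta> in at \<rho>. f \<zeta> = - (S m / (2 * of_real pi * \<i> * (\<zeta> - \<rho>))) +
        (fps_nth \<phi> 1 + (- 1 / pi2) * (g \<zeta> + \<epsilon> * Q \<zeta>))"
      using g(2)
    proof eventually_elim
      case (elim \<zeta>)
      have "S m = c n" using True by (simp add: S_def c_def n del: of_nat_Suc)
      thus ?case unfolding f_def elim pi2_def[symmetric] by (simp add: distrib_left)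
    qed
    ultimately show ?thesis unfolding \<rho> has_stokes_constant_def by blast
  next
    case False
    define n where "n = nat (- m) - 1"
    have n: "m = - int (Suc n)" using False m by (simp add: n_def)
    define \<rho> where "\<rho> = - A * of_nat (Suc n)"
    have \<rho>: "A * of_int m = \<rho>" by (simp add: n \<rho>_def del: of_nat_Suc)
    obtain g where g: "g analytic_on {\<rho>}" "\<forall>\<^sub>F \<zeta> in at \<rho>. Q \<zeta> = c n / (\<zeta> - \<rho>) + g \<zeta>"
      using pole_series_at_pole[OF A' c, of n] unfolding Q_def \<rho>_def by blast
    have "P analytic_on {\<rho>}"
    proof (rule P)
      fix k
      have "of_nat (Suc n) + of_nat (Suc k) \<noteq> (0 :: complex)" by (simp flip: of_nat_add del: of_nat_Suc)
      hence "A * (of_nat (Suc n) + of_nat (Suc k)) \<noteq> 0" using A by (simp only: mult_eq_0_iff) simp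
      thus "\<rho> \<noteq> A * of_nat (Suc k)"
        unfolding \<rho>_def distrib_left by (metis add.left_inverse add.right_inverse mult_minus_left)
    qed
    hence "(\<lambda>\<zeta>. fps_nth \<phi> 1 + (- 1 / pi2) * (P \<zeta> + \<epsilon> * g \<zeta>)) analytic_on {\<rho>}"
      using g(1) by (intro analytic_on_add analytic_on_mult analytic_on_const)
    moreover have "\<forall>\<^sub>F \<zeta> in at \<rho>. f \<zeta> = - (S m / (2 * of_real pi * \<i> * (\<zeta> - \<rho>))) +
        (fps_nth \<phi> 1 + (- 1 / pi2) * (P \<zeta> + \<epsilon> * g \<zeta>))"
      using g(2)
    proof eventually_elim
      case (elim \<zeta>)
      have "S m = \<epsilon> * c n" using False by (simp add: S_def c_def n del: of_nat_Suc)
      thus ?case unfolding f_def elim pi2_def[symmetric] by (simp add: distrib_left)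
    qed
    ultimately show ?thesis unfolding \<rho> has_stokes_constant_def by blast
  qed
  ultimately show "\<exists>f. borel_continuation \<phi> A f \<and> (\<forall>m. m \<noteq> 0 \<longrightarrow> has_stokes_constant f (A * of_int m) (S m))"
    by blast
qed

section \<open>Bernoulli polynomials and polylogarithms at roots of unity\<close>

definition tpi :: complex where "tpi = 2 * of_real pi * \<i>"

lemma tpi_nonzero [simp]: "tpi \<noteq> 0"
  by (simp add: tpi_def)

lemma exp_tpi_eq_1_iff: "exp (tpi * z) = 1 \<longleftrightarrow> z \<in> \<int>"
proof
  assume "exp (tpi * z) = 1"
  then obtain n :: int where "Re (tpi * z) = 0" "Im (tpi * z) = of_int (2 * n) * pi"
    unfolding exp_eq_1 by blast
  hence "z = of_int n" by (simp add: tpi_def complex_eq_iff)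
  thus "z \<in> \<int>" by simp
next
  assume "z \<in> \<int>"
  then obtain n where "z = of_int n" by (elim Ints_cases)
  thus "exp (tpi * z) = 1" unfolding exp_eq_1 by (auto simp: tpi_def)
qed

text \<open>
  The generating function of the Bernoulli numbers divided by its argument, and also \<open>-1 - Li\<^sub>0(e\<^sup>u)\<close>. Its
  Taylor coefficients at \<open>2\<pi>\<i>j/N\<close> carry the special values that occur in the two series.
\<close>
definition bose :: "complex \<Rightarrow> complex" where
  "bose u = 1 / (exp u - 1)"

text \<open>
  The function \<open>bose u - 1/u\<close>, written so that its holomorphy at \<open>0\<close> and its derivatives there can be read
  off (\<open>bose_reg_eq\<close>).
\<close>
definition bose_reg :: "complex \<Rightarrow> complex" where
  "bose_reg u = - 1 / 2 + (Digamma (1 - u / tpi) - Digamma (1 + u / tpi)) / tpi"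

lemma higher_deriv_family:
  fixes F :: "nat \<Rightarrow> complex \<Rightarrow> complex"
  assumes S: "open S" and F: "\<And>p u. u \<in> S \<Longrightarrow> (F p has_field_derivative F (Suc p) u) (at u)"
    and f: "\<And>u. u \<in> S \<Longrightarrow> f u = F 0 u" and u: "u \<in> S"
  shows "(deriv ^^ p) f u = F p u"
  using u
proof (induction p arbitrary: u)
  case 0
  thus ?case using f by simp
next
  case (Suc p)
  have "\<forall>\<^sub>F v in nhds u. v \<in> S" using S Suc.prems by (rule eventually_nhds_in_open)
  hence "\<forall>\<^sub>F v in nhds u. (deriv ^^ p) f v = F p v"
    by eventually_elim (rule Suc.IH)
  hence "deriv ((deriv ^^ p) f) u = deriv (F p) u" by (rule deriv_cong_ev) simp
  also have "\<dots> = F (Suc p) u" by (rule DERIV_imp_deriv[OF F[OF Suc.prems]])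
  finally show ?case by simp
qed

lemma not_Int_imp_not_nonpos_Int:
  fixes z :: complex
  assumes "z \<notin> \<int>"
  shows "z \<notin> \<int>\<^sub>\<le>\<^sub>0" "1 - z \<notin> \<int>\<^sub>\<le>\<^sub>0"
proof -
  show "z \<notin> \<int>\<^sub>\<le>\<^sub>0" using assms nonpos_Ints_subset_Ints by blast
  have "1 - (1 - z) \<in> \<int>" if "1 - z \<in> \<int>" using that by (intro Ints_diff) auto
  hence "1 - z \<notin> \<int>" using assms by auto
  thus "1 - z \<notin> \<int>\<^sub>\<le>\<^sub>0" using nonpos_Ints_subset_Ints by blast
qed

text \<open>
  The logarithmic derivative of the reflection formula of the Gamma function.
\<close>
lemma Digamma_reflection:
  fixes z :: complex
  assumes z: "z \<notin> \<int>"
  shows "sin (of_real pi * z) \<noteq> 0"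
    and "Digamma (1 - z) - Digamma z = of_real pi * cot (of_real pi * z)"
proof -
  note z' = not_Int_imp_not_nonpos_Int[OF z]
  define G where "G = Gamma z * Gamma (1 - z)"
  have G: "G \<noteq> 0" using z' by (simp add: G_def Gamma_eq_zero_iff)
  have G_eq: "G = of_real pi / sin (of_real pi * z)" by (simp add: G_def Gamma_reflection_complex)
  with G show sin: "sin (of_real pi * z) \<noteq> 0" by auto
  have 1: "((\<lambda>z. Gamma (1 - z)) has_field_derivative Gamma (1 - z) * Digamma (1 - z) * (-1)) (at z)"
    by (rule DERIV_chain2[where f = Gamma and g = "\<lambda>z. 1 - z", OF has_field_derivative_Gamma[OF z'(2)]]) (auto intro!: derivative_eq_intros)
  have "((\<lambda>z. Gamma z * Gamma (1 - z)) has_field_derivative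
          Gamma z * Digamma z * Gamma (1 - z) + Gamma (1 - z) * Digamma (1 - z) * (-1) * Gamma z) (at z)"
    by (rule DERIV_mult[OF has_field_derivative_Gamma[OF z'(1)] 1])
  moreover have "((\<lambda>z. of_real pi / sin (of_real pi * z)) has_field_derivative
          - (of_real pi * (cos (of_real pi * z) * of_real pi)) / sin (of_real pi * z) ^ 2) (at z)"
    using sin by (auto intro!: derivative_eq_intros simp: power2_eq_square)
  ultimately have "Gamma z * Digamma z * Gamma (1 - z) + Gamma (1 - z) * Digamma (1 - z) * (-1) * Gamma z =
          - (of_real pi * (cos (of_real pi * z) * of_real pi)) / sin (of_real pi * z) ^ 2"
    unfolding Gamma_reflection_complex by (rule DERIV_unique)
  also have "\<dots> = - G * (of_real pi * cot (of_real pi * z))"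
    using sin by (simp add: G_eq cot_def power2_eq_square)
  also have "Gamma z * Digamma z * Gamma (1 - z) + Gamma (1 - z) * Digamma (1 - z) * (-1) * Gamma z =
          - G * (Digamma (1 - z) - Digamma z)"
    by (simp add: G_def algebra_simps)
  finally show "Digamma (1 - z) - Digamma z = of_real pi * cot (of_real pi * z)" using G by simp
qed

text \<open>
  Since the derivatives of the digamma function are series over a half-lattice, this is the partial fraction
  expansion of \<open>1/(e\<^sup>u - 1)\<close> in a form that can be differentiated.
\<close>
lemma bose_Digamma:
  assumes z: "z \<notin> \<int>"
  shows "bose (tpi * z) = - 1 / 2 + (Digamma (1 - z) - Digamma z) / tpi"
proof -
  define w where "w = exp (\<i> * (of_real pi * z))"
  have w: "w \<noteq> 0" by (simp add: w_def)
  have sin: "sin (of_real pi * z) = (w - 1 / w) / (2 * \<i>)"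
    unfolding sin_exp_eq w_def exp_minus inverse_eq_divide ..
  have cos: "cos (of_real pi * z) = (w + 1 / w) / 2"
    unfolding cos_exp_eq w_def exp_minus inverse_eq_divide ..
  have "tpi * z = 2 * (\<i> * (of_real pi * z))" by (simp add: tpi_def)
  hence w2: "exp (tpi * z) = w ^ 2" by (simp only: w_def exp_double)
  have ne: "w ^ 2 - 1 \<noteq> 0" using z exp_tpi_eq_1_iff[of z] w2 by simp
  have s: "w - 1 / w = (w ^ 2 - 1) / w" and c: "w + 1 / w = (w ^ 2 + 1) / w"
    using w by (simp_all add: diff_divide_distrib add_divide_distrib power2_eq_square)
  have "cot (of_real pi * z) = ((w ^ 2 + 1) / w / 2) / ((w ^ 2 - 1) / w / (2 * \<i>))"
    unfolding cot_def sin cos s c ..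
  also have "\<dots> = \<i> * ((w ^ 2 + 1) / (w ^ 2 - 1))" using w ne by (simp add: divide_simps)
  finally have "cot (of_real pi * z) = \<i> * ((w ^ 2 + 1) / (w ^ 2 - 1))" .
  hence "(Digamma (1 - z) - Digamma z) / tpi = (w ^ 2 + 1) / (w ^ 2 - 1) / 2"
    unfolding Digamma_reflection(2)[OF z] tpi_def by simp
  also have "(w ^ 2 + 1) / (w ^ 2 - 1) = ((w ^ 2 - 1) + 2) / (w ^ 2 - 1)" by simp
  also have "\<dots> = 1 + 2 / (w ^ 2 - 1)" using ne unfolding add_divide_distrib by simp
  finally have "(Digamma (1 - z) - Digamma z) / tpi = (1 + 2 / (w ^ 2 - 1)) / 2" .
  also have "(1 + 2 / x) / 2 = 1 / 2 + 1 / x" for x :: complex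
    by (cases "x = 0") (simp_all add: field_simps)
  finally show ?thesis by (simp add: bose_def w2)
qed

lemma higher_deriv_bose:
  assumes z: "z \<notin> \<int>" and p: "p > 0"
  shows "(deriv ^^ p) bose (tpi * z) = ((- 1) ^ p * Polygamma p (1 - z) - Polygamma p z) / tpi ^ Suc p"
proof -
  define F where "F p u = (if p = 0 then - 1 / 2 else 0) +
     ((- 1) ^ p * Polygamma p (1 - u / tpi) - Polygamma p (u / tpi)) / tpi ^ Suc p" for p :: nat and u
  let ?S = "{u. u / tpi \<notin> \<int>}"
  have "open ((\<lambda>u. u / tpi) -` (- \<int>))"
    by (intro open_vimage continuous_intros) (auto simp: open_Compl)
  also have "(\<lambda>u. u / tpi) -` (- \<int>) = ?S" by auto
  finally have S: "open ?S" .
  have "(deriv ^^ p) bose (tpi * z) = F p (tpi * z)"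
  proof (rule higher_deriv_family[OF S])
    fix q u assume "u \<in> ?S"
    hence u: "u / tpi \<notin> \<int>\<^sub>\<le>\<^sub>0" "1 - u / tpi \<notin> \<int>\<^sub>\<le>\<^sub>0" using not_Int_imp_not_nonpos_Int[of "u / tpi"] by auto
    have 1: "((\<lambda>u. Polygamma q (u / tpi)) has_field_derivative Polygamma (Suc q) (u / tpi) * (1 / tpi)) (at u)"
      by (rule DERIV_chain2[where f = "Polygamma q" and g = "\<lambda>u. u / tpi", OF has_field_derivative_Polygamma[OF u(1)]]) (auto intro!: derivative_eq_intros)
    have 2: "((\<lambda>u. Polygamma q (1 - u / tpi)) has_field_derivative Polygamma (Suc q) (1 - u / tpi) * (- 1 / tpi)) (at u)"
      by (rule DERIV_chain2[where f = "Polygamma q" and g = "\<lambda>u. 1 - u / tpi", OF has_field_derivative_Polygamma[OF u(2)]]) (auto intro!: derivative_eq_intros)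
    have "(F q has_field_derivative 0 + ((- 1) ^ q * (Polygamma (Suc q) (1 - u / tpi) * (- 1 / tpi)) -
            Polygamma (Suc q) (u / tpi) * (1 / tpi)) / tpi ^ Suc q) (at u)"
      unfolding F_def[abs_def]
      by (intro DERIV_add DERIV_const DERIV_cdivide DERIV_diff DERIV_cmult 1 2)
    also have "0 + ((- 1) ^ q * (Polygamma (Suc q) (1 - u / tpi) * (- 1 / tpi)) -
            Polygamma (Suc q) (u / tpi) * (1 / tpi)) / tpi ^ Suc q = F (Suc q) u"
      by (simp add: F_def field_simps)
    finally show "(F q has_field_derivative F (Suc q) u) (at u)" .
  next
    fix u assume "u \<in> ?S"
    thus "bose u = F 0 u" using bose_Digamma[of "u / tpi"] by (simp add: F_def)
  qed (use z in simp)
  thus ?thesis using p by (simp add: F_def)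
qed

lemma Re_pos_not_nonpos_Int: "Re z > 0 \<Longrightarrow> z \<notin> \<int>\<^sub>\<le>\<^sub>0"
  by (auto elim!: nonpos_Ints_cases)

lemma
  shows higher_deriv_bose_reg: "p > 0 \<Longrightarrow>
      (deriv ^^ p) bose_reg 0 = ((- 1) ^ p * Polygamma p 1 - Polygamma p 1) / tpi ^ Suc p"
    and analytic_bose_reg: "bose_reg analytic_on {0}"
proof -
  define F where "F p u = (if p = 0 then - 1 / 2 else 0) +
     ((- 1) ^ p * Polygamma p (1 - u / tpi) - Polygamma p (1 + u / tpi)) / tpi ^ Suc p" for p :: nat and u
  let ?S = "ball 0 (norm tpi) :: complex set"
  have DF: "(F q has_field_derivative F (Suc q) u) (at u)" if "u \<in> ?S" for q u
  proof -
    have "norm (u / tpi) < 1" using that by (simp add: norm_divide divide_simps)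
    hence "\<bar>Re (u / tpi)\<bar> < 1" using abs_Re_le_cmod[of "u / tpi"] by linarith
    hence "Re (1 + u / tpi) > 0" "Re (1 - u / tpi) > 0"
      unfolding plus_complex.sel minus_complex.sel one_complex.sel by linarith+
    hence u: "1 + u / tpi \<notin> \<int>\<^sub>\<le>\<^sub>0" "1 - u / tpi \<notin> \<int>\<^sub>\<le>\<^sub>0"
      by (simp_all only: Re_pos_not_nonpos_Int not_False_eq_True)
    have 1: "((\<lambda>u. Polygamma q (1 + u / tpi)) has_field_derivative Polygamma (Suc q) (1 + u / tpi) * (1 / tpi)) (at u)"
      by (rule DERIV_chain2[where f = "Polygamma q" and g = "\<lambda>u. 1 + u / tpi", OF has_field_derivative_Polygamma[OF u(1)]]) (auto intro!: derivative_eq_intros)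
    have 2: "((\<lambda>u. Polygamma q (1 - u / tpi)) has_field_derivative Polygamma (Suc q) (1 - u / tpi) * (- 1 / tpi)) (at u)"
      by (rule DERIV_chain2[where f = "Polygamma q" and g = "\<lambda>u. 1 - u / tpi", OF has_field_derivative_Polygamma[OF u(2)]]) (auto intro!: derivative_eq_intros)
    have "(F q has_field_derivative 0 + ((- 1) ^ q * (Polygamma (Suc q) (1 - u / tpi) * (- 1 / tpi)) -
            Polygamma (Suc q) (1 + u / tpi) * (1 / tpi)) / tpi ^ Suc q) (at u)"
      unfolding F_def[abs_def]
      by (intro DERIV_add DERIV_const DERIV_cdivide DERIV_diff DERIV_cmult 1 2)
    also have "0 + ((- 1) ^ q * (Polygamma (Suc q) (1 - u / tpi) * (- 1 / tpi)) -
            Polygamma (Suc q) (1 + u / tpi) * (1 / tpi)) / tpi ^ Suc q = F (Suc q) u"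
      by (simp add: F_def field_simps)
    finally show ?thesis .
  qed
  have F0: "bose_reg = F 0" by (simp add: fun_eq_iff bose_reg_def F_def)
  have "(deriv ^^ p) bose_reg 0 = F p 0"
    by (rule higher_deriv_family[of ?S F, OF _ DF]) (simp_all add: F0)
  thus "p > 0 \<Longrightarrow> (deriv ^^ p) bose_reg 0 = ((- 1) ^ p * Polygamma p 1 - Polygamma p 1) / tpi ^ Suc p"
    by (simp add: F_def)
  have "F 0 holomorphic_on ?S" using DF[of _ 0]
    by (subst holomorphic_on_open) blast+
  hence "bose_reg holomorphic_on ?S" by (simp only: F0)
  thus "bose_reg analytic_on {0}" by (rule holomorphic_on_imp_analytic_at) auto
qed

lemma not_Int_if_small:
  assumes "u \<noteq> 0" "norm u < norm tpi"
  shows "u / tpi \<notin> \<int>"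
proof
  assume "u / tpi \<in> \<int>"
  then obtain n where n: "u / tpi = of_int n" by (elim Ints_cases)
  have "norm (u / tpi) < 1" using assms by (simp add: norm_divide divide_simps)
  hence "n = 0" unfolding n by simp
  thus False using n assms by simp
qed

lemma bose_reg_eq:
  assumes "u \<noteq> 0" "norm u < norm tpi"
  shows "bose_reg u = bose u - 1 / u"
proof -
  have "Digamma (u / tpi + 1) = Digamma (u / tpi) + 1 / (u / tpi)"
    by (rule Digamma_plus1) (use assms in simp)
  thus ?thesis
    using bose_Digamma[OF not_Int_if_small[OF assms]]
    by (simp add: bose_reg_def add.commute diff_divide_distrib add_divide_distrib)
qed

text \<open>
  The denominator of the quotient of formal power series that defines the Bernoulli polynomials has no constant
  term; the quotient is therefore identified by multiplying out.
\<close>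
lemma bernoulli_poly_if_expansion:
  assumes W: "W has_fps_expansion G" and eq: "\<forall>\<^sub>F u in nhds 0. (exp u - 1) * W u = u * exp (x * u)"
  shows "bernoulli_poly n x = fact n * fps_nth G n"
proof -
  have "(\<lambda>u. (exp u - 1) * W u) has_fps_expansion (fps_exp 1 - 1) * G"
    by (intro has_fps_expansion_mult W has_fps_expansion_diff has_fps_expansion_exp1 has_fps_expansion_1)
  hence "(\<lambda>u. u * exp (x * u)) has_fps_expansion (fps_exp 1 - 1) * G"
    using has_fps_expansion_cong[OF eq refl] by blast
  moreover have "(\<lambda>u. u * exp (x * u)) has_fps_expansion fps_X * fps_exp x"
    by (intro has_fps_expansion_mult has_fps_expansion_fps_X has_fps_expansion_exp)
  ultimately have eq: "fps_X * fps_exp x = G * (fps_exp 1 - 1)"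
    by (metis fps_expansion_unique_complex mult.commute)
  have "fps_nth (fps_exp 1 - 1 :: complex fps) 1 \<noteq> 0" by simp
  hence "fps_exp 1 - 1 \<noteq> (0 :: complex fps)" by (metis fps_zero_nth)
  thus ?thesis unfolding bernoulli_poly_def eq by simp
qed

lemma bernoulli_number_Suc:
  "bernoulli_number (Suc p) / fact (Suc p) = (deriv ^^ p) bose_reg 0 / fact p"
proof -
  have "(\<lambda>u. 1 + u * bose_reg u) has_fps_expansion 1 + fps_X * fps_expansion bose_reg 0"
    by (intro has_fps_expansion_add has_fps_expansion_1 has_fps_expansion_mult has_fps_expansion_fps_X
              analytic_at_imp_has_fps_expansion_0 analytic_bose_reg)
  moreover have "\<forall>\<^sub>F u in nhds 0. (exp u - 1) * (1 + u * bose_reg u) = u * exp (0 * u)"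
  proof -
    have "\<forall>\<^sub>F u in nhds 0. u \<in> ball 0 (norm tpi)" by (intro eventually_nhds_in_open) auto
    thus ?thesis
    proof eventually_elim
      case (elim u)
      show ?case
      proof (cases "u = 0")
        case False
        have "exp u \<noteq> 1" using exp_tpi_eq_1_iff[of "u / tpi"] not_Int_if_small[OF False] elim by simp
        thus ?thesis using False elim bose_reg_eq[OF False] by (simp add: bose_def field_simps)
      qed simp
    qed
  qed
  ultimately have "bernoulli_number (Suc p) =
      fact (Suc p) * fps_nth (1 + fps_X * fps_expansion bose_reg 0) (Suc p)"
    by (rule bernoulli_poly_if_expansion)
  hence "bernoulli_number (Suc p) / fact (Suc p) = fps_nth (1 + fps_X * fps_expansion bose_reg 0) (Suc p)"
    by (simp del: fact_Suc)
  also have "\<dots> = (deriv ^^ p) bose_reg 0 / fact p" by (simp add: fps_expansion_def)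
  finally show ?thesis .
qed

text \<open>
  Each summand times \<open>y\<^sup>N - 1\<close> is a geometric sum in \<open>y zeta_root N ^ j\<close>; summing over \<open>j\<close> leaves
  the power \<open>y\<^sup>k\<close> by orthogonality of roots of unity.
\<close>
lemma partial_fraction_root_of_unity:
  assumes N: "k < N" and y: "y ^ N \<noteq> (1 :: complex)"
  shows "(\<Sum>j<N. zeta_root N ^ (j * (N - k)) / (y * zeta_root N ^ j - 1)) = of_nat N * y ^ k / (y ^ N - 1)"
proof -
  let ?z = "zeta_root N"
  have N0: "N > 0" using N by simp
  have zN: "?z ^ N = 1" using zeta_root_power_eq_1_iff[OF N0, of N] by simp
  have pow: "(y * ?z ^ j) ^ N = y ^ N" for j
  proof -
    have "(?z ^ j) ^ N = (?z ^ N) ^ j" unfolding power_mult[symmetric] mult.commute[of j N] ..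
    thus ?thesis by (simp add: power_mult_distrib zN)
  qed
  have ne: "y * ?z ^ j - 1 \<noteq> 0" for j
  proof
    assume "y * ?z ^ j - 1 = 0"
    hence "y * ?z ^ j = 1" by simp
    thus False using pow[of j] y by simp
  qed
  have quot: "(y ^ N - 1) / (y * ?z ^ j - 1) = (\<Sum>i<N. (y * ?z ^ j) ^ i)" for j
    using power_diff_1_eq[of "y * ?z ^ j" N] ne[of j] unfolding pow by simp
  have "(y ^ N - 1) * (\<Sum>j<N. ?z ^ (j * (N - k)) / (y * ?z ^ j - 1)) =
          (\<Sum>j<N. ?z ^ (j * (N - k)) * (\<Sum>i<N. (y * ?z ^ j) ^ i))"
    unfolding sum_distrib_left[of "y ^ N - 1"] quot[symmetric] by (simp add: mult.commute)
  also have "\<dots> = (\<Sum>j<N. \<Sum>i<N. y ^ i * ?z ^ ((i + (N - k)) * j))"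
  proof (subst sum_distrib_left, intro sum.cong refl)
    fix j i
    have e: "(i + (N - k)) * j = j * i + j * (N - k)" by (simp add: algebra_simps)
    show "?z ^ (j * (N - k)) * (y * ?z ^ j) ^ i = y ^ i * ?z ^ ((i + (N - k)) * j)"
      unfolding e power_add power_mult_distrib power_mult[symmetric] by (simp add: mult_ac)
  qed
  also have "\<dots> = (\<Sum>i<N. \<Sum>j<N. y ^ i * ?z ^ ((i + (N - k)) * j))" by (rule sum.swap)
  also have "\<dots> = (\<Sum>i<N. y ^ i * (if N dvd i + (N - k) then of_nat N else 0))"
    unfolding sum_distrib_left[symmetric] sum_zeta_root_power[OF N0] ..
  also have "\<dots> = (\<Sum>i<N. if i = k then y ^ k * of_nat N else 0)"
  proof (intro sum.cong refl)
    fix i assume i: "i \<in> {..<N}"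
    have "N dvd i + (N - k) \<longleftrightarrow> i = k"
    proof
      assume "N dvd i + (N - k)"
      then obtain q where q: "i + (N - k) = N * q" by (elim dvdE)
      have "0 < i + (N - k)" "i + (N - k) < N * 2" using i N by auto
      hence "0 < N * q" "N * q < N * 2" unfolding q .
      hence "q = 1" using N0 by (cases q) auto
      thus "i = k" using q N by simp
    qed (use N in auto)
    thus "y ^ i * (if N dvd i + (N - k) then of_nat N else 0) = (if i = k then y ^ k * of_nat N else 0)"
      by auto
  qed
  also have "\<dots> = y ^ k * of_nat N" using N by simp
  finally show ?thesis using y by (simp add: field_simps)
qed

lemma analytic_bose: "z \<notin> \<int> \<Longrightarrow> bose analytic_on {tpi * z}"
  unfolding bose_def[abs_def] using exp_tpi_eq_1_iff[of z] by (intro analytic_intros) auto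

lemma fraction_not_Int: "0 < j \<Longrightarrow> j < N \<Longrightarrow> (of_nat j / of_nat N :: complex) \<notin> \<int>"
  by (rule fraction_not_in_Ints[of N "int j", simplified]) (auto dest: zdvd_imp_le nat_dvd_not_less)

lemma zeta_root_power_tpi: "zeta_root N ^ j = exp (tpi * (of_nat j / of_nat N))"
  by (simp add: zeta_root_power tpi_def)

text \<open>
  With \<open>y = e\<^sup>u\<^sup>/\<^sup>N\<close> the generating function is \<open>u y\<^sup>k / (y\<^sup>N - 1)\<close>, and the partial fraction decomposition in \<open>y\<close>
  writes it as a sum of values of \<open>bose\<close> at the points \<open>2\<pi>\<i>j/N + u/N\<close>. Only \<open>j = 0\<close> contributes a pole at
  \<open>u = 0\<close>, hence the separate term with \<open>bose_reg\<close>.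
\<close>
lemma bernoulli_poly_rational:
  assumes k: "0 < k" "k < N"
  shows "bernoulli_poly (Suc p) (of_nat k / of_nat N) / fact (Suc p) =
     ((deriv ^^ p) bose_reg 0 / fact p +
      (\<Sum>j\<in>{1..<N}. zeta_root N ^ (j * (N - k)) * ((deriv ^^ p) bose (tpi * (of_nat j / of_nat N)) / fact p)))
     / of_nat N ^ Suc p"
proof -
  let ?z = "zeta_root N" and ?n = "of_nat N :: complex" and ?t = "\<lambda>j. tpi * (of_nat j / of_nat N)"
  have N0: "N > 0" using k by simp
  let ?lin = "fps_const (1 / ?n) * fps_X"
  have lin: "(\<lambda>u. (1 / ?n) * u) has_fps_expansion ?lin" "fps_nth ?lin 0 = 0"
    by (rule has_fps_expansion_mult[OF has_fps_expansion_const has_fps_expansion_fps_X]) simp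
  define W where "W u = 1 + (1 / ?n * u) * ((bose_reg \<circ> (\<lambda>u. (1 / ?n) * u)) u +
      (\<Sum>j\<in>{1..<N}. ?z ^ (j * (N - k)) * ((\<lambda>v. bose (?t j + v)) \<circ> (\<lambda>u. (1 / ?n) * u)) u))" for u
  define G where "G = 1 + ?lin * (fps_compose (fps_expansion bose_reg 0) ?lin +
      (\<Sum>j\<in>{1..<N}. fps_const (?z ^ (j * (N - k))) * fps_compose (fps_expansion bose (?t j)) ?lin))"
  have "W has_fps_expansion G"
    unfolding W_def G_def using fraction_not_Int
    by (intro has_fps_expansion_add has_fps_expansion_1 has_fps_expansion_mult has_fps_expansion_sum
          has_fps_expansion_const has_fps_expansion_compose lin analytic_at_imp_has_fps_expansion_0
          analytic_at_imp_has_fps_expansion analytic_bose_reg analytic_bose) auto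
  moreover have "\<forall>\<^sub>F u in nhds 0. (exp u - 1) * W u = u * exp (of_nat k / ?n * u)"
  proof -
    have "\<forall>\<^sub>F u in nhds 0. u \<in> ball 0 (norm tpi)" by (intro eventually_nhds_in_open) auto
    thus ?thesis
    proof eventually_elim
      case (elim u)
      show ?case
      proof (cases "u = 0")
        case False
        define y where "y = exp (u / ?n)"
        have yN: "y ^ N = exp u" and yk: "y ^ k = exp (of_nat k / ?n * u)"
          using N0 by (simp_all add: y_def flip: exp_of_nat_mult)
        have exp1: "exp u \<noteq> 1" using exp_tpi_eq_1_iff[of "u / tpi"] not_Int_if_small[OF False] elim by simp
        have small: "norm (u / ?n) < norm tpi"
        proof -
          have "norm (u / ?n) \<le> norm u / 1"
            unfolding norm_divide norm_of_nat using N0 by (intro divide_left_mono) auto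
          thus ?thesis using elim by simp
        qed
        have bose_t: "bose (?t j + u / ?n) = 1 / (y * ?z ^ j - 1)" for j
          by (simp add: bose_def exp_add y_def zeta_root_power_tpi mult.commute)
        have "bose_reg (u / ?n) = bose (?t 0 + u / ?n) - ?n / u"
          using bose_reg_eq[OF _ small] False N0 by simp
        hence "W u = (u / ?n) * (?z ^ (0 * (N - k)) * bose (?t 0 + u / ?n) +
            (\<Sum>j\<in>{1..<N}. ?z ^ (j * (N - k)) * bose (?t j + u / ?n)))"
          using False N0 by (simp add: W_def field_simps)
        also have "?z ^ (0 * (N - k)) * bose (?t 0 + u / ?n) +
            (\<Sum>j\<in>{1..<N}. ?z ^ (j * (N - k)) * bose (?t j + u / ?n)) =
            (\<Sum>j\<in>insert 0 {1..<N}. ?z ^ (j * (N - k)) * bose (?t j + u / ?n))"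
          by (subst sum.insert) auto
        also have "insert 0 {1..<N} = {..<N}" using N0 by auto
        also have "(\<Sum>j<N. ?z ^ (j * (N - k)) * bose (?t j + u / ?n)) = ?n * y ^ k / (y ^ N - 1)"
          unfolding bose_t using partial_fraction_root_of_unity[OF k(2), of y] exp1 yN by simp
        finally have "W u = u * y ^ k / (exp u - 1)" using N0 yN by simp
        thus ?thesis using exp1 yk by simp
      qed simp
    qed
  qed
  ultimately have "bernoulli_poly (Suc p) (of_nat k / ?n) = fact (Suc p) * fps_nth G (Suc p)"
    by (rule bernoulli_poly_if_expansion)
  hence "bernoulli_poly (Suc p) (of_nat k / ?n) / fact (Suc p) = fps_nth G (Suc p)"
    by (simp del: fact_Suc)
  also have "fps_nth G (Suc p) = (1 / ?n) * (fps_nth (fps_compose (fps_expansion bose_reg 0) ?lin) p +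
      (\<Sum>j\<in>{1..<N}. ?z ^ (j * (N - k)) * fps_nth (fps_compose (fps_expansion bose (?t j)) ?lin) p))"
    by (simp add: G_def mult.assoc fps_sum_nth del: fps_nth_compose_linear)
  also have "\<dots> = (1 / ?n) * ((1 / ?n) ^ p * ((deriv ^^ p) bose_reg 0 / fact p +
      (\<Sum>j\<in>{1..<N}. ?z ^ (j * (N - k)) * ((deriv ^^ p) bose (?t j) / fact p))))"
    by (simp add: fps_expansion_def distrib_left sum_distrib_left mult.left_commute)
  also have "\<dots> = ((deriv ^^ p) bose_reg 0 / fact p +
      (\<Sum>j\<in>{1..<N}. ?z ^ (j * (N - k)) * ((deriv ^^ p) bose (?t j) / fact p))) / ?n ^ Suc p"
    by (simp add: power_divide)
  finally show ?thesis .
qed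

text \<open>
  The rational function \<open>Li\<^sub>-\<^sub>p\<close>, obtained by applying \<open>z d/dz\<close> repeatedly to the geometric series.
\<close>
primrec neg_li :: "nat \<Rightarrow> complex \<Rightarrow> complex" where
  "neg_li 0 = (\<lambda>z. z / (1 - z))"
| "neg_li (Suc p) = (\<lambda>z. z * deriv (neg_li p) z)"

lemma holomorphic_neg_li: "neg_li p holomorphic_on - {1}"
proof (induction p)
  case 0
  show ?case unfolding neg_li.simps
    by (intro holomorphic_on_divide holomorphic_on_diff holomorphic_on_const holomorphic_on_ident) auto
next
  case (Suc p)
  show ?case unfolding neg_li.simps
    by (intro holomorphic_on_mult holomorphic_on_ident holomorphic_deriv[OF Suc]) auto
qed

lemma has_fps_expansion_neg_li:
  "neg_li p has_fps_expansion Abs_fps (\<lambda>m. if m = 0 then 0 else of_nat m ^ p)"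
proof (induction p)
  case 0
  show ?case
  proof (rule has_fps_expansionI)
    have "\<forall>\<^sub>F z in nhds (0::complex). z \<in> ball 0 1" by (intro eventually_nhds_in_open) auto
    thus "\<forall>\<^sub>F z in nhds 0. (\<lambda>n. fps_nth (Abs_fps (\<lambda>m. if m = 0 then 0 else of_nat m ^ 0)) n * z ^ n) sums neg_li 0 z"
    proof eventually_elim
      case (elim z)
      hence z: "norm z < 1" by simp
      hence "z \<noteq> 1" by auto
      have "(\<lambda>n. z * z ^ n) sums (z * (1 / (1 - z)))" by (intro sums_mult geometric_sums z)
      hence "(\<lambda>n. (if Suc n = 0 then 0 else 1) * z ^ Suc n) sums neg_li 0 z" by simp
      thus ?case by (subst (asm) sums_Suc_iff) (simp cong: if_cong)
    qed
  qed
next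
  case (Suc p)
  have "neg_li (Suc p) has_fps_expansion fps_X * fps_deriv (Abs_fps (\<lambda>m. if m = 0 then 0 else of_nat m ^ p))"
    unfolding neg_li.simps by (intro has_fps_expansion_mult has_fps_expansion_fps_X has_fps_expansion_deriv Suc)
  also have "fps_X * fps_deriv (Abs_fps (\<lambda>m. if m = 0 then 0 else of_nat m ^ p)) =
      Abs_fps (\<lambda>m. if m = 0 then 0 else of_nat m ^ Suc p :: complex)"
    by (rule fps_ext) (auto simp: gr0_conv_Suc)
  finally show ?case .
qed

lemma neg_li_sums:
  assumes "norm u < 1"
  shows "(\<lambda>m. u ^ Suc m / of_nat (Suc m) powi (- int p)) sums neg_li p u"
proof -
  have "(\<lambda>n. fps_nth (Abs_fps (\<lambda>m. if m = 0 then 0 else of_nat m ^ p)) n * u ^ n) sums neg_li p u"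
  proof (rule has_fps_expansion_imp_sums_complex[OF has_fps_expansion_neg_li])
    show "neg_li p holomorphic_on eball 0 1"
      by (rule holomorphic_on_subset[OF holomorphic_neg_li]) (auto simp: in_eball_iff)
  qed (use assms in simp)
  hence "(\<lambda>m. fps_nth (Abs_fps (\<lambda>m. if m = 0 then 0 else of_nat m ^ p)) (Suc m) * u ^ Suc m) sums neg_li p u"
    by (subst sums_Suc_iff) simp
  hence "(\<lambda>m. of_nat (Suc m) ^ p * u ^ Suc m) sums neg_li p u" by (simp del: of_nat_Suc power_Suc)
  thus ?thesis by (simp add: power_int_minus divide_inverse mult.commute del: of_nat_Suc)
qed

lemma open_slit_plane: "open slit_plane"
proof -
  have "closed {z. Im z = 0 \<and> Re z \<ge> 1}"
    by (intro closed_Collect_conj closed_Collect_eq closed_Collect_le continuous_intros)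
  thus ?thesis unfolding slit_plane_def by (rule open_Compl)
qed

lemma connected_slit_plane: "connected slit_plane"
proof (rule starlike_imp_connected)
  have "t *\<^sub>R x \<in> slit_plane" if "x \<in> slit_plane" "0 \<le> t" "t \<le> 1" for x :: complex and t
  proof (rule ccontr)
    assume "t *\<^sub>R x \<notin> slit_plane"
    hence *: "t * Im x = 0" "t * Re x \<ge> 1" by (auto simp: slit_plane_def)
    hence "t \<noteq> 0" by auto
    hence t: "t > 0" using that by simp
    have "Im x = 0" using * t by simp
    moreover have "Re x > 0" using *(2) t by (metis less_le_trans zero_less_mult_pos zero_less_one)
    hence "t * Re x \<le> 1 * Re x" using that by (intro mult_right_mono) auto
    hence "Re x \<ge> 1" using *(2) by simp
    ultimately show False using that(1) by (simp add: slit_plane_def)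
  qed
  moreover have "0 \<in> slit_plane" by (simp add: slit_plane_def)
  ultimately show "starlike slit_plane"
    unfolding starlike_def by (intro bexI[of _ 0]) (auto simp: closed_segment_def)
qed

text \<open>
  The rational function is one continuation of the power series to the slit plane, and by connectedness the only
  one.
\<close>
lemma polylog_neg:
  assumes z: "z \<in> slit_plane"
  shows "polylog (- int p) z = neg_li p z"
  unfolding polylog_def
proof (rule the_equality)
  have "neg_li p holomorphic_on slit_plane"
    by (rule holomorphic_on_subset[OF holomorphic_neg_li]) (auto simp: slit_plane_def)
  thus "\<exists>f. f holomorphic_on slit_plane \<and>
      (\<forall>u\<in>ball 0 1. (\<lambda>m. u ^ Suc m / of_nat (Suc m) powi (- int p)) sums f u) \<and> neg_li p z = f z"
    by (intro exI[of _ "neg_li p"] conjI ballI neg_li_sums) auto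
next
  fix w assume "\<exists>f. f holomorphic_on slit_plane \<and>
      (\<forall>u\<in>ball 0 1. (\<lambda>m. u ^ Suc m / of_nat (Suc m) powi (- int p)) sums f u) \<and> w = f z"
  then obtain f where f: "f holomorphic_on slit_plane" "w = f z"
      "\<forall>u\<in>ball 0 1. (\<lambda>m. u ^ Suc m / of_nat (Suc m) powi (- int p)) sums f u" by blast
  have "f z = neg_li p z"
  proof (rule analytic_continuation_open[of "ball 0 1" slit_plane f "neg_li p" z])
    show "ball 0 1 \<subseteq> slit_plane"
    proof
      fix u :: complex assume "u \<in> ball 0 1"
      hence "Re u < 1" using complex_Re_le_cmod[of u] by simp
      thus "u \<in> slit_plane" by (simp add: slit_plane_def)
    qed
    show "neg_li p holomorphic_on slit_plane"
      by (rule holomorphic_on_subset[OF holomorphic_neg_li]) (auto simp: slit_plane_def)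
    show "f u = neg_li p u" if "u \<in> ball 0 1" for u
      using f(3) that neg_li_sums[of u p] by (intro sums_unique2[of _ "f u" "neg_li p u"]) auto
  qed (use z f open_slit_plane connected_slit_plane in auto)
  thus "w = neg_li p z" using f(2) by simp
qed

text \<open>
  In the variable \<open>u\<close> with \<open>z = e\<^sup>u\<close> the operator \<open>z d/dz\<close> is \<open>d/du\<close>. The constant in
  \<open>Li\<^sub>0(e\<^sup>u) = -1 - bose u\<close> disappears after one differentiation.
\<close>
lemma neg_li_exp:
  assumes "exp u \<noteq> 1" "p > 0"
  shows "neg_li p (exp u) = - (deriv ^^ p) bose u"
proof -
  define F where "F p u = - neg_li p (exp u) - (if p = 0 then 1 else 0)" for p :: nat and u
  have "open (exp -` (- {1 :: complex}))"
    by (intro open_vimage continuous_intros)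
  hence S: "open {u :: complex. exp u \<noteq> 1}" by (simp add: vimage_def)
  have "(deriv ^^ p) bose u = F p u"
  proof (rule higher_deriv_family[OF S])
    fix q and u :: complex assume "u \<in> {u. exp u \<noteq> 1}"
    hence "exp u \<in> - {1}" by simp
    hence "(neg_li q has_field_derivative deriv (neg_li q) (exp u)) (at (exp u))"
      using holomorphic_derivI[OF holomorphic_neg_li] by blast
    hence "((\<lambda>u. neg_li q (exp u)) has_field_derivative deriv (neg_li q) (exp u) * exp u) (at u)"
      by (rule DERIV_chain2[where f = "neg_li q" and g = exp, OF _ DERIV_exp])
    hence "(F q has_field_derivative - (deriv (neg_li q) (exp u) * exp u) - 0) (at u)"
      unfolding F_def[abs_def] by (intro DERIV_diff DERIV_minus DERIV_const)
    thus "(F q has_field_derivative F (Suc q) u) (at u)" by (simp add: F_def mult.commute)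
  next
    fix u :: complex assume "u \<in> {u. exp u \<noteq> 1}"
    hence "exp u - 1 \<noteq> 0" "1 - exp u \<noteq> 0" by auto
    thus "bose u = F 0 u" by (simp add: F_def bose_def field_simps)
  qed (use assms in simp)
  thus ?thesis using assms by (simp add: F_def)
qed

lemma polylog_zeta_root:
  assumes "0 < k" "k < N" "p > 0"
  shows "polylog (- int p) (zeta_root N ^ k) = - (deriv ^^ p) bose (tpi * (of_nat k / of_nat N))"
proof -
  let ?w = "zeta_root N ^ k"
  have ne: "?w \<noteq> 1"
    using zeta_root_power_eq_1_iff[of N k] assms by (auto dest: nat_dvd_not_less)
  have "norm ?w = 1" by (simp add: zeta_root_def norm_power norm_exp_eq_Re)
  have "?w \<in> slit_plane"
  proof (rule ccontr)
    assume "?w \<notin> slit_plane"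
    hence *: "Im ?w = 0" "Re ?w \<ge> 1" by (auto simp: slit_plane_def)
    moreover have "Re ?w \<le> 1" using complex_Re_le_cmod[of ?w] \<open>norm ?w = 1\<close> by simp
    ultimately have "?w = 1" by (simp add: complex_eq_iff)
    thus False using ne by simp
  qed
  thus ?thesis using ne assms by (simp add: polylog_neg zeta_root_power_tpi neg_li_exp)
qed

text \<open>
  The difference of the indicators of the residue classes of \<open>j\<close> and \<open>-j\<close> modulo \<open>N\<close>, for \<open>0 < j < N\<close>.
\<close>
definition odd_residue :: "nat \<Rightarrow> nat \<Rightarrow> nat \<Rightarrow> complex" where
  "odd_residue N j n = (if n mod N = j then 1 else 0) - (if n mod N = N - j then 1 else 0)"

lemma sums_residue_class:
  assumes j: "0 < j" "j < N" and s: "s \<ge> 2"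
  shows "(\<lambda>m. (if Suc m mod N = j then 1 else 0) / of_nat (Suc m) ^ s) sums
           (\<Sum>k. 1 / of_nat (j + k * N) ^ s :: complex)"
proof -
  let ?f = "\<lambda>n. (if n mod N = j then 1 else 0) / of_nat n ^ s :: complex"
  let ?X = "infsum ?f {0<..}"
  have "dirichlet_abs_conv (\<lambda>n. if n mod N = j then 1 else 0) (of_nat s)"
    by (rule dirichlet_abs_conv_bounded[of _ 1]) (use s in auto)
  hence "(\<lambda>n. (if n mod N = j then 1 else 0) / of_nat n powr of_nat s :: complex) summable_on {0<..}"
    by (simp only: dirichlet_abs_conv_iff)
  also have "?this \<longleftrightarrow> ?f summable_on {0<..}"
    by (intro summable_on_cong) (simp add: powr_nat')
  finally have sum: "(?f has_sum ?X) {0<..}" by simp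
  have "((\<lambda>m. ?f (Suc m)) has_sum ?X) UNIV \<longleftrightarrow> (?f has_sum ?X) {0<..}"
    by (rule has_sum_reindex_bij_witness[of _ "\<lambda>n. n - 1" Suc]) auto
  hence 1: "(\<lambda>m. ?f (Suc m)) sums ?X" using sum has_sum_imp_sums by blast
  have "(?f has_sum ?X) {0<..} \<longleftrightarrow> (?f has_sum ?X) {n. n mod N = j}"
    using j by (intro has_sum_cong_neutral) (auto intro!: Nat.gr0I)
  also have "\<dots> \<longleftrightarrow> ((\<lambda>k. 1 / of_nat (j + k * N) ^ s) has_sum ?X) UNIV"
    by (rule has_sum_reindex_bij_witness[of _ "\<lambda>k. j + k * N" "\<lambda>n. n div N"])
       (use j in \<open>auto simp del: of_nat_add of_nat_mult\<close>)
  finally have "(\<lambda>k. 1 / of_nat (j + k * N) ^ s) sums ?X" using sum has_sum_imp_sums by blast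
  with 1 show ?thesis by (simp add: sums_iff)
qed

text \<open>
  After scaling by \<open>N\<close>, the points \<open>j/N + k\<close> of the polygamma series are the positive integers congruent to \<open>j\<close>.
\<close>
lemma Polygamma_rational:
  assumes j: "0 < j" "j < N" and p: "p > 0"
  shows "Polygamma p (of_nat j / of_nat N :: complex) = (- 1) ^ Suc p * fact p * of_nat N ^ Suc p *
           (\<Sum>m. (if Suc m mod N = j then 1 else 0) / of_nat (Suc m) ^ Suc p)"
proof -
  note sums = sums_residue_class[OF j, of "Suc p"]
  have s: "Suc p \<ge> 2" using p by simp
  have "summable (\<lambda>k. 1 / of_nat (j + k * N) ^ Suc p :: complex)"
  proof (rule summable_comparison_test')
    have "summable (\<lambda>k. inverse (real k ^ Suc p))" by (rule inverse_power_summable[OF s])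
    hence "summable (\<lambda>k. inverse (real (Suc k) ^ Suc p))" by (subst summable_Suc_iff)
    thus "summable (\<lambda>k. inverse (real (Suc k) ^ Suc p))" .
    fix k
    have "real (Suc k) \<le> real (j + k * N)"
    proof -
      have "k * 1 \<le> k * N" using j by (intro mult_le_mono2) auto
      thus ?thesis using j by linarith
    qed
    hence "inverse (real (j + k * N) ^ Suc p) \<le> inverse (real (Suc k) ^ Suc p)"
      by (intro le_imp_inverse_le power_mono zero_less_power) auto
    thus "norm (1 / of_nat (j + k * N) ^ Suc p :: complex) \<le> inverse (real (Suc k) ^ Suc p)"
      by (simp only: norm_divide norm_power norm_of_nat norm_one inverse_eq_divide)
  qed
  from suminf_mult[OF this, of "of_nat N ^ Suc p"]
  have "(\<Sum>k. of_nat N ^ Suc p * (1 / of_nat (j + k * N) ^ Suc p)) =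
          of_nat N ^ Suc p * (\<Sum>k. 1 / of_nat (j + k * N) ^ Suc p :: complex)" .
  moreover have "inverse ((of_nat j / of_nat N + of_nat k) ^ Suc p) =
      (of_nat N ^ Suc p * (1 / of_nat (j + k * N) ^ Suc p) :: complex)" for k
  proof -
    have "(of_nat j / of_nat N + of_nat k :: complex) = of_nat (j + k * N) / of_nat N"
      using j by (simp add: field_simps)
    thus ?thesis by (simp only: power_divide inverse_divide) simp
  qed
  ultimately show ?thesis
    using p sums_unique[OF sums[OF s]] unfolding Polygamma_def by (simp only: mult.assoc) simp
qed

lemma summable_residue_class:
  "0 < j \<Longrightarrow> j < N \<Longrightarrow> s \<ge> 2 \<Longrightarrow>
     summable (\<lambda>m. (if Suc m mod N = j then 1 else 0) / of_nat (Suc m) ^ s :: complex)"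
  using sums_residue_class sums_iff by blast

text \<open>
  The two half-lattices of poles to the left and to the right of \<open>2\<pi>\<i>j/N\<close> give the residue classes of \<open>j\<close> and
  \<open>-j\<close>. For even \<open>p\<close> the poles have odd order \<open>p + 1\<close>, so the two classes enter with opposite signs.
\<close>
lemma higher_deriv_bose_even:
  assumes j: "0 < j" "j < N" and p: "even p" "p > 0"
  shows "(deriv ^^ p) bose (tpi * (of_nat j / of_nat N)) / fact p =
     (of_nat N / tpi) ^ Suc p * (\<Sum>m. odd_residue N j (Suc m) / of_nat (Suc m) ^ Suc p)"
proof -
  let ?s = "\<lambda>j. \<Sum>m. (if Suc m mod N = j then 1 else 0) / of_nat (Suc m) ^ Suc p :: complex"
  have j': "0 < N - j" "N - j < N" using j by auto
  have s: "Suc p \<ge> 2" using p by simp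
  have eq: "1 - of_nat j / of_nat N = (of_nat (N - j) / of_nat N :: complex)"
    using j by (simp add: of_nat_diff field_simps)
  have "(\<Sum>m. odd_residue N j (Suc m) / of_nat (Suc m) ^ Suc p) = ?s j - ?s (N - j)"
    unfolding odd_residue_def diff_divide_distrib
    by (rule suminf_diff[symmetric]) (intro summable_residue_class j j' s)+
  moreover have "(deriv ^^ p) bose (tpi * (of_nat j / of_nat N)) =
      (Polygamma p (of_nat (N - j) / of_nat N) - Polygamma p (of_nat j / of_nat N)) / tpi ^ Suc p"
    using higher_deriv_bose[OF fraction_not_Int[OF j] p(2)] p(1) unfolding eq by simp
  ultimately show ?thesis
    unfolding Polygamma_rational[OF j p(2)] Polygamma_rational[OF j' p(2)]
    using p(1) by (simp add: power_divide diff_divide_distrib right_diff_distrib del: power_Suc)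
qed

text \<open>
  Euler's formula for the zeta values at even integers.
\<close>
lemma bernoulli_number_zeta:
  assumes p: "odd p"
  shows "bernoulli_number (Suc p) / fact (Suc p) = - 2 * (\<Sum>m. 1 / of_nat (Suc m) ^ Suc p) / tpi ^ Suc p"
proof -
  have p0: "p > 0" using p by (intro Nat.gr0I) auto
  have "Polygamma p (1 :: complex) = fact p * (\<Sum>m. 1 / of_nat (Suc m) ^ Suc p)"
    using p p0 by (simp add: Polygamma_def inverse_eq_divide add.commute)
  thus ?thesis
    unfolding bernoulli_number_Suc higher_deriv_bose_reg[OF p0] using p by (simp del: power_Suc of_nat_Suc)
qed

section \<open>The Stokes constants of the two vectors\<close>

lemma dirichlet_series_of_nat:
  "dirichlet_series A (of_nat s) = (\<Sum>m. A (Suc m) / of_nat (Suc m) ^ s)"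
  unfolding dirichlet_series_def by (simp add: powr_nat' del: of_nat_Suc)

lemma
  fixes h :: "nat \<Rightarrow> complex" and a b :: nat
  assumes N: "N > 0" and h: "\<And>n. h (n + N) = h n" and p: "p \<ge> 2"
  defines "T \<equiv> dirichlet_conv (\<lambda>n. h n / of_nat n ^ a) (\<lambda>n. 1 / of_nat n ^ b)"
  shows dirichlet_abs_conv_periodic_conv: "dirichlet_abs_conv T (of_nat p)"
    and moments_periodic_conv: "(\<Sum>m. T (Suc m) / of_nat (Suc m) ^ p) =
          (\<Sum>m. h (Suc m) / of_nat (Suc m) ^ (p + a)) * (\<Sum>m. 1 / of_nat (Suc m) ^ (p + b))"
proof -
  have s: "Re (of_nat p + of_nat c :: complex) > 1" for c using p by simp
  have u: "dirichlet_abs_conv h (of_nat p + of_nat a)"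
    by (rule periodic_dirichlet_abs_conv[of N h, OF N h s])
  have v: "dirichlet_abs_conv (\<lambda>_. 1) (of_nat p + of_nat b)"
    by (rule periodic_dirichlet_abs_conv[of 1 "\<lambda>_. 1", OF _ _ s]) simp_all
  note u' = dirichlet_series_divide_power[OF u] and v' = dirichlet_series_divide_power[OF v]
  show "dirichlet_abs_conv T (of_nat p)"
    unfolding T_def by (rule dirichlet_series_conv(1)[OF u'(1) v'(1)])
  have "dirichlet_series T (of_nat p) = dirichlet_series h (of_nat (p + a)) * dirichlet_series (\<lambda>_. 1) (of_nat (p + b))"
    unfolding T_def dirichlet_series_conv(2)[OF u'(1) v'(1)] u'(2) v'(2) of_nat_add ..
  thus "(\<Sum>m. T (Suc m) / of_nat (Suc m) ^ p) =
          (\<Sum>m. h (Suc m) / of_nat (Suc m) ^ (p + a)) * (\<Sum>m. 1 / of_nat (Suc m) ^ (p + b))"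
    by (simp only: dirichlet_series_of_nat)
qed

text \<open>
  The Stokes constants are \<open>c\<close> times the convolution of \<open>h k n / n\<^sup>a\<close> and \<open>1 / n\<^sup>b\<close>. Their moments factor into
  two Dirichlet series at integers, which is the form that the coefficients of both vectors have, and
  periodicity of \<open>h k\<close> provides the L-functions.
\<close>
theorem vector_modular_resurgent_if_moments:
  fixes h :: "'i \<Rightarrow> nat \<Rightarrow> complex" and a b :: nat and \<epsilon> c A :: complex
  assumes I: "finite I" and N: "N > 0" and A: "A \<noteq> 0"
    and h: "\<And>k n. k \<in> I \<Longrightarrow> h k (n + N) = h k n"
    and \<phi>0: "\<And>k. k \<in> I \<Longrightarrow> fps_nth (\<phi> k) 0 = 0"
    and \<phi>: "\<And>k p. k \<in> I \<Longrightarrow> p \<ge> 2 \<Longrightarrow> fps_nth (\<phi> k) p / fact (p - 1) =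
       (1 + \<epsilon> * (- 1) ^ p) / (2 * of_real pi * \<i> * A ^ p) *
       (c * ((\<Sum>m. h k (Suc m) / of_nat (Suc m) ^ (p + a)) * (\<Sum>m. 1 / of_nat (Suc m) ^ (p + b))))"
  shows "vector_modular_resurgent I \<phi>"
proof -
  define T where "T k n = c * dirichlet_conv (\<lambda>n. h k n / of_nat n ^ a) (\<lambda>n. 1 / of_nat n ^ b) n" for k n
  define S where "S k m = (if m > 0 then T k (nat m) else \<epsilon> * T k (nat (- m)))" for k m
  have abs: "dirichlet_abs_conv (T k) (of_nat p)" if "k \<in> I" "p \<ge> 2" for k p
    unfolding T_def using dirichlet_abs_conv_periodic_conv[of N "h k" p a b, OF N h[OF that(1)] that(2)]
    by (rule dirichlet_series_cmult(1))
  have moment: "(\<Sum>m. T k (Suc m) / of_nat (Suc m) ^ p) =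
      c * ((\<Sum>m. h k (Suc m) / of_nat (Suc m) ^ (p + a)) * (\<Sum>m. 1 / of_nat (Suc m) ^ (p + b)))"
    if "k \<in> I" "p \<ge> 2" for k p
  proof -
    let ?U = "dirichlet_conv (\<lambda>n. h k n / of_nat n ^ a) (\<lambda>n. 1 / of_nat n ^ b)"
    have "dirichlet_series (T k) (of_nat p) = c * dirichlet_series ?U (of_nat p)"
      unfolding T_def
      by (rule dirichlet_series_cmult(2)) (rule dirichlet_abs_conv_periodic_conv[of N "h k" p a b, OF N h[OF that(1)] that(2)])
    thus ?thesis
      unfolding dirichlet_series_of_nat moments_periodic_conv[of N "h k" p a b, OF N h[OF that(1)] that(2)] .
  qed
  have summable: "summable (\<lambda>m. norm (T k (Suc m)) / real (Suc m) ^ 2)" if "k \<in> I" for k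
  proof -
    have "summable (\<lambda>m. norm (T k (Suc m) / of_nat (Suc m) powr of_nat 2))"
      using abs[OF that, of 2] unfolding dirichlet_abs_conv_def by simp
    also have "(\<lambda>m. norm (T k (Suc m) / of_nat (Suc m) powr of_nat 2)) = (\<lambda>m. norm (T k (Suc m)) / real (Suc m) ^ 2)"
    proof
      fix m
      have "(of_nat (Suc m) :: complex) powr of_nat 2 = of_nat (Suc m) ^ 2" by (rule powr_nat') simp
      thus "norm (T k (Suc m) / of_nat (Suc m) powr of_nat 2) = norm (T k (Suc m)) / real (Suc m) ^ 2"
        by (simp only: norm_divide norm_power norm_of_nat)
    qed
    finally show ?thesis .
  qed
  have coeff: "fps_nth (\<phi> k) p / fact (p - 1) =
      (1 + \<epsilon> * (- 1) ^ p) / (2 * of_real pi * \<i> * A ^ p) * (\<Sum>m. T k (Suc m) / of_nat (Suc m) ^ p)"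
    if "k \<in> I" "p \<ge> 2" for k p
    unfolding moment[OF that] by (rule \<phi>[OF that])
  have res: "gevrey1 (\<phi> k)"
    "\<exists>f. borel_continuation (\<phi> k) A f \<and> (\<forall>m. m \<noteq> 0 \<longrightarrow> has_stokes_constant f (A * of_int m) (S k m))"
    if k: "k \<in> I" for k
    unfolding S_def using resurgent_if_moments[OF A summable[OF k] \<phi>0[OF k] coeff[OF k]] by blast+
  have comb: "L_combination (T k)" if "k \<in> I" for k
    unfolding T_def by (intro L_combination_cmult L_combination_periodic[of N "h k", OF N h[OF that]])
  \<comment> \<open>the divisors of \<open>0\<close> form an infinite set, over which a sum is \<open>0\<close>; so \<open>S k 0\<close>, which falls under the negative case, agrees with \<open>T k 0\<close>\<close>
  have T0: "T k 0 = 0" for k by (simp add: T_def dirichlet_conv_def)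
  have "(\<lambda>k m. S k (int m)) = T" "(\<lambda>k m. - S k (- int m)) = (\<lambda>k m. (- \<epsilon>) * T k m)"
    by (auto simp: S_def T0 fun_eq_iff)
  hence "\<exists>v. L_decomposition I v (\<lambda>k m. S k (int m)) \<and> L_decomposition I v (\<lambda>k m. - S k (- int m))"
    using L_combination_imp_L_decomposition[of I T "\<lambda>k m. (- \<epsilon>) * T k m", OF I comb L_combination_cmult[OF comb]]
    by simp
  thus ?thesis unfolding vector_modular_resurgent_def using I res A by blast
qed

lemma odd_residue_periodic: "odd_residue N j (n + N) = odd_residue N j n"
  by (simp add: odd_residue_def)

lemma odd_residue_minus: "j \<le> N \<Longrightarrow> odd_residue N (N - j) n = - odd_residue N j n"
  by (simp add: odd_residue_def)

lemma summable_odd_residue: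
  assumes j: "0 < j" "j < N" and s: "s \<ge> 2"
  shows "summable (\<lambda>m. odd_residue N j (Suc m) / of_nat (Suc m) ^ s)"
proof -
  have j': "0 < N - j" "N - j < N" using j by auto
  from summable_diff[OF summable_residue_class[OF j s] summable_residue_class[OF j' s]]
  show ?thesis unfolding odd_residue_def diff_divide_distrib .
qed

text \<open>
  Passing from \<open>k\<close> to \<open>N - k\<close> changes the sign of \<open>odd_residue\<close>, so the difference doubles the
  polylogarithm.
\<close>
lemma psi_difference_coeff:
  assumes k: "0 < k" "k < N" and p: "odd p" "p \<ge> 2"
  shows "fps_nth (psi_series N k - psi_series N (N - k)) p / fact (p - 1) =
    4 * of_nat N ^ p / tpi ^ Suc p *
    ((\<Sum>m. odd_residue N k (Suc m) / of_nat (Suc m) ^ p) * (\<Sum>m. 1 / of_nat (Suc m) ^ Suc p))"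
proof -
  define q where "q = p - 1"
  have q: "p = Suc q" "even q" "q > 0" using p by (auto simp: q_def)
  have k': "0 < N - k" "N - k < N" using k by auto
  let ?D = "\<lambda>j. \<Sum>m. odd_residue N j (Suc m) / of_nat (Suc m) ^ Suc q"
  have li: "polylog (1 - int p) (zeta_root N ^ j) / fact q = - ((of_nat N / tpi) ^ Suc q * ?D j)"
    if j: "0 < j" "j < N" for j
  proof -
    have "1 - int p = - int q" using q by simp
    thus ?thesis
      using polylog_zeta_root[OF j q(3)] higher_deriv_bose_even[OF j q(2,3)] by simp
  qed
  have "?D (N - k) = (\<Sum>m. - (odd_residue N k (Suc m) / of_nat (Suc m) ^ Suc q))"
    using k by (simp add: odd_residue_minus)
  also have "\<dots> = - ?D k"
    by (rule suminf_minus[OF summable_odd_residue[OF k]]) (use q in simp)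
  finally have D: "?D (N - k) = - ?D k" .
  have "fps_nth (psi_series N k - psi_series N (N - k)) p / fact q =
      tpi ^ p * (bernoulli_number (Suc p) / fact (Suc p)) *
      (polylog (1 - int p) (zeta_root N ^ k) / fact q - polylog (1 - int p) (zeta_root N ^ (N - k)) / fact q)"
    using p(1) by (simp add: psi_series_def tpi_def right_diff_distrib diff_divide_distrib del: fact_Suc)
  also have "\<dots> = tpi ^ p * (- 2 * (\<Sum>m. 1 / of_nat (Suc m) ^ Suc p) / tpi ^ Suc p) *
      (- 2 * ((of_nat N / tpi) ^ p * ?D k))"
  proof -
    have "- (x * d) - - (x * - d) = - 2 * (x * d)" for x d :: complex by simp
    thus ?thesis
      unfolding li[OF k] li[OF k'] D bernoulli_number_zeta[OF p(1)] unfolding q(1)[symmetric] by (simp only:)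
  qed
  also have "\<dots> = 4 * of_nat N ^ p / tpi ^ Suc p * (?D k * (\<Sum>m. 1 / of_nat (Suc m) ^ Suc p))"
    by (simp add: power_divide del: of_nat_Suc)
  finally show ?thesis unfolding q_def[symmetric] q(1)[symmetric] .
qed

text \<open>
  In closed form this is \<open>-4 \<i> sin(2\<pi>nk/N)\<close>; the expansion in \<open>odd_residue\<close> is the form in which it arises
  from the Bernoulli polynomials.
\<close>
definition phi_weight :: "nat \<Rightarrow> nat \<Rightarrow> nat \<Rightarrow> complex" where
  "phi_weight N k n =
     (\<Sum>j\<in>{1..<N}. (zeta_root N ^ (j * (N - k)) - zeta_root N ^ (j * k)) * odd_residue N j n)"

text \<open>
  The contribution of \<open>bose_reg\<close> does not depend on \<open>k\<close> and cancels.
\<close>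
lemma bernoulli_poly_difference:
  assumes k: "0 < k" "k < N" and p: "even p" "p > 0"
  shows "(bernoulli_poly (Suc p) (of_nat k / of_nat N) - bernoulli_poly (Suc p) (of_nat (N - k) / of_nat N)) / fact (Suc p)
     = (\<Sum>m. phi_weight N k (Suc m) / of_nat (Suc m) ^ Suc p) / tpi ^ Suc p"
proof -
  have k': "0 < N - k" "N - k < N" "N - (N - k) = k" using k by auto
  let ?z = "zeta_root N" and ?n = "of_nat N :: complex"
  let ?b = "\<lambda>j. (deriv ^^ p) bose (tpi * (of_nat j / ?n)) / fact p"
  let ?D = "\<lambda>j. \<Sum>m. odd_residue N j (Suc m) / of_nat (Suc m) ^ Suc p"
  have "(bernoulli_poly (Suc p) (of_nat k / ?n) - bernoulli_poly (Suc p) (of_nat (N - k) / ?n)) / fact (Suc p)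
     = (\<Sum>j\<in>{1..<N}. (?z ^ (j * (N - k)) - ?z ^ (j * k)) * ?b j) / ?n ^ Suc p"
    unfolding diff_divide_distrib bernoulli_poly_rational[OF k] bernoulli_poly_rational[OF k'(1,2)] k'(3)
      left_diff_distrib sum_subtractf by (simp add: add_divide_distrib del: power_Suc)
  also have "(\<Sum>j\<in>{1..<N}. (?z ^ (j * (N - k)) - ?z ^ (j * k)) * ?b j) =
      (\<Sum>j\<in>{1..<N}. (?n / tpi) ^ Suc p * ((?z ^ (j * (N - k)) - ?z ^ (j * k)) * ?D j))"
  proof (rule sum.cong)
    fix j assume "j \<in> {1..<N}"
    hence j: "0 < j" "j < N" by auto
    show "(?z ^ (j * (N - k)) - ?z ^ (j * k)) * ?b j =
        (?n / tpi) ^ Suc p * ((?z ^ (j * (N - k)) - ?z ^ (j * k)) * ?D j)"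
      unfolding higher_deriv_bose_even[OF j p] by (rule mult.left_commute)
  qed simp
  also have "\<dots> = (?n / tpi) ^ Suc p * (\<Sum>j\<in>{1..<N}. (?z ^ (j * (N - k)) - ?z ^ (j * k)) * ?D j)"
    by (rule sum_distrib_left[symmetric])
  also have "(\<Sum>j\<in>{1..<N}. (?z ^ (j * (N - k)) - ?z ^ (j * k)) * ?D j) =
      (\<Sum>j\<in>{1..<N}. \<Sum>m. (?z ^ (j * (N - k)) - ?z ^ (j * k)) * (odd_residue N j (Suc m) / of_nat (Suc m) ^ Suc p))"
    by (intro sum.cong refl suminf_mult[symmetric] summable_odd_residue) (use p in auto)
  also have "\<dots> = (\<Sum>m. \<Sum>j\<in>{1..<N}. (?z ^ (j * (N - k)) - ?z ^ (j * k)) * (odd_residue N j (Suc m) / of_nat (Suc m) ^ Suc p))"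
    by (intro suminf_sum[symmetric] summable_mult summable_odd_residue) (use p in auto)
  also have "\<dots> = (\<Sum>m. phi_weight N k (Suc m) / of_nat (Suc m) ^ Suc p)"
    unfolding phi_weight_def sum_divide_distrib times_divide_eq_right ..
  finally show ?thesis using k by (simp add: power_divide)
qed

lemma phi_difference_coeff:
  assumes k: "0 < k" "k < N" and p: "even p" "p \<ge> 2"
  shows "fps_nth (phi_series N k - phi_series N (N - k)) p / fact (p - 1) =
    - 2 / tpi ^ Suc p *
    ((\<Sum>m. phi_weight N k (Suc m) / of_nat (Suc m) ^ Suc p) * (\<Sum>m. 1 / of_nat (Suc m) ^ p))"
proof -
  define q where "q = p - 1"
  have q: "p = Suc q" "odd q" using p by (auto simp: q_def)
  have p0: "p > 0" using p by simp
  let ?b = "\<lambda>j. bernoulli_poly (Suc p) (of_nat j / of_nat N)"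
  have fact_p: "fact p = of_nat p * (fact q :: complex)" unfolding q by simp
  have "fps_nth (phi_series N k - phi_series N (N - k)) p / fact q =
      tpi ^ p * (bernoulli_number p / fact p) * ((?b k - ?b (N - k)) / fact (Suc p))"
    unfolding fact_p using p(1) p0
    by (simp add: phi_series_def tpi_def right_diff_distrib diff_divide_distrib mult_ac del: fact_Suc)
  also have "\<dots> = tpi ^ p * (- 2 * (\<Sum>m. 1 / of_nat (Suc m) ^ p) / tpi ^ p) *
      ((\<Sum>m. phi_weight N k (Suc m) / of_nat (Suc m) ^ Suc p) / tpi ^ Suc p)"
    unfolding bernoulli_poly_difference[OF k p(1) p0] using bernoulli_number_zeta[OF q(2)] unfolding q(1)[symmetric] by simp
  also have "\<dots> = - 2 / tpi ^ Suc p *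
      ((\<Sum>m. phi_weight N k (Suc m) / of_nat (Suc m) ^ Suc p) * (\<Sum>m. 1 / of_nat (Suc m) ^ p))"
    by (simp add: mult_ac del: of_nat_Suc power_Suc)
  finally show ?thesis by (simp only: q_def)
qed

theorem proposition3p2:
  fixes N :: nat
  assumes "N \<ge> 3"
  shows "vector_modular_resurgent (G_plus N) (\<lambda>k. psi_series N k - psi_series N (N - k)) \<and>
         vector_modular_resurgent (G_plus N) (\<lambda>k. phi_series N k - phi_series N (N - k))"
proof
  have N: "N > 0" using assms by simp
  have fin: "finite (G_plus N)"
    by (rule finite_subset[of _ "{..N}"]) (auto simp: G_plus_def)
  have k: "0 < k" "k < N" if "k \<in> G_plus N" for k
    using that assms by (auto simp: G_plus_def)
  show "vector_modular_resurgent (G_plus N) (\<lambda>k. psi_series N k - psi_series N (N - k))"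
  proof (rule vector_modular_resurgent_if_moments[where A = "tpi / of_nat N" and N = N and h = "odd_residue N"
        and a = 0 and b = 1 and c = 2 and \<epsilon> = "- 1"])
    show "tpi / of_nat N \<noteq> 0" using N by simp
    show "fps_nth (psi_series N k - psi_series N (N - k)) 0 = 0" for k
      by (simp add: psi_series_def)
    fix k p assume "k \<in> G_plus N" and p: "(2::nat) \<le> p"
    note k = k[OF this(1)]
    let ?s = "(\<Sum>m. odd_residue N k (Suc m) / of_nat (Suc m) ^ (p + 0)) * (\<Sum>m. 1 / of_nat (Suc m) ^ (p + 1))"
    show "fps_nth (psi_series N k - psi_series N (N - k)) p / fact (p - 1) =
        (1 + - 1 * (- 1) ^ p) / (2 * of_real pi * \<i> * (tpi / of_nat N) ^ p) * (2 * ?s)"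
    proof (cases "odd p")
      case True
      have "fps_nth (psi_series N k - psi_series N (N - k)) p / fact (p - 1) = 4 * of_nat N ^ p / tpi ^ Suc p * ?s"
        using psi_difference_coeff[OF k True p] by simp
      also have "4 * of_nat N ^ p / tpi ^ Suc p * ?s =
          (1 + - 1 * (- 1) ^ p) / (tpi * (tpi / of_nat N) ^ p) * (2 * ?s)"
        using True N by (simp add: power_divide field_simps)
      finally show ?thesis unfolding tpi_def .
    qed (simp add: psi_series_def)
  qed (simp_all add: fin N odd_residue_periodic)
  show "vector_modular_resurgent (G_plus N) (\<lambda>k. phi_series N k - phi_series N (N - k))"
  proof (rule vector_modular_resurgent_if_moments[where A = tpi and N = N and h = "phi_weight N"
        and a = 1 and b = 0 and c = "- 1" and \<epsilon> = 1])
    show "phi_weight N k (n + N) = phi_weight N k n" for k n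
      by (simp add: phi_weight_def odd_residue_periodic)
    show "fps_nth (phi_series N k - phi_series N (N - k)) 0 = 0" for k
      by (simp add: phi_series_def)
    fix k p assume "k \<in> G_plus N" and p: "(2::nat) \<le> p"
    note k = k[OF this(1)]
    let ?s = "(\<Sum>m. phi_weight N k (Suc m) / of_nat (Suc m) ^ (p + 1)) * (\<Sum>m. 1 / of_nat (Suc m) ^ (p + 0))"
    show "fps_nth (phi_series N k - phi_series N (N - k)) p / fact (p - 1) =
        (1 + 1 * (- 1) ^ p) / (2 * of_real pi * \<i> * tpi ^ p) * (- 1 * ?s)"
    proof (cases "even p")
      case True
      have "fps_nth (phi_series N k - phi_series N (N - k)) p / fact (p - 1) = - 2 / tpi ^ Suc p * ?s"
        using phi_difference_coeff[OF k True p] by simp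
      also have "\<dots> = (1 + 1 * (- 1) ^ p) / (tpi * tpi ^ p) * (- 1 * ?s)"
        using True by simp
      finally show ?thesis unfolding tpi_def .
    qed (simp add: phi_series_def)
  qed (simp_all add: fin N)
qed

end
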